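(* Let $X$ be a multifractional Brownian motion with continuous Hurst function $H:\mathbf{R}\to(0,1)$. Then, with probability one, $$\forall t\in\mathbf{R}\setminus\{0\};\qquad \dim_{\mathrm H,t}\,\mathrm{Gr}(X)=1+H(t)\Bigl(\dim_{\mathrm H,t}\bigl(\mathrm{Gr}(H)\,;\varrho_{H(t)}\bigr)-1\Bigr).$$
   Context: Let $W$ be a Wiener measure (Gaussian white noise) on $\mathbf{R}$. For $t\in\mathbf{R}$, $H\in(0,1)$, let $$B^\pm(t,H)=\frac{1}{\Gamma(H+\frac12)}\int_{\mathbf{R}}\bigl[(t-u)_\pm^{H-1/2}-(-u)_\pm^{H-1/2}\bigr]\,dW_u,$$ where $x_+=\max(x,0)$, $x_-=\max(-x,0)$ and $x_\pm^{a}:=0$ when $x_\pm=0$. Fix reals $(a^+,a^-)\neq(0,0)$ with $a^+\neq a^-$ and let $B(t,H)=a^+B^+(t,H)+a^-B^-(t,H)$ be the fractional Brownian field, always taken in its version which is almost surely jointly continuous in $(t,H)$ and infinitely differentiable in $H$, with jointly continuous derivatives. The multifractional Brownian motion with Hurst function $H(\cdot)$ is $X_t=B(t,H(t))$. For a function $f:\mathbf{R}\to\mathbf{R}$ and $V\subset\mathbf{R}$, $\mathrm{Gr}(f,V)=\{(t,f(t)):t\in V\}$; $\dim_{\mathrm H}$ is the usual (Euclidean) Hausdorff dimension, and $\dim_{\mathrm H,t}\,\mathrm{Gr}(f)=\lim_{\rho\to0}\dim_{\mathrm H}\mathrm{Gr}(f,B(t,\rho))$, with $B(t,\rho)$ the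 ball of centre $t$ and radius $\rho$. Parabolic Hausdorff dimension: for $h>0$ let $\varrho_h((u,x);(v,y))=\max(|u-v|^{h},|x-y|)$ on $\mathbf{R}^2$. For $A\subset\mathbf{R}^2$, $\dim_{\mathrm H}(A;\varrho_h)$ is the Hausdorff dimension of $A$ relative to $\varrho_h$, i.e. the infimum of the $s\ge0$ for which $\lim_{\delta\to0}\inf\{\sum_{i}\mathrm{diam}(O_i;\varrho_h)^s : (O_i)_{i\in\mathbf N}\text{ is a }\delta\text{-cover of }A\text{ (w.r.t. }\varrho_h)\}<\infty$. Its local version on the graph is $\dim_{\mathrm H,t}(\mathrm{Gr}(f);\varrho_h)=\lim_{\rho\to0}\dim_{\mathrm H}(\mathrm{Gr}(f,B(t,\rho));\varrho_h)$. *)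

theory Defs
  imports "HOL-Probability.Probability"
begin

section \<open>Gaussian white noise and the Wiener integral\<close>

text \<open>
  A Gaussian white noise on the line with Lebesgue control measure: an independently scattered,
  almost surely countably additive random set function with centred Gaussian values, the variance
  of \<open>W A\<close> being the Lebesgue measure of \<open>A\<close>. Only Borel sets of finite measure matter;
  null sets are treated separately because \<open>normal_density 0 0\<close> is not the density of a Dirac mass.
\<close>
definition white_noise :: "'a measure \<Rightarrow> (real set \<Rightarrow> 'a \<Rightarrow> real) \<Rightarrow> bool" where
  "white_noise M W \<longleftrightarrow>
     prob_space M \<and>
     (\<forall>A \<in> sets borel. 0 < emeasure lborel A \<longrightarrow> emeasure lborel A < \<infinity> \<longrightarrow>
        distributed M lborel (W A) (\<lambda>x. ennreal (normal_density 0 (sqrt (measure lborel A)) x))) \<and>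
     (\<forall>A \<in> sets borel. emeasure lborel A = 0 \<longrightarrow>
        W A \<in> borel_measurable M \<and> (AE \<omega> in M. W A \<omega> = 0)) \<and>
     (\<forall>A :: nat \<Rightarrow> real set.
        disjoint_family A \<longrightarrow> (\<forall>i. A i \<in> sets borel \<and> emeasure lborel (A i) < \<infinity>) \<longrightarrow>
        prob_space.indep_vars M (\<lambda>_. borel) (\<lambda>i. W (A i)) UNIV) \<and>
     (\<forall>A :: nat \<Rightarrow> real set.
        disjoint_family A \<longrightarrow> (\<forall>i. A i \<in> sets borel) \<longrightarrow> emeasure lborel (\<Union>i. A i) < \<infinity> \<longrightarrow>
        (AE \<omega> in M. (\<lambda>i. W (A i) \<omega>) sums W (\<Union>i. A i) \<omega>))"

text \<open>
  As for \<^const>\<open>Bochner_Integration.simple_bochner_integral\<close>, the term for the value \<open>0\<close>, whose level set has infinite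
  measure, vanishes.
\<close>
definition simple_wiener_integral ::
  "(real set \<Rightarrow> 'a \<Rightarrow> real) \<Rightarrow> (real \<Rightarrow> real) \<Rightarrow> 'a \<Rightarrow> real" where
  "simple_wiener_integral W s \<omega> = (\<Sum>y \<in> range s. y * W {u. s u = y} \<omega>)"

text \<open>
  \<open>Y\<close> is a version of the integral of the deterministic function \<open>f\<close> with respect to \<open>W\<close>, i.e. the
  mean-square limit of the integrals of simple functions converging to \<open>f\<close> in \<open>L\<^sup>2(\<real>)\<close>. It is a
  relation because the integral is determined only up to almost sure equality.
\<close>
definition has_wiener_integral ::
  "'a measure \<Rightarrow> (real set \<Rightarrow> 'a \<Rightarrow> real) \<Rightarrow> (real \<Rightarrow> real) \<Rightarrow> ('a \<Rightarrow> real) \<Rightarrow> bool" where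
  "has_wiener_integral M W f Y \<longleftrightarrow>
     f \<in> borel_measurable lborel \<and> Y \<in> borel_measurable M \<and>
     (\<exists>s. (\<forall>n. Bochner_Integration.simple_bochner_integrable lborel (s n)) \<and>
        (\<lambda>n. \<integral>\<^sup>+u. ennreal ((f u - s n u)\<^sup>2) \<partial>lborel) \<longlonglongrightarrow> 0 \<and>
        (\<lambda>n. \<integral>\<^sup>+\<omega>. ennreal ((Y \<omega> - simple_wiener_integral W (s n) \<omega>)\<^sup>2) \<partial>M) \<longlonglongrightarrow> 0)"

section \<open>The fractional Brownian field and multifractional Brownian motion\<close>

text \<open>Both powers vanish when the truncated base is \<open>0\<close>, since \<open>0 powr a = 0\<close> also for \<open>a \<le> 0\<close>.\<close>
definition pos_powr :: "real \<Rightarrow> real \<Rightarrow> real" where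
  "pos_powr x a = max x 0 powr a"

definition neg_powr :: "real \<Rightarrow> real \<Rightarrow> real" where
  "neg_powr x a = max (- x) 0 powr a"

definition fractional_brownian_field_version ::
  "'a measure \<Rightarrow> (real set \<Rightarrow> 'a \<Rightarrow> real) \<Rightarrow> real \<Rightarrow> real \<Rightarrow> (real \<Rightarrow> real \<Rightarrow> 'a \<Rightarrow> real) \<Rightarrow> bool" where
  "fractional_brownian_field_version M W ap am B \<longleftrightarrow>
     (\<forall>t. \<forall>H \<in> {0<..<1}. B t H \<in> borel_measurable M \<and>
        (\<exists>Ip Im.
           has_wiener_integral M W (\<lambda>u. pos_powr (t - u) (H - 1/2) - pos_powr (- u) (H - 1/2)) Ip \<and>
           has_wiener_integral M W (\<lambda>u. neg_powr (t - u) (H - 1/2) - neg_powr (- u) (H - 1/2)) Im \<and>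
           (AE \<omega> in M. B t H \<omega> =
              ap * (1 / Gamma (H + 1/2) * Ip \<omega>) + am * (1 / Gamma (H + 1/2) * Im \<omega>))))"

text \<open>\<open>D n\<close> is the \<open>n\<close>-th partial derivative with respect to the second variable.\<close>
definition jointly_smooth_in_H :: "(real \<Rightarrow> real \<Rightarrow> real) \<Rightarrow> bool" where
  "jointly_smooth_in_H b \<longleftrightarrow>
     (\<exists>D :: nat \<Rightarrow> real \<Rightarrow> real \<Rightarrow> real.
        (\<forall>t. \<forall>H \<in> {0<..<1}. D 0 t H = b t H) \<and>
        (\<forall>n t. \<forall>H \<in> {0<..<1}. (D n t has_real_derivative D (Suc n) t H) (at H)) \<and>
        (\<forall>n. continuous_on (UNIV \<times> {0<..<1}) (\<lambda>(t, H). D n t H)))"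

definition fractional_brownian_field ::
  "'a measure \<Rightarrow> (real set \<Rightarrow> 'a \<Rightarrow> real) \<Rightarrow> real \<Rightarrow> real \<Rightarrow> (real \<Rightarrow> real \<Rightarrow> 'a \<Rightarrow> real) \<Rightarrow> bool" where
  "fractional_brownian_field M W ap am B \<longleftrightarrow>
     fractional_brownian_field_version M W ap am B \<and>
     (AE \<omega> in M. jointly_smooth_in_H (\<lambda>t H. B t H \<omega>))"

definition multifractional_brownian_motion ::
  "(real \<Rightarrow> real \<Rightarrow> 'a \<Rightarrow> real) \<Rightarrow> (real \<Rightarrow> real) \<Rightarrow> 'a \<Rightarrow> real \<Rightarrow> real" where
  "multifractional_brownian_motion B H \<omega> t = B t (H t) \<omega>"

section \<open>Hausdorff dimension relative to a distance function\<close>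

definition ediam :: "('b \<Rightarrow> 'b \<Rightarrow> real) \<Rightarrow> 'b set \<Rightarrow> ennreal" where
  "ediam d S = (SUP x \<in> S. SUP y \<in> S. ennreal (d x y))"

definition delta_covers :: "('b \<Rightarrow> 'b \<Rightarrow> real) \<Rightarrow> real \<Rightarrow> 'b set \<Rightarrow> (nat \<Rightarrow> 'b set) set" where
  "delta_covers d \<delta> A = {C. A \<subseteq> (\<Union>i. C i) \<and> (\<forall>i. ediam d (C i) \<le> ennreal \<delta>)}"

text \<open>
  The diameters are finite here, so \<^const>\<open>enn2real\<close> loses nothing. For \<open>s = 0\<close> the convention
  \<open>0 powr 0 = 0\<close> applies; it affects only the outer measure for \<open>s = 0\<close>, not the dimension.
\<close>
definition hausdorff_pre :: "('b \<Rightarrow> 'b \<Rightarrow> real) \<Rightarrow> real \<Rightarrow> 'b set \<Rightarrow> real \<Rightarrow> ennreal" where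
  "hausdorff_pre d s A \<delta> =
     (INF C \<in> delta_covers d \<delta> A. \<Sum>i. ennreal (enn2real (ediam d (C i)) powr s))"

definition hausdorff_outer :: "('b \<Rightarrow> 'b \<Rightarrow> real) \<Rightarrow> real \<Rightarrow> 'b set \<Rightarrow> ennreal" where
  "hausdorff_outer d s A = Lim (at_right 0) (hausdorff_pre d s A)"

definition hausdorff_dim :: "('b \<Rightarrow> 'b \<Rightarrow> real) \<Rightarrow> 'b set \<Rightarrow> ereal" where
  "hausdorff_dim d A = Inf (ereal ` {s. 0 \<le> s \<and> hausdorff_outer d s A < \<infinity>})"

definition graph_on :: "(real \<Rightarrow> real) \<Rightarrow> real set \<Rightarrow> (real \<times> real) set" where
  "graph_on f V = (\<lambda>t. (t, f t)) ` V"

definition local_graph_dim ::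
  "(real \<times> real \<Rightarrow> real \<times> real \<Rightarrow> real) \<Rightarrow> (real \<Rightarrow> real) \<Rightarrow> real \<Rightarrow> ereal" where
  "local_graph_dim d f t = Lim (at_right 0) (\<lambda>r. hausdorff_dim d (graph_on f (ball t r)))"

definition parabolic_dist :: "real \<Rightarrow> real \<times> real \<Rightarrow> real \<times> real \<Rightarrow> real" where
  "parabolic_dist h p q = max (\<bar>fst p - fst q\<bar> powr h) \<bar>snd p - snd q\<bar>"

text \<open>Both limits above are monotone, hence exist.\<close>

lemma hausdorff_pre_tendsto:
  "(hausdorff_pre d s A \<longlongrightarrow> hausdorff_outer d s A) (at_right 0)"
proof -
  let ?f = "hausdorff_pre d s A" and ?L = "SUP \<delta>\<in>{0<..}. hausdorff_pre d s A \<delta>"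
  have anti: "?f y \<le> ?f x" if "x \<le> y" for x y
    unfolding hausdorff_pre_def
    by (rule INF_superset_mono)
       (use that in \<open>auto simp: delta_covers_def intro: order_trans ennreal_leI\<close>)
  have "(?f \<longlongrightarrow> ?L) (at_right 0)"
  proof (rule order_tendstoI)
    fix a assume "a < ?L"
    then obtain \<delta> where d: "\<delta> > 0" "a < ?f \<delta>" by (auto simp: less_SUP_iff)
    have "a < ?f x" if "0 < x" "x < \<delta>" for x
      using anti[of x \<delta>] that d(2) by (auto intro: less_le_trans)
    then show "\<forall>\<^sub>F x in at_right 0. a < ?f x"
      using d(1) unfolding eventually_at_right_field by blast
  next
    fix a assume a: "?L < a"
    have "?f x < a" if "0 < x" for x
      using that by (intro le_less_trans[OF SUP_upper a]) auto
    then show "\<forall>\<^sub>F x in at_right 0. ?f x < a"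
      unfolding eventually_at_right_field by (intro exI[of _ 1]) auto
  qed
  moreover from this have "hausdorff_outer d s A = ?L"
    unfolding hausdorff_outer_def by (intro tendsto_Lim) auto
  ultimately show ?thesis by simp
qed

lemma hausdorff_dim_mono:
  assumes "A \<subseteq> A'"
  shows "hausdorff_dim d A \<le> hausdorff_dim d A'"
proof -
  have "hausdorff_outer d s A \<le> hausdorff_outer d s A'" for s
  proof (rule tendsto_le[OF _ hausdorff_pre_tendsto hausdorff_pre_tendsto])
    show "\<forall>\<^sub>F x in at_right 0. hausdorff_pre d s A x \<le> hausdorff_pre d s A' x"
      unfolding hausdorff_pre_def
      by (intro always_eventually allI INF_superset_mono)
         (use assms in \<open>auto simp: delta_covers_def\<close>)
  qed simp
  then show ?thesis
    unfolding hausdorff_dim_def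
    by (intro Inf_superset_mono image_mono) (auto intro: le_less_trans)
qed

lemma local_graph_dim_tendsto:
  "((\<lambda>r. hausdorff_dim d (graph_on f (ball t r))) \<longlongrightarrow> local_graph_dim d f t) (at_right 0)"
proof -
  let ?f = "\<lambda>r. hausdorff_dim d (graph_on f (ball t r))" and
      ?L = "INF r\<in>{0<..}. hausdorff_dim d (graph_on f (ball t r))"
  have mono: "?f x \<le> ?f y" if "x \<le> y" for x y
    by (rule hausdorff_dim_mono) (use that in \<open>auto simp: graph_on_def\<close>)
  have "(?f \<longlongrightarrow> ?L) (at_right 0)"
  proof (rule order_tendstoI)
    fix a assume "?L < a"
    then obtain r where d: "r > 0" "?f r < a" by (auto simp: INF_less_iff)
    have "?f x < a" if "0 < x" "x < r" for x
      using mono[of x r] that d(2) by (auto intro: le_less_trans)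
    then show "\<forall>\<^sub>F x in at_right 0. ?f x < a"
      using d(1) unfolding eventually_at_right_field by blast
  next
    fix a assume a: "a < ?L"
    have "a < ?f x" if "0 < x" for x
      using that by (intro less_le_trans[OF a INF_lower]) auto
    then show "\<forall>\<^sub>F x in at_right 0. a < ?f x"
      unfolding eventually_at_right_field by (intro exI[of _ 1]) auto
  qed
  moreover from this have "local_graph_dim d f t = ?L"
    unfolding local_graph_dim_def by (intro tendsto_Lim) auto
  ultimately show ?thesis by simp
qed

end

theory Submission
  imports Defs "HOL-Real_Asymp.Real_Asymp"
begin

text \<open>
  By smoothness in \<open>H\<close>, an increment \<open>X u - X v\<close> of the motion is bounded by a constant times
  \<open>\<bar>u - v\<bar> powr g + \<bar>H u - H v\<bar>\<close> for every \<open>g < H t\<close> near \<open>t\<close>. Hence over a piece of the graph of \<open>H\<close> of parabolic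
  diameter \<open>r\<close>, which has time length \<open>r powr (1 / g)\<close>, the graph of \<open>X\<close> is covered by about \<open>r powr (1 - 1 / g)\<close>
  squares of side \<open>r powr (1 / g)\<close>, and this gives the upper bound.

  For the lower bound, away from time \<open>0\<close> the standard deviation of \<open>X u - X v\<close> is at least a constant times the parabolic
  distance \<open>\<rho>\<close> of the corresponding points of the graph of \<open>H\<close>, so the expectation of the \<open>s'\<close>-energy kernel of the graph of \<open>X\<close>
  at \<open>u, v\<close> is at most a constant times \<open>\<bar>u - v\<bar> powr (1 - s') / \<rho>\<close>. Integrated against a Frostman measure of
  exponent \<open>s\<close> on the graph of \<open>H\<close> this is finite as soon as \<open>s' < 1 + h * (s - 1)\<close>: the set of \<open>v\<close> with
  \<open>\<bar>u - v\<bar> \<le> \<tau>\<close> and \<open>\<rho> \<le> r\<close> is covered by about \<open>r / \<tau> powr h\<close> parabolic balls of radius \<open>\<tau> powr h\<close>, so a dyadic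
  block of the integral is of order \<open>\<tau> powr (1 - s' + h * (s - 1))\<close> whatever \<open>r\<close> is.
\<close>

section \<open>Hausdorff measures and dimensions\<close>

text \<open>The exceptional null set must not depend on \<open>t\<close>, although the exponent
  \<open>H t\<close> varies with \<open>t\<close>. Both bounds are therefore proved almost surely
  for countably many rational data, and a given \<open>t\<close> is reached by perturbing the
  exponent: \<open>g < H t\<close> above, \<open>h > H t\<close> below. Lowering the exponent of the
  parabolic distance multiplies the dimension by at most the ratio of the exponents, so the
  perturbation is free in the limit. Below, its direction is dictated by the variance bound, which
  is proved where the Hurst function stays at most \<open>h\<close>. That bound has two regimes.
  When the time term dominates, the singularities at the two times contribute; this rests on their
  different coefficients, \<open>ap \<noteq> am\<close>. When the Hurst term dominates, the kernels
  are compared far out; \<open>t \<noteq> 0\<close> matters there because the field vanishes at time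
  \<open>0\<close> whatever the Hurst parameter. The Frostman measures are deterministic and
  finitely supported, one for each dyadic level, with an energy kernel truncated at a matching
  scale. No weak limit occurs: Fatou's lemma bounds the energies along infinitely many levels, and
  this is enough.\<close>

lemma ediam_le:
  assumes "\<And>x y. x \<in> S \<Longrightarrow> y \<in> S \<Longrightarrow> d x y \<le> r"
  shows "ediam d S \<le> ennreal r"
  unfolding ediam_def using assms by (intro SUP_least ennreal_leI) auto

lemma le_ediam: "x \<in> S \<Longrightarrow> y \<in> S \<Longrightarrow> ennreal (d x y) \<le> ediam d S"
  unfolding ediam_def by (intro SUP_upper2[of x] SUP_upper) auto

lemma ediam_empty [simp]: "ediam d {} = 0"
  by (simp add: ediam_def bot_ennreal)

lemma ediam_mono: "S \<subseteq> T \<Longrightarrow> ediam d S \<le> ediam d T"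
  unfolding ediam_def by (intro SUP_subset_mono order_refl) auto

lemma enn2real_ediam_le:
  assumes "ediam d S \<le> ennreal r" "0 \<le> r"
  shows "enn2real (ediam d S) \<le> r"
  using enn2real_mono[OF assms(1)] assms(2) by simp

lemma dist_le_enn2real_ediam:
  assumes "ediam d S \<le> ennreal r" "x \<in> S" "y \<in> S"
  shows "d x y \<le> enn2real (ediam d S)"
proof -
  have fin: "ediam d S < top" using assms(1) by (rule le_less_trans) simp
  have "ennreal (d x y) \<le> ennreal (enn2real (ediam d S))"
    using le_ediam[OF assms(2,3)] fin by simp
  then show ?thesis by (simp add: ennreal_le_iff2) (meson enn2real_nonneg order_trans)
qed

lemma hausdorff_pre_antimono: "\<epsilon> \<le> \<delta> \<Longrightarrow> hausdorff_pre d s A \<delta> \<le> hausdorff_pre d s A \<epsilon>"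
  unfolding hausdorff_pre_def
  by (rule INF_superset_mono) (auto simp: delta_covers_def intro: order_trans ennreal_leI)

lemma hausdorff_pre_le_outer:
  assumes "0 < \<delta>" shows "hausdorff_pre d s A \<delta> \<le> hausdorff_outer d s A"
proof (rule tendsto_lowerbound[OF hausdorff_pre_tendsto])
  show "\<forall>\<^sub>F x in at_right 0. hausdorff_pre d s A \<delta> \<le> hausdorff_pre d s A x"
    using assms unfolding eventually_at_right_field
    by (intro exI[of _ \<delta>]) (auto intro: hausdorff_pre_antimono)
qed simp

lemma hausdorff_outer_leI:
  assumes "\<And>\<delta>. 0 < \<delta> \<Longrightarrow> hausdorff_pre d s A \<delta> \<le> M" shows "hausdorff_outer d s A \<le> M"
proof (rule tendsto_upperbound[OF hausdorff_pre_tendsto])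
  show "\<forall>\<^sub>F x in at_right 0. hausdorff_pre d s A x \<le> M"
    using assms unfolding eventually_at_right_field by (intro exI[of _ 1]) auto
qed simp

text \<open>Near-optimal covers of the pieces, with slack \<open>e * (1/2)^Suc i\<close>, are merged
  into one sequence by \<open>prod_decode\<close>. The scale \<open>\<delta>\<close> stays fixed, so
  no limit intervenes.\<close>

lemma hausdorff_pre_Union_le:
  "hausdorff_pre d s (\<Union>i. A i) \<delta> \<le> (\<Sum>i. hausdorff_pre d s (A i) \<delta>)"
proof (rule ennreal_le_epsilon)
  let ?P = "\<lambda>i. hausdorff_pre d s (A i) \<delta>"
  fix e :: real assume fin: "(\<Sum>i. ?P i) < top" and e: "0 < e"
  define w where "w C = ennreal (enn2real (ediam d C) powr s)" for C
  have "\<exists>C. C \<in> delta_covers d \<delta> (A i) \<and> (\<Sum>j. w (C j)) < ?P i + ennreal (e * (1/2)^Suc i)" for i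
  proof -
    have "?P i < top" using ennreal_suminf_lessD[OF fin] .
    moreover have "0 < ennreal (e * (1/2)^Suc i)" using e by simp
    ultimately have "?P i < ?P i + ennreal (e * (1/2)^Suc i)"
      by (cases "?P i") (auto simp flip: ennreal_plus simp: ennreal_less_iff e)
    then show ?thesis unfolding hausdorff_pre_def w_def INF_less_iff by blast
  qed
  then obtain C where C: "\<And>i. C i \<in> delta_covers d \<delta> (A i)"
    and CS: "\<And>i. (\<Sum>j. w (C i j)) < ?P i + ennreal (e * (1/2)^Suc i)" by metis
  let ?D = "\<lambda>n. case prod_decode n of (i, j) \<Rightarrow> C i j"
  have D: "?D \<in> delta_covers d \<delta> (\<Union>i. A i)"
  proof -
    have "x \<in> (\<Union>n. ?D n)" if x: "x \<in> A i" for x i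
    proof -
      have "A i \<subseteq> (\<Union>j. C i j)" using C[of i] by (simp add: delta_covers_def)
      then obtain j where "x \<in> C i j" using x by blast
      then show ?thesis by (intro UN_I[of "prod_encode (i, j)"]) auto
    qed
    moreover have "ediam d (?D n) \<le> ennreal \<delta>" for n
      using C by (auto simp: delta_covers_def split: prod.split)
    ultimately show ?thesis unfolding delta_covers_def by blast
  qed
  have "hausdorff_pre d s (\<Union>i. A i) \<delta> \<le> (\<Sum>n. w (?D n))"
    unfolding hausdorff_pre_def w_def by (rule INF_lower[OF D])
  also have "\<dots> = (\<Sum>n. (\<lambda>(i, j). w (C i j)) (prod_decode n))"
    by (simp add: prod.case_distrib)
  also have "\<dots> = (\<Sum>i. \<Sum>j. w (C i j))"
    using suminf_ennreal_2dimen[of "\<lambda>i. \<Sum>j. w (C i j)" "\<lambda>(i, j). w (C i j)"] by (simp add: comp_def)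
  also have "\<dots> \<le> (\<Sum>i. ?P i + ennreal (e * (1/2)^Suc i))"
    by (intro suminf_le less_imp_le CS) auto
  also have "\<dots> = (\<Sum>i. ?P i) + (\<Sum>i. ennreal (e * (1/2)^Suc i))"
    by (intro suminf_add[symmetric]) auto
  also have "(\<Sum>i. ennreal (e * (1/2)^Suc i)) = ennreal e"
    using e sums_mult[OF power_half_series, of e]
    by (intro suminf_ennreal_eq) auto
  finally show "hausdorff_pre d s (\<Union>i. A i) \<delta> \<le> (\<Sum>i. ?P i) + ennreal e" .
qed

text \<open>The finite cover is continued by empty sets. They cost nothing for any \<open>s\<close>,
  since their diameter is \<open>0\<close> and \<open>0 powr s = 0\<close> even for
  \<open>s = 0\<close>.\<close>

lemma hausdorff_pre_finite_cover:
  assumes "finite I" "A \<subseteq> (\<Union>i\<in>I. C i)" "\<And>i. i \<in> I \<Longrightarrow> ediam d (C i) \<le> ennreal \<delta>"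
  shows "hausdorff_pre d s A \<delta> \<le> (\<Sum>i\<in>I. ennreal (enn2real (ediam d (C i)) powr s))"
proof -
  obtain g where g: "bij_betw g {..<card I} I"
    using assms(1) by (metis atLeast0LessThan ex_bij_betw_nat_finite)
  let ?D = "\<lambda>n. if n < card I then C (g n) else {}"
  have "?D \<in> delta_covers d \<delta> A"
  proof -
    have "x \<in> (\<Union>n. ?D n)" if x: "x \<in> A" for x
    proof -
      obtain i where i: "i \<in> I" "x \<in> C i" using assms(2) x by auto
      then obtain n where "n < card I" "i = g n" using g by (auto simp: bij_betw_def)
      then show ?thesis using i by (intro UN_I[of n]) auto
    qed
    moreover have "ediam d (?D n) \<le> ennreal \<delta>" for n
      using assms(3) bij_betwE[OF g] by auto
    ultimately show ?thesis unfolding delta_covers_def by blast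
  qed
  then have "hausdorff_pre d s A \<delta> \<le> (\<Sum>n. ennreal (enn2real (ediam d (?D n)) powr s))"
    unfolding hausdorff_pre_def by (rule INF_lower)
  also have "\<dots> = (\<Sum>n<card I. ennreal (enn2real (ediam d (?D n)) powr s))"
    by (intro suminf_finite) auto
  also have "\<dots> = (\<Sum>n<card I. ennreal (enn2real (ediam d (C (g n))) powr s))"
    by (intro sum.cong) auto
  also have "\<dots> = (\<Sum>i\<in>I. ennreal (enn2real (ediam d (C i)) powr s))"
    by (rule sum.reindex_bij_betw[OF g])
  finally show ?thesis .
qed

lemma hausdorff_outer_eq_0:
  assumes "hausdorff_outer d r A < \<infinity>" "0 \<le> r" "r < s"
  shows "hausdorff_outer d s A = 0"
proof -
  obtain M where M: "hausdorff_outer d r A = ennreal M" "0 \<le> M"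
    using assms(1) by (cases "hausdorff_outer d r A") auto
  \<comment> \<open>Covers at a finer scale \<open>\<delta>\<close> also serve at scale
    \<open>\<epsilon>\<close>, and each diameter there gains a factor
    \<open>\<delta> powr (s - r)\<close>, which tends to \<open>0\<close>. The bound
    \<open>M + 1\<close> gives a strict inequality, from which an actual cover can be
    extracted.\<close>
  have *: "hausdorff_pre d s A \<epsilon> \<le> ennreal (\<delta> powr (s - r) * (M + 1))" if d: "0 < \<delta>" "\<delta> \<le> \<epsilon>" for \<epsilon> \<delta>
  proof -
    have "hausdorff_pre d r A \<delta> < ennreal (M + 1)"
      using hausdorff_pre_le_outer[OF d(1), of d r A] M by (auto simp: ennreal_less_iff elim!: le_less_trans)
    then obtain C where C: "C \<in> delta_covers d \<delta> A"
      and S: "(\<Sum>i. ennreal (enn2real (ediam d (C i)) powr r)) < ennreal (M + 1)"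
      unfolding hausdorff_pre_def INF_less_iff by blast
    have pw: "enn2real (ediam d (C i)) powr s \<le> \<delta> powr (s - r) * enn2real (ediam d (C i)) powr r" for i
    proof -
      let ?e = "enn2real (ediam d (C i))"
      have "?e \<le> \<delta>" using C d by (intro enn2real_ediam_le) (auto simp: delta_covers_def)
      then have "?e powr (s - r) * ?e powr r \<le> \<delta> powr (s - r) * ?e powr r"
        using assms by (intro mult_right_mono powr_mono2) auto
      then show ?thesis by (simp flip: powr_add)
    qed
    have "hausdorff_pre d s A \<epsilon> \<le> hausdorff_pre d s A \<delta>" using d by (intro hausdorff_pre_antimono)
    also have "\<dots> \<le> (\<Sum>i. ennreal (enn2real (ediam d (C i)) powr s))"
      unfolding hausdorff_pre_def by (rule INF_lower[OF C])
    also have "\<dots> \<le> (\<Sum>i. ennreal (\<delta> powr (s - r)) * ennreal (enn2real (ediam d (C i)) powr r))"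
      using pw by (intro suminf_le) (auto simp flip: ennreal_mult intro: ennreal_leI)
    also have "\<dots> = ennreal (\<delta> powr (s - r)) * (\<Sum>i. ennreal (enn2real (ediam d (C i)) powr r))"
      by simp
    also have "\<dots> \<le> ennreal (\<delta> powr (s - r)) * ennreal (M + 1)"
      using S by (intro mult_left_mono) auto
    finally show ?thesis using M by (simp add: ennreal_mult)
  qed
  have "hausdorff_pre d s A \<epsilon> \<le> 0" if e: "0 < \<epsilon>" for \<epsilon>
  proof (rule tendsto_lowerbound)
    have "((\<lambda>\<delta>. \<delta> powr (s - r)) \<longlongrightarrow> 0 powr (s - r)) (at_right 0)"
      by (rule tendsto_powr') (use assms in \<open>auto intro!: tendsto_intros simp: eventually_at_right_field intro: gt_ex\<close>)
    from tendsto_mult_left[OF this, of "M + 1"]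
    have "((\<lambda>\<delta>. \<delta> powr (s - r) * (M + 1)) \<longlongrightarrow> 0) (at_right 0)"
      by (simp add: mult.commute)
    then show "((\<lambda>\<delta>. ennreal (\<delta> powr (s - r) * (M + 1))) \<longlongrightarrow> 0) (at_right 0)"
      using tendsto_ennrealI by fastforce
    show "\<forall>\<^sub>F \<delta> in at_right 0. hausdorff_pre d s A \<epsilon> \<le> ennreal (\<delta> powr (s - r) * (M + 1))"
      using e * unfolding eventually_at_right_field by (intro exI[of _ \<epsilon>]) auto
  qed simp
  then have "hausdorff_outer d s A \<le> 0" by (rule hausdorff_outer_leI)
  then show ?thesis by simp
qed

lemma hausdorff_dim_le:
  assumes "0 \<le> s" "hausdorff_outer d s A < \<infinity>" shows "hausdorff_dim d A \<le> ereal s"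
  unfolding hausdorff_dim_def using assms by (intro Inf_lower) auto

lemma hausdorff_dim_nonneg: "0 \<le> hausdorff_dim d A"
  unfolding hausdorff_dim_def by (intro Inf_greatest) auto

lemma hausdorff_outer_above_dim:
  assumes "hausdorff_dim d A < ereal s" shows "hausdorff_outer d s A = 0"
proof -
  obtain r where "0 \<le> r" "hausdorff_outer d r A < \<infinity>" "r < s"
    using assms unfolding hausdorff_dim_def Inf_less_iff by auto
  then show ?thesis by (intro hausdorff_outer_eq_0)
qed

lemma hausdorff_outer_below_dim:
  assumes "ereal s < hausdorff_dim d A" "0 \<le> s" shows "hausdorff_outer d s A = \<infinity>"
  using assms hausdorff_dim_le[of s d A] by (metis infinity_ennreal_def leD less_top)

lemma hausdorff_dim_ge:
  assumes "hausdorff_outer d s A \<noteq> 0" shows "ereal s \<le> hausdorff_dim d A"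
  using assms hausdorff_outer_above_dim[of d A s] by (meson not_le)

text \<open>The common engine for Hoelder maps and for graphs. Only the pre-measure of the image of
  a small piece is controlled, not its diameter, so an image may be covered by many small sets, as a
  tall thin piece of a graph requires. The constant \<open>K\<close> is uniform in
  \<open>\<epsilon>\<close>, while \<open>\<delta>\<close> may depend on it.\<close>

lemma hausdorff_outer_transfer:
  assumes K: "0 \<le> K"
    and piece: "\<And>\<epsilon>. 0 < \<epsilon> \<Longrightarrow> \<exists>\<delta>>0. \<forall>S r. S \<subseteq> A \<longrightarrow> 0 \<le> r \<longrightarrow> r \<le> \<delta> \<longrightarrow> ediam d S = ennreal r \<longrightarrow>
             hausdorff_pre d' s' (f ` S) \<epsilon> \<le> ennreal (K * r powr s)"
    and s: "0 \<le> s" and fin: "hausdorff_outer d s A < \<infinity>"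
  shows "hausdorff_outer d' s' (f ` A) < \<infinity>"
proof -
  obtain M where M: "hausdorff_outer d s A = ennreal M" "0 \<le> M"
    using fin by (cases "hausdorff_outer d s A") auto
  have "hausdorff_pre d' s' (f ` A) \<epsilon> \<le> ennreal (K * (M + 1))" if e: "0 < \<epsilon>" for \<epsilon>
  proof -
    obtain \<delta> where d: "0 < \<delta>" and p: "\<And>S r. S \<subseteq> A \<Longrightarrow> 0 \<le> r \<Longrightarrow> r \<le> \<delta> \<Longrightarrow> ediam d S = ennreal r \<Longrightarrow>
             hausdorff_pre d' s' (f ` S) \<epsilon> \<le> ennreal (K * r powr s)"
      using piece[OF e] by blast
    have "hausdorff_pre d s A \<delta> < ennreal (M + 1)"
      using hausdorff_pre_le_outer[OF d(1), of d s A] M by (auto simp: ennreal_less_iff elim!: le_less_trans)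
    then obtain C where C: "C \<in> delta_covers d \<delta> A"
      and S: "(\<Sum>i. ennreal (enn2real (ediam d (C i)) powr s)) < ennreal (M + 1)"
      unfolding hausdorff_pre_def INF_less_iff by blast
    have Cd: "ediam d (C i) \<le> ennreal \<delta>" for i using C by (auto simp: delta_covers_def)
    \<comment> \<open>The estimate is available for subsets of \<open>A\<close>, so the members of
      the cover are first intersected with \<open>A\<close>; this does not increase
      diameters.\<close>
    have le: "hausdorff_pre d' s' (f ` (A \<inter> C i)) \<epsilon> \<le> ennreal K * ennreal (enn2real (ediam d (C i)) powr s)" for i
    proof -
      let ?r = "enn2real (ediam d (A \<inter> C i))"
      have m: "ediam d (A \<inter> C i) \<le> ediam d (C i)" by (intro ediam_mono) auto
      have r: "?r \<le> enn2real (ediam d (C i))"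
        using Cd[of i] by (intro enn2real_mono m) (auto intro: le_less_trans)
      have "hausdorff_pre d' s' (f ` (A \<inter> C i)) \<epsilon> \<le> ennreal (K * ?r powr s)"
        using d Cd[of i] m
        by (intro p enn2real_ediam_le ennreal_enn2real[symmetric])
           (auto intro: order_trans le_less_trans[of _ "ennreal \<delta>"])
      also have "\<dots> \<le> ennreal (K * enn2real (ediam d (C i)) powr s)"
        using r K s by (intro ennreal_leI mult_left_mono powr_mono2) auto
      finally show ?thesis using K by (simp add: ennreal_mult)
    qed
    have "A \<subseteq> (\<Union>i. C i)" using C by (simp add: delta_covers_def)
    then have "f ` A = (\<Union>i. f ` (A \<inter> C i))" by blast
    then have "hausdorff_pre d' s' (f ` A) \<epsilon> \<le> (\<Sum>i. hausdorff_pre d' s' (f ` (A \<inter> C i)) \<epsilon>)"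
      using hausdorff_pre_Union_le[of d' s' "\<lambda>i. f ` (A \<inter> C i)" \<epsilon>] by simp
    also have "\<dots> \<le> (\<Sum>i. ennreal K * ennreal (enn2real (ediam d (C i)) powr s))"
      by (intro suminf_le le) auto
    also have "\<dots> = ennreal K * (\<Sum>i. ennreal (enn2real (ediam d (C i)) powr s))" by simp
    also have "\<dots> \<le> ennreal K * ennreal (M + 1)" using S by (intro mult_left_mono) auto
    finally show ?thesis using K M by (simp add: ennreal_mult)
  qed
  then have "hausdorff_outer d' s' (f ` A) \<le> ennreal (K * (M + 1))" by (rule hausdorff_outer_leI)
  then show ?thesis by (simp add: le_less_trans)
qed

text \<open>A piece of diameter \<open>r\<close> is sent to one of diameter at most
  \<open>K * r powr \<theta>\<close>, so the exponent \<open>s / \<theta>\<close> on the image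
  matches \<open>s\<close> on the source. Distances up to \<open>1\<close> are enough because covers
  may be taken fine.\<close>

lemma hausdorff_dim_hoelder_image_le:
  assumes K: "0 \<le> K" and \<theta>: "0 < \<theta>" and d0: "\<And>x y. 0 \<le> d x y"
    and hoelder: "\<And>x y. x \<in> A \<Longrightarrow> y \<in> A \<Longrightarrow> d x y \<le> 1 \<Longrightarrow> d' (f x) (f y) \<le> K * d x y powr \<theta>"
    and s: "hausdorff_dim d A < ereal s"
  shows "hausdorff_dim d' (f ` A) \<le> ereal (s / \<theta>)"
proof -
  have s0: "0 < s" using hausdorff_dim_nonneg[of d A] s by (metis ereal_less(2) le_less_trans)
  have "hausdorff_outer d' (s / \<theta>) (f ` A) < \<infinity>"
  proof (rule hausdorff_outer_transfer)
    fix \<epsilon> :: real assume e: "0 < \<epsilon>"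
    \<comment> \<open>Small enough for \<open>K * r powr \<theta> \<le> \<epsilon>\<close>; dividing
      by \<open>K + 1\<close> covers the case \<open>K = 0\<close>.\<close>
    define \<delta> where "\<delta> = min 1 ((\<epsilon> / (K + 1)) powr (1 / \<theta>))"
    have "hausdorff_pre d' (s / \<theta>) (f ` S) \<epsilon> \<le> ennreal (K powr (s / \<theta>) * r powr s)"
      if S: "S \<subseteq> A" "0 \<le> r" "r \<le> \<delta>" "ediam d S = ennreal r" for S r
    proof -
      have dr: "d x y \<le> r" if "x \<in> S" "y \<in> S" for x y
        using le_ediam[OF that, of d] S d0 by (simp add: ennreal_le_iff)
      have D: "ediam d' (f ` S) \<le> ennreal (K * r powr \<theta>)"
      proof (rule ediam_le)
        fix x y assume "x \<in> f ` S" "y \<in> f ` S"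
        then obtain a b where ab: "a \<in> S" "b \<in> S" "x = f a" "y = f b" by auto
        have "d a b \<le> 1" using dr[OF ab(1,2)] S by (auto simp: \<delta>_def)
        then have "d' x y \<le> K * d a b powr \<theta>" using hoelder[of a b] ab S by auto
        also have "\<dots> \<le> K * r powr \<theta>"
          using dr[OF ab(1,2)] K \<theta> d0 by (intro mult_left_mono powr_mono2) auto
        finally show "d' x y \<le> K * r powr \<theta>" .
      qed
      have "r powr \<theta> \<le> ((\<epsilon> / (K + 1)) powr (1 / \<theta>)) powr \<theta>"
        using S \<theta> by (intro powr_mono2) (auto simp: \<delta>_def)
      also have "\<dots> = \<epsilon> / (K + 1)" using e K \<theta> by (simp add: powr_powr)
      finally have "K * r powr \<theta> \<le> (K + 1) * (\<epsilon> / (K + 1))" using K e by (intro mult_mono) auto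
      then have Ke: "K * r powr \<theta> \<le> \<epsilon>" using K by simp
      have "hausdorff_pre d' (s / \<theta>) (f ` S) \<epsilon> \<le> (\<Sum>i\<in>{()}. ennreal (enn2real (ediam d' (f ` S)) powr (s / \<theta>)))"
        using D Ke by (intro hausdorff_pre_finite_cover) (auto intro: order_trans ennreal_leI)
      also have "\<dots> \<le> ennreal ((K * r powr \<theta>) powr (s / \<theta>))"
        using D K s0 \<theta> by (auto intro!: ennreal_leI powr_mono2 enn2real_ediam_le)
      also have "(K * r powr \<theta>) powr (s / \<theta>) = K powr (s / \<theta>) * r powr s"
        using K \<theta> S by (simp add: powr_mult powr_powr)
      finally show ?thesis .
    qed
    moreover have "0 < \<delta>" using e K by (simp add: \<delta>_def)
    ultimately show "\<exists>\<delta>>0. \<forall>S r. S \<subseteq> A \<longrightarrow> 0 \<le> r \<longrightarrow> r \<le> \<delta> \<longrightarrow> ediam d S = ennreal r \<longrightarrow>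
             hausdorff_pre d' (s / \<theta>) (f ` S) \<epsilon> \<le> ennreal (K powr (s / \<theta>) * r powr s)" by blast
  qed (use s0 hausdorff_outer_above_dim[OF s] in auto)
  then show ?thesis using s0 \<theta> by (intro hausdorff_dim_le) auto
qed

text \<open>Comparison with Lebesgue measure: a covering set lies in an interval of twice its
  diameter centred at one of its points, so the diameters of a cover sum to at least half the
  length. The scale \<open>1\<close> keeps the diameters finite.\<close>

lemma hausdorff_dim_interval_ge:
  fixes p q :: real
  assumes "p < q"
  shows "1 \<le> hausdorff_dim (\<lambda>x y. \<bar>x - y\<bar>) {p..q}"
proof -
  let ?d = "\<lambda>x y :: real. \<bar>x - y\<bar>"
  have "ennreal ((q - p) / 2) \<le> hausdorff_pre ?d 1 {p..q} 1"
    unfolding hausdorff_pre_def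
  proof (rule INF_greatest)
    fix C assume C: "C \<in> delta_covers ?d 1 {p..q}"
    define I where "I i = (if C i = {} then {} else
      {(SOME x. x \<in> C i) - enn2real (ediam ?d (C i)) .. (SOME x. x \<in> C i) + enn2real (ediam ?d (C i))})" for i
    have CI: "C i \<subseteq> I i" for i
    proof
      fix y assume y: "y \<in> C i"
      define x where "x = (SOME x. x \<in> C i)"
      have x: "x \<in> C i" unfolding x_def using y by (rule someI)
      have "?d x y \<le> enn2real (ediam ?d (C i))"
        using C x y by (intro dist_le_enn2real_ediam[of ?d _ 1]) (auto simp: delta_covers_def)
      then show "y \<in> I i" using y x unfolding I_def x_def[symmetric] by (auto simp: abs_le_iff)
    qed
    have "ennreal (q - p) = emeasure lborel {p..q}" using assms by simp
    also have "\<dots> \<le> emeasure lborel (\<Union>i. I i)"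
    proof (rule emeasure_mono)
      show "{p..q} \<subseteq> (\<Union>i. I i)" using C CI unfolding delta_covers_def by blast
      show "(\<Union>i. I i) \<in> sets lborel" by (intro sets.countable_UN) (auto simp: I_def)
    qed
    also have "\<dots> \<le> (\<Sum>i. emeasure lborel (I i))"
      by (intro emeasure_subadditive_countably) (auto simp: I_def)
    also have "\<dots> \<le> (\<Sum>i. 2 * ennreal (enn2real (ediam ?d (C i)) powr 1))"
      by (intro suminf_le) (auto simp: I_def ennreal_mult[symmetric] simp flip: ennreal_numeral intro!: ennreal_leI)
    also have "\<dots> = 2 * (\<Sum>i. ennreal (enn2real (ediam ?d (C i)) powr 1))" by simp
    finally have *: "ennreal (q - p) \<le> 2 * (\<Sum>i. ennreal (enn2real (ediam ?d (C i)) powr 1))" .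
    then show "ennreal ((q - p) / 2) \<le> (\<Sum>i. ennreal (enn2real (ediam ?d (C i)) powr 1))"
    proof (cases "\<Sum>i. ennreal (enn2real (ediam ?d (C i)) powr 1)")
      case (real S)
      have "2 * ennreal S = ennreal (2 * S)" using real(1) by (simp add: ennreal_mult)
      then have "q - p \<le> 2 * S" using * real by (simp add: ennreal_le_iff)
      then have "(q - p) / 2 \<le> S" by (simp add: field_simps)
      then have "ennreal ((q - p) / 2) \<le> ennreal S" by (rule ennreal_leI)
      also have "\<dots> = (\<Sum>i. ennreal (enn2real (ediam ?d (C i)) powr 1))" by (rule real(2)[symmetric])
      finally show ?thesis .
    next
      case top
      show ?thesis unfolding top by (rule top_greatest)
    qed
  qed
  moreover have "0 < ennreal ((q - p) / 2)" using assms by simp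
  ultimately have "hausdorff_outer ?d 1 {p..q} \<noteq> 0"
    using hausdorff_pre_le_outer[of 1 ?d 1 "{p..q}"] by auto
  then show ?thesis using hausdorff_dim_ge by (metis one_ereal_def)
qed

section \<open>Parabolic dimensions and the upper bound for graphs\<close>

lemma parabolic_dist_nonneg: "0 \<le> parabolic_dist h x y"
  by (simp add: parabolic_dist_def)

text \<open>Projection to the time axis is Hoelder of exponent \<open>1 / h\<close> for the
  parabolic distance, so a dimension below \<open>1 / h\<close> would give an interval dimension
  below \<open>1\<close>. For \<open>h < 1\<close> this makes the local parabolic dimension exceed
  \<open>1\<close>, as the final comparison requires.\<close>

lemma hausdorff_dim_parabolic_graph_ge:
  assumes h: "0 < h" and pq: "p < q" "{p..q} \<subseteq> V"
  shows "ereal (1 / h) \<le> hausdorff_dim (parabolic_dist h) (graph_on f V)"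
proof (rule ccontr)
  assume "\<not> ?thesis"
  then obtain s where s: "hausdorff_dim (parabolic_dist h) (graph_on f V) < ereal s" "ereal s < ereal (1 / h)"
    using ereal_dense2[of "hausdorff_dim (parabolic_dist h) (graph_on f V)" "ereal (1 / h)"]
    by (metis not_le)
  have "hausdorff_dim (\<lambda>x y. \<bar>x - y\<bar>) (fst ` graph_on f V) \<le> ereal (s / (1 / h))"
  proof (rule hausdorff_dim_hoelder_image_le[where K = 1, OF _ _ parabolic_dist_nonneg _ s(1)])
    fix x y :: "real \<times> real"
    have "\<bar>fst x - fst y\<bar> = (\<bar>fst x - fst y\<bar> powr h) powr (1 / h)" using h by (simp add: powr_powr)
    also have "\<dots> \<le> parabolic_dist h x y powr (1 / h)"
      using h by (intro powr_mono2) (auto simp: parabolic_dist_def)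
    finally show "\<bar>fst x - fst y\<bar> \<le> 1 * parabolic_dist h x y powr (1 / h)" by simp
  qed (use h in auto)
  moreover have "fst ` graph_on f V = V" by (force simp: graph_on_def)
  moreover have "1 \<le> hausdorff_dim (\<lambda>x y :: real. \<bar>x - y\<bar>) V"
    using hausdorff_dim_interval_ge[OF pq(1)] hausdorff_dim_mono[OF pq(2)] order_trans by blast
  ultimately have "1 \<le> ereal (s / (1 / h))" by (metis order_trans)
  then have "1 \<le> s * h" by (simp add: one_ereal_def)
  then show False using s(2) h by (simp add: field_simps)
qed

text \<open>The identity is Hoelder of exponent \<open>g / h\<close> between the two distances, at
  distances up to \<open>1\<close>. The ratio \<open>h / g\<close> is the price of replacing
  \<open>H t\<close> by a nearby rational exponent.\<close>

lemma hausdorff_dim_parabolic_le: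
  assumes "0 < g" "g \<le> h" "hausdorff_dim (parabolic_dist h) A < ereal s"
  shows "hausdorff_dim (parabolic_dist g) A \<le> ereal (h / g * s)"
proof -
  have "hausdorff_dim (parabolic_dist g) (id ` A) \<le> ereal (s / (g / h))"
  proof (rule hausdorff_dim_hoelder_image_le[where K = 1, OF _ _ parabolic_dist_nonneg _ assms(3)])
    fix x y :: "real \<times> real"
    let ?r = "parabolic_dist h x y"
    assume r: "?r \<le> 1"
    have "\<bar>fst x - fst y\<bar> powr g = (\<bar>fst x - fst y\<bar> powr h) powr (g / h)" using assms by (simp add: powr_powr)
    also have "\<dots> \<le> ?r powr (g / h)"
      using assms by (intro powr_mono2) (auto simp: parabolic_dist_def)
    finally have 1: "\<bar>fst x - fst y\<bar> powr g \<le> ?r powr (g / h)" .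
    have "\<bar>snd x - snd y\<bar> \<le> ?r powr 1" by (simp add: parabolic_dist_def)
    also have "\<dots> \<le> ?r powr (g / h)"
      using r assms by (intro powr_mono') (auto simp: parabolic_dist_nonneg)
    finally show "parabolic_dist g (id x) (id y) \<le> 1 * ?r powr (g / h)"
      using 1 by (subst parabolic_dist_def) simp
  qed (use assms in auto)
  then show ?thesis by (simp add: mult.commute)
qed

text \<open>The exponent comes from a count: about \<open>r / w\<close> squares of side
  \<open>w = r powr (1 / g)\<close> have total weight of order \<open>r * w powr (s' - 1)\<close>,
  and this is \<open>r powr s\<close> exactly when \<open>s' = 1 + g * (s - 1)\<close>.\<close>

lemma hausdorff_dim_graph_le:
  fixes x H :: "real \<Rightarrow> real"
  assumes g: "0 < g" "g < 1" and K: "0 \<le> K"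
    and x: "\<And>u v. u \<in> V \<Longrightarrow> v \<in> V \<Longrightarrow> \<bar>x u - x v\<bar> \<le> K * parabolic_dist g (u, H u) (v, H v)"
    and s: "hausdorff_dim (parabolic_dist g) (graph_on H V) < ereal s"
  shows "hausdorff_dim dist (graph_on x V) \<le> ereal (1 + g * (s - 1))"
proof -
  have s0: "0 < s" using hausdorff_dim_nonneg[of "parabolic_dist g" "graph_on H V"] s
    by (metis ereal_less(2) le_less_trans)
  define s' where "s' = 1 + g * (s - 1)"
  have s'0: "0 < s'"
  proof -
    have "s' = g * s + (1 - g)" by (simp add: s'_def algebra_simps)
    then show ?thesis using g s0 by (simp add: add_pos_pos)
  qed
  define A where "A = graph_on H V"
  define f where "f = (\<lambda>z :: real \<times> real. (fst z, x (fst z)))"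
  \<comment> \<open>\<open>2 * K + 1\<close> bounds the number of squares in units of
    \<open>r / w\<close>, and \<open>2 powr s'\<close> accounts for diameters up to
    \<open>2 * w\<close>.\<close>
  define K' where "K' = (2 * K + 1) * 2 powr s'"
  have fA: "f ` A = graph_on x V" by (simp add: A_def f_def graph_on_def image_image)
  have "hausdorff_outer dist s' (f ` A) < \<infinity>"
  proof (rule hausdorff_outer_transfer)
    fix \<epsilon> :: real assume e: "0 < \<epsilon>"
    have "hausdorff_pre dist s' (f ` S) \<epsilon> \<le> ennreal (K' * r powr s)"
      if S: "S \<subseteq> A" "0 \<le> r" "r \<le> min 1 (\<epsilon> / 2)" "ediam (parabolic_dist g) S = ennreal r" for S r
    proof (cases "S = {}")
      case True
      then have "hausdorff_pre dist s' (f ` S) \<epsilon> = 0"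
        using hausdorff_pre_finite_cover[of "{}" "{}" _ dist \<epsilon> s'] by auto
      then show ?thesis by (simp only: zero_le)
    next
      case False
      then obtain z0 where z0: "z0 \<in> S" by blast
      have dr: "parabolic_dist g z z' \<le> r" if "z \<in> S" "z' \<in> S" for z z'
        using le_ediam[OF that, of "parabolic_dist g"] S parabolic_dist_nonneg[of g z z'] by (simp add: ennreal_le_iff)
      define w where "w = r powr (1 / g)"
      have tw: "\<bar>fst z - fst z'\<bar> \<le> w" if "z \<in> S" "z' \<in> S" for z z'
      proof -
        have "\<bar>fst z - fst z'\<bar> = (\<bar>fst z - fst z'\<bar> powr g) powr (1 / g)" using g by (simp add: powr_powr)
        also have "\<dots> \<le> r powr (1 / g)"
          using dr[OF that] g by (intro powr_mono2) (auto simp: parabolic_dist_def)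
        finally show ?thesis unfolding w_def .
      qed
      have xr: "\<bar>x (fst z) - x (fst z')\<bar> \<le> K * r" if "z \<in> S" "z' \<in> S" for z z'
      proof -
        have "z = (fst z, H (fst z))" "z' = (fst z', H (fst z'))" "fst z \<in> V" "fst z' \<in> V"
          using that S by (auto simp: A_def graph_on_def)
        then have "\<bar>x (fst z) - x (fst z')\<bar> \<le> K * parabolic_dist g z z'" using x[of "fst z" "fst z'"] by simp
        also have "\<dots> \<le> K * r" using K dr[OF that] by (intro mult_left_mono)
        finally show ?thesis .
      qed
      show ?thesis
      \<comment> \<open>A piece of diameter \<open>0\<close> is a single point; it is split off
        because then \<open>w = 0\<close> and there are no squares to count.\<close>
      proof (cases "r = 0")
        case True
        have z: "z = z0" if "z \<in> S" for z
        proof -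
          have "\<bar>fst z - fst z0\<bar> \<le> 0" using tw[OF that z0] True by (simp add: w_def)
          moreover have "\<bar>snd z - snd z0\<bar> \<le> 0" using dr[OF that z0] True by (simp add: parabolic_dist_def)
          ultimately show ?thesis by (simp add: prod_eq_iff)
        qed
        then have fS: "f ` S = {f z0}" using z0 by blast
        have "ediam dist {f z0} \<le> ennreal 0" by (intro ediam_le) auto
        then have "hausdorff_pre dist s' (f ` S) \<epsilon> \<le> (\<Sum>i\<in>{()}. ennreal (enn2real (ediam dist {f z0}) powr s'))"
          unfolding fS using e by (intro hausdorff_pre_finite_cover) auto
        then show ?thesis using \<open>ediam dist {f z0} \<le> ennreal 0\<close> by simp
      next
        case False
        then have r: "0 < r" using S by simp
        have w0: "0 < w" using r by (simp add: w_def)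
        have "w \<le> r powr 1" unfolding w_def using S r g by (intro powr_mono') auto
        then have wr: "w \<le> r" using r by simp
        \<comment> \<open>On \<open>S\<close> the values of \<open>x\<close> stay within
          \<open>K * r\<close> of the value at \<open>z0\<close>, in an interval of length
          \<open>2 * K * r\<close> starting at \<open>y0\<close>, which is cut into strips of height
          \<open>w\<close>.\<close>
        define N where "N = nat \<lfloor>2 * K * r / w\<rfloor> + 1"
        define y0 where "y0 = x (fst z0) - K * r"
        define C where "C j = {z \<in> f ` S. y0 + real j * w \<le> snd z \<and> snd z \<le> y0 + real (j + 1) * w}" for j :: nat
        have Cdiam: "ediam dist (C j) \<le> ennreal (2 * w)" for j
        proof (rule ediam_le)
          fix a b assume "a \<in> C j" "b \<in> C j"
          then have ab: "\<bar>fst a - fst b\<bar> \<le> w" "\<bar>snd a - snd b\<bar> \<le> w"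
            using tw by (auto simp: C_def f_def abs_le_iff algebra_simps)
          have "dist a b \<le> dist (fst a) (fst b) + dist (snd a) (snd b)"
            by (cases a, cases b) (auto simp: dist_Pair_Pair intro!: sqrt_sum_squares_le_sum)
          then show "dist a b \<le> 2 * w" using ab by (simp add: dist_real_def)
        qed
        have cover: "f ` S \<subseteq> (\<Union>j\<in>{..<N}. C j)"
        proof
          fix a assume a: "a \<in> f ` S"
          then obtain z where z: "z \<in> S" "a = f z" by auto
          have y: "0 \<le> snd a - y0" "snd a - y0 \<le> 2 * K * r"
            using xr[OF z(1) z0] z by (auto simp: f_def y0_def abs_le_iff)
          define j where "j = nat \<lfloor>(snd a - y0) / w\<rfloor>"
          have "0 \<le> (snd a - y0) / w" using y w0 by simp
          then have j: "real j \<le> (snd a - y0) / w" "(snd a - y0) / w < real j + 1" unfolding j_def by linarith+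
          have "(snd a - y0) / w \<le> 2 * K * r / w" using y w0 by (intro divide_right_mono) auto
          then have "j < N" unfolding j_def N_def by (simp add: floor_mono nat_mono less_Suc_eq_le)
          moreover have "a \<in> C j" using a j w0 by (auto simp: C_def field_simps)
          ultimately show "a \<in> (\<Union>j\<in>{..<N}. C j)" by blast
        qed
        have le: "2 * w \<le> \<epsilon>" using wr S by auto
        have "hausdorff_pre dist s' (f ` S) \<epsilon> \<le> (\<Sum>j<N. ennreal (enn2real (ediam dist (C j)) powr s'))"
          using le by (intro hausdorff_pre_finite_cover cover order_trans[OF Cdiam] ennreal_leI) auto
        also have "\<dots> \<le> (\<Sum>j<N. ennreal ((2 * w) powr s'))"
          using w0 s'0 by (intro sum_mono ennreal_leI powr_mono2 enn2real_ediam_le Cdiam) auto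
        also have "\<dots> = ennreal (real N * (2 * w) powr s')" by (simp add: ennreal_mult ennreal_of_nat_eq_real_of_nat)
        also have "\<dots> \<le> ennreal (K' * r powr s)"
        proof (rule ennreal_leI)
          have "1 \<le> r / w" using wr w0 by simp
          have "0 \<le> 2 * K * r / w" using K r w0 by simp
          then have "real N \<le> 2 * K * r / w + 1" unfolding N_def by linarith
          also have "\<dots> \<le> (2 * K + 1) * (r / w)" using \<open>1 \<le> r / w\<close> by (simp add: algebra_simps)
          finally have "real N * (2 * w) powr s' \<le> (2 * K + 1) * (r / w) * (2 * w) powr s'"
            by (intro mult_right_mono) auto
          also have "\<dots> = K' * (r * (w powr s' / w powr 1))"
            using w0 by (simp add: K'_def powr_mult)
          also have "w powr s' / w powr 1 = w powr (s' - 1)" by (simp add: powr_diff)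
          also have "w powr (s' - 1) = r powr (s - 1)" using g by (simp add: w_def powr_powr s'_def)
          also have "r * r powr (s - 1) = r powr s" using r by (simp add: powr_diff)
          finally show "real N * (2 * w) powr s' \<le> K' * r powr s" .
        qed
        finally show ?thesis .
      qed
    qed
    then show "\<exists>\<delta>>0. \<forall>S r. S \<subseteq> A \<longrightarrow> 0 \<le> r \<longrightarrow> r \<le> \<delta> \<longrightarrow> ediam (parabolic_dist g) S = ennreal r \<longrightarrow>
             hausdorff_pre dist s' (f ` S) \<epsilon> \<le> ennreal (K' * r powr s)"
      using e by (intro exI[of _ "min 1 (\<epsilon> / 2)"]) auto
  qed (use s0 K hausdorff_outer_above_dim[OF s] in \<open>auto simp: K'_def A_def\<close>)
  then show ?thesis unfolding fA using s'0 by (intro hausdorff_dim_le) (auto simp: s'_def)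
qed

section \<open>Discrete Frostman measures and energies on graphs\<close>

text \<open>Greedy construction: a new point receives the largest mass that the cells containing it
  allow. A cell attaining this minimum becomes saturated, and cells already saturated remain so,
  because sums only grow and never exceed \<open>w\<close>.\<close>

lemma saturating_weights:
  fixes w :: "'j \<Rightarrow> real"
  assumes "finite P" and J: "finite J" and cov: "\<And>p. p \<in> P \<Longrightarrow> \<exists>j\<in>J. p \<in> C j" and w: "\<And>j. j \<in> J \<Longrightarrow> 0 \<le> w j"
  shows "\<exists>\<mu>. (\<forall>p. 0 \<le> \<mu> p) \<and> (\<forall>j\<in>J. sum \<mu> (P \<inter> C j) \<le> w j) \<and>
     (\<forall>p\<in>P. \<exists>j\<in>J. p \<in> C j \<and> sum \<mu> (P \<inter> C j) = w j)"
  using assms(1) cov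
proof (induction P rule: finite_induct)
  case empty
  then show ?case using w by (intro exI[of _ "\<lambda>_. 0"]) auto
next
  case (insert p P)
  then obtain \<mu> where \<mu>: "\<And>p. 0 \<le> \<mu> p" "\<And>j. j \<in> J \<Longrightarrow> sum \<mu> (P \<inter> C j) \<le> w j"
     "\<And>p. p \<in> P \<Longrightarrow> \<exists>j\<in>J. p \<in> C j \<and> sum \<mu> (P \<inter> C j) = w j" by (metis insertI2)
  define Jp where "Jp = {j\<in>J. p \<in> C j}"
  have Jp: "finite Jp" "Jp \<noteq> {}" using J insert.prems[of p] by (auto simp: Jp_def)
  define r where "r = Min ((\<lambda>j. w j - sum \<mu> (P \<inter> C j)) ` Jp)"
  have r0: "0 \<le> r" unfolding r_def using Jp \<mu>(2) by (subst Min_ge_iff) (auto simp: Jp_def)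
  have rle: "sum \<mu> (P \<inter> C j) + r \<le> w j" if "j \<in> Jp" for j
  proof -
    have "r \<le> w j - sum \<mu> (P \<inter> C j)" unfolding r_def using Jp that by (intro Min_le) auto
    then show ?thesis by simp
  qed
  have "r \<in> (\<lambda>j. w j - sum \<mu> (P \<inter> C j)) ` Jp" unfolding r_def using Jp by (intro Min_in) auto
  then obtain k where k: "k \<in> Jp" "sum \<mu> (P \<inter> C k) + r = w k" by auto
  define \<nu> where "\<nu> = \<mu>(p := r)"
  have \<nu>P: "sum \<nu> (P \<inter> C j) = sum \<mu> (P \<inter> C j)" for j
    using insert.hyps(2) by (intro sum.cong) (auto simp: \<nu>_def)
  have \<nu>in: "sum \<nu> (insert p P \<inter> C j) = sum \<mu> (P \<inter> C j) + r" if "p \<in> C j" for j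
    using that insert.hyps by (simp add: Int_insert_left \<nu>P) (simp add: \<nu>_def)
  have \<nu>out: "sum \<nu> (insert p P \<inter> C j) = sum \<mu> (P \<inter> C j)" if "p \<notin> C j" for j
    using that by (simp add: Int_insert_left \<nu>P)
  have le: "sum \<nu> (insert p P \<inter> C j) \<le> w j" if "j \<in> J" for j
    using that \<nu>in[of j] \<nu>out[of j] rle[of j] \<mu>(2)[of j] by (cases "p \<in> C j") (auto simp: Jp_def)
  have "\<exists>j\<in>J. q \<in> C j \<and> sum \<nu> (insert p P \<inter> C j) = w j" if q: "q \<in> insert p P" for q
  proof (cases "q = p")
    case True
    then show ?thesis using k \<nu>in[of k] by (intro bexI[of _ k]) (auto simp: Jp_def)
  next
    case False
    then obtain j where j: "j \<in> J" "q \<in> C j" "sum \<mu> (P \<inter> C j) = w j" using \<mu>(3) q by auto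
    have "sum \<mu> (P \<inter> C j) \<le> sum \<nu> (insert p P \<inter> C j)" using \<nu>in[of j] \<nu>out[of j] r0 by (cases "p \<in> C j") auto
    then show ?thesis using j le[of j] by (intro bexI[of _ j]) auto
  qed
  moreover have "0 \<le> \<nu> q" for q using \<mu>(1) r0 by (simp add: \<nu>_def)
  ultimately show ?case using le by (intro exI[of _ \<nu>]) blast
qed

text \<open>
  A maximal mass distribution saturates a cell around every point, and the largest saturated cells
  are disjoint.
\<close>
lemma frostman_nested_partitions:
  fixes cl :: "nat \<Rightarrow> 'p \<Rightarrow> 'l" and w :: "nat \<Rightarrow> real"
  assumes P: "finite P" and w: "\<And>m. 0 \<le> w m"
    and nest: "\<And>m p q. cl (Suc m) p = cl (Suc m) q \<Longrightarrow> cl m p = cl m q"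
  shows "\<exists>\<mu> L. (\<forall>p. 0 \<le> \<mu> p) \<and> (\<forall>m\<le>n. \<forall>l. sum \<mu> {q\<in>P. cl m q = l} \<le> w m) \<and> (\<forall>p\<in>P. L p \<le> n) \<and>
     sum \<mu> P = (\<Sum>z\<in>(\<lambda>p. (L p, cl (L p) p)) ` P. w (fst z))"
proof -
  define J where "J = (SIGMA m:{..n}. cl m ` P)"
  define C where "C z = {q. cl (fst z) q = snd z}" for z :: "nat \<times> 'l"
  have "\<exists>\<mu>. (\<forall>p. 0 \<le> \<mu> p) \<and> (\<forall>j\<in>J. sum \<mu> (P \<inter> C j) \<le> w (fst j)) \<and>
     (\<forall>p\<in>P. \<exists>j\<in>J. p \<in> C j \<and> sum \<mu> (P \<inter> C j) = w (fst j))"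
    using P w by (intro saturating_weights) (auto simp: J_def C_def)
  then obtain \<mu> where \<mu>: "\<And>p. 0 \<le> \<mu> p" "\<And>j. j \<in> J \<Longrightarrow> sum \<mu> (P \<inter> C j) \<le> w (fst j)"
     "\<And>p. p \<in> P \<Longrightarrow> \<exists>j\<in>J. p \<in> C j \<and> sum \<mu> (P \<inter> C j) = w (fst j)" by blast
  have PC: "P \<inter> C z = {q\<in>P. cl (fst z) q = snd z}" for z by (auto simp: C_def)
  define sat where "sat m p \<longleftrightarrow> m \<le> n \<and> sum \<mu> {q\<in>P. cl m q = cl m p} = w m" for m p
  have ex: "\<exists>m. sat m p" if pP: "p \<in> P" for p
  proof -
    obtain j where "j \<in> J" "p \<in> C j" "sum \<mu> (P \<inter> C j) = w (fst j)" using \<mu>(3)[OF pP] by blast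
    then show ?thesis unfolding PC sat_def by (intro exI[of _ "fst j"]) (auto simp: J_def C_def)
  qed
  define L where "L p = (LEAST m. sat m p)" for p
  have satL: "sat (L p) p" if "p \<in> P" for p using ex[OF that] unfolding L_def by (rule LeastI_ex)
  have leastL: "L p \<le> m" if "sat m p" for p m using that unfolding L_def by (rule Least_le)
  have nest': "cl k p = cl k q" if "cl m p = cl m q" "k \<le> m" for k m p q
    using that(2,1) by (induction rule: inc_induct) (auto intro: nest)
  let ?c = "\<lambda>p. (L p, cl (L p) p)"
  \<comment> \<open>Every point of the cell chosen by \<open>p0\<close> chooses that very cell: the
    cell is saturated for it as well, and a smaller level for it would, by nesting, saturate a
    larger cell around \<open>p0\<close> too. Hence the fibres of \<open>?c\<close> are full
    cells.\<close>
  have fib: "{p\<in>P. ?c p = ?c p0} = {p\<in>P. cl (L p0) p = cl (L p0) p0}" if p0: "p0 \<in> P" for p0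
  proof safe
    fix p assume p: "p \<in> P" "cl (L p0) p = cl (L p0) p0"
    have "sat (L p0) p" using satL[OF p0] p unfolding sat_def by simp
    then have le: "L p \<le> L p0" by (rule leastL)
    then have "cl (L p) p = cl (L p) p0" using nest'[OF p(2)] by simp
    then have "sat (L p) p0" using satL[OF p(1)] unfolding sat_def by simp
    then have "L p0 \<le> L p" by (rule leastL)
    then show eq: "L p = L p0" using le by simp
    show "cl (L p) p = cl (L p0) p0" using eq p by simp
  qed auto
  have "sum \<mu> P = (\<Sum>z\<in>?c ` P. sum \<mu> {p\<in>P. ?c p = z})"
    by (rule sum.image_gen[OF P])
  also have "\<dots> = (\<Sum>z\<in>?c ` P. w (fst z))"
  proof (intro sum.cong refl)
    fix z assume "z \<in> ?c ` P"
    then obtain p0 where p0: "p0 \<in> P" "z = ?c p0" by blast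
    have "sum \<mu> {p\<in>P. ?c p = z} = sum \<mu> {p\<in>P. cl (L p0) p = cl (L p0) p0}"
      unfolding p0(2) fib[OF p0(1)] ..
    also have "\<dots> = w (L p0)" using satL[OF p0(1)] by (simp add: sat_def)
    finally show "sum \<mu> {p\<in>P. ?c p = z} = w (fst z)" by (simp add: p0(2))
  qed
  finally have total: "sum \<mu> P = (\<Sum>z\<in>?c ` P. w (fst z))" .
  have mass: "sum \<mu> {q\<in>P. cl m q = l} \<le> w m" if "m \<le> n" for m l
  proof (cases "l \<in> cl m ` P")
    case True
    then have "(m, l) \<in> J" using that by (simp add: J_def)
    from \<mu>(2)[OF this] show ?thesis by (simp add: PC)
  next
    case False
    then have "{q\<in>P. cl m q = l} = {}" by auto
    then show ?thesis using w by (simp only: sum.empty)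
  qed
  show ?thesis
    by (rule exI[of _ \<mu>], rule exI[of _ L]) (use \<mu>(1) mass satL total in \<open>auto simp: sat_def\<close>)
qed

text \<open>
  The cells of level \<open>m\<close> have time length \<open>2 powr - m\<close> and height about \<open>2 powr - (h * m)\<close>, rounded to a
  power of \<open>2\<close> so that the cells of successive levels are nested.
\<close>
definition cell_exponent :: "real \<Rightarrow> nat \<Rightarrow> nat" where
  "cell_exponent h m = nat \<lfloor>h * real m\<rfloor>"

definition graph_cell :: "real \<Rightarrow> (real \<Rightarrow> real) \<Rightarrow> nat \<Rightarrow> real \<Rightarrow> int \<times> int" where
  "graph_cell h H m u = (\<lfloor>2 ^ m * u\<rfloor>, \<lfloor>2 ^ cell_exponent h m * H u\<rfloor>)"

text \<open>The \<open>s\<close>-th power of the bound for the parabolic diameter of a cell of level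
  \<open>m\<close>; the summand \<open>1\<close> in the exponent pays for rounding
  \<open>h * real m\<close> down to an integer.\<close>

definition cell_weight :: "real \<Rightarrow> real \<Rightarrow> nat \<Rightarrow> real" where
  "cell_weight h s m = (2 powr (1 - h * real m)) powr s"

lemma cell_exponent_bounds:
  assumes "0 \<le> h"
  shows "real (cell_exponent h m) \<le> h * real m" "h * real m < real (cell_exponent h m) + 1"
  using assms unfolding cell_exponent_def by (auto simp: of_nat_nat)

lemma cell_exponent_mono: "0 \<le> h \<Longrightarrow> m \<le> m' \<Longrightarrow> cell_exponent h m \<le> cell_exponent h m'"
  unfolding cell_exponent_def by (intro nat_mono floor_mono mult_left_mono) auto

text \<open>The coarse floor is the integer quotient of the fine one by
  \<open>2 ^ (a - b)\<close>.\<close>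

lemma dyadic_floor_nested:
  fixes x y :: real
  assumes "\<lfloor>2 ^ a * x\<rfloor> = \<lfloor>2 ^ a * y\<rfloor>" "b \<le> a"
  shows "\<lfloor>2 ^ b * x\<rfloor> = \<lfloor>2 ^ b * y\<rfloor>"
proof -
  have "\<lfloor>2 ^ b * z\<rfloor> = \<lfloor>2 ^ a * z\<rfloor> div 2 ^ (a - b)" for z :: real
  proof -
    have "2 ^ b * z = 2 ^ a * z / 2 ^ (a - b)" using assms(2) by (simp add: power_diff)
    then have "\<lfloor>2 ^ b * z\<rfloor> = \<lfloor>2 ^ a * z / real_of_int (2 ^ (a - b))\<rfloor>" by simp
    also have "\<dots> = \<lfloor>2 ^ a * z\<rfloor> div 2 ^ (a - b)" by (rule floor_divide_real_eq_div) simp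
    finally show ?thesis .
  qed
  then show ?thesis using assms(1) by simp
qed

lemma graph_cell_nested:
  assumes "0 \<le> h" "graph_cell h H (Suc m) u = graph_cell h H (Suc m) v"
  shows "graph_cell h H m u = graph_cell h H m v"
  using assms dyadic_floor_nested[of "Suc m" u v m]
    dyadic_floor_nested[of "cell_exponent h (Suc m)" "H u" "H v" "cell_exponent h m"] cell_exponent_mono[of h m "Suc m"]
  by (auto simp: graph_cell_def)

lemma dyadic_floor_close:
  fixes x y :: real
  assumes "\<lfloor>2 ^ a * x\<rfloor> = \<lfloor>2 ^ a * y\<rfloor>"
  shows "\<bar>x - y\<bar> \<le> 2 powr - real a"
proof -
  have "\<bar>2 ^ a * x - 2 ^ a * y\<bar> \<le> 1" using assms by linarith
  then have "2 ^ a * \<bar>x - y\<bar> \<le> 1" by (simp add: right_diff_distrib[symmetric] abs_mult)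
  then show ?thesis by (simp add: powr_minus powr_realpow field_simps)
qed

lemma graph_cell_diam:
  assumes h: "0 < h" and eq: "graph_cell h H m u = graph_cell h H m v"
  shows "parabolic_dist h (u, H u) (v, H v) \<le> 2 powr (1 - h * real m)"
proof -
  have "\<bar>u - v\<bar> \<le> 2 powr - real m" using eq dyadic_floor_close[of m u v] by (simp add: graph_cell_def)
  then have "\<bar>u - v\<bar> powr h \<le> (2 powr - real m) powr h" using h by (intro powr_mono2) auto
  also have "\<dots> \<le> 2 powr (1 - h * real m)" by (simp add: powr_powr mult.commute)
  finally have 1: "\<bar>u - v\<bar> powr h \<le> 2 powr (1 - h * real m)" .
  have "\<bar>H u - H v\<bar> \<le> 2 powr - real (cell_exponent h m)"
    using eq dyadic_floor_close[of "cell_exponent h m" "H u" "H v"] by (simp add: graph_cell_def)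
  also have "\<dots> \<le> 2 powr (1 - h * real m)" using cell_exponent_bounds(2)[of h m] h by (intro powr_mono) auto
  finally show ?thesis using 1 by (simp add: parabolic_dist_def)
qed

text \<open>The constant \<open>c\<close> is independent of the level \<open>n\<close>: the mass
  equals the total weight of the chosen cells, these cover the whole graph, and the pre-measure at
  one fixed scale bounds the weight of fine covers from below. Infinite outer measure enters through
  a scale at which the pre-measure is at least \<open>1\<close>.\<close>

lemma frostman_graph:
  fixes H :: "real \<Rightarrow> real"
  assumes h: "0 < h" and s: "0 < s" and out: "hausdorff_outer (parabolic_dist h) s (graph_on H V) = \<infinity>"
    and bnd: "bounded V" "bounded (H ` V)"
  shows "\<exists>c>0. \<forall>n. \<exists>P \<mu>. finite P \<and> P \<subseteq> V \<and> (\<forall>u. 0 \<le> \<mu> u) \<and> c \<le> sum \<mu> P \<and>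
     (\<forall>m\<le>n. \<forall>l. sum \<mu> {q\<in>P. graph_cell h H m q = l} \<le> cell_weight h s m)"
proof -
  let ?d = "parabolic_dist h" and ?A = "graph_on H V"
  have "\<not> (\<forall>\<delta>>0. hausdorff_pre ?d s ?A \<delta> \<le> 1)"
    using out hausdorff_outer_leI[of ?d s ?A 1] by (auto simp: top_unique)
  then obtain \<delta> where \<delta>: "0 < \<delta>" "1 \<le> hausdorff_pre ?d s ?A \<delta>" by (auto simp: not_le)
  \<comment> \<open>If all chosen cells have diameter bound at most \<open>\<delta>\<close>, they
    form an admissible cover of weight at least \<open>1\<close>; otherwise one coarse cell alone
    weighs at least \<open>\<delta> powr s\<close>.\<close>
  define c where "c = min 1 (\<delta> powr s)"
  have c: "0 < c" using \<delta> by (simp add: c_def)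
  have "\<exists>P \<mu>. finite P \<and> P \<subseteq> V \<and> (\<forall>u. 0 \<le> \<mu> u) \<and> c \<le> sum \<mu> P \<and>
     (\<forall>m\<le>n. \<forall>l. sum \<mu> {q\<in>P. graph_cell h H m q = l} \<le> cell_weight h s m)" for n
  proof -
    let ?cl = "graph_cell h H"
    have fin: "finite (?cl n ` V)"
    proof -
      obtain a where a: "\<And>u. u \<in> V \<Longrightarrow> \<bar>u\<bar> \<le> a" "\<And>u. u \<in> V \<Longrightarrow> \<bar>H u\<bar> \<le> a"
        using bnd unfolding bounded_iff by (metis image_eqI max.cobounded1 max.cobounded2 order_trans real_norm_def)
      have "\<lfloor>2 ^ k * x\<rfloor> \<in> {\<lfloor>- (2 ^ k * a)\<rfloor> .. \<lfloor>2 ^ k * a\<rfloor>}" if "\<bar>x\<bar> \<le> a" for k x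
      proof -
        have "x \<le> a" "- a \<le> x" using that by linarith+
        then have "2 ^ k * x \<le> 2 ^ k * a" "2 ^ k * (- a) \<le> 2 ^ k * x"
          using mult_left_mono[of x a "2 ^ k"] mult_left_mono[of "- a" x "2 ^ k"] by auto
        then show ?thesis by (auto intro!: floor_mono)
      qed
      then have "?cl n ` V \<subseteq> {\<lfloor>- (2 ^ n * a)\<rfloor> .. \<lfloor>2 ^ n * a\<rfloor>} \<times>
          {\<lfloor>- (2 ^ cell_exponent h n * a)\<rfloor> .. \<lfloor>2 ^ cell_exponent h n * a\<rfloor>}"
        using a by (auto simp: graph_cell_def)
      then show ?thesis by (rule finite_subset) auto
    qed
    \<comment> \<open>One point of \<open>V\<close> for each nonempty cell of the finest level;
      boundedness makes these cells finite in number.\<close>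
    define rep where "rep l = (SOME u. u \<in> V \<and> ?cl n u = l)" for l
    have rep: "rep (?cl n u) \<in> V \<and> ?cl n (rep (?cl n u)) = ?cl n u" if "u \<in> V" for u
      unfolding rep_def by (rule someI[of _ u]) (use that in auto)
    define P where "P = rep ` ?cl n ` V"
    have P: "finite P" "P \<subseteq> V" using fin rep by (auto simp: P_def)
    have w: "0 \<le> cell_weight h s m" for m by (simp add: cell_weight_def)
    obtain \<mu> L where \<mu>: "\<And>p. 0 \<le> \<mu> p" "\<And>m l. m \<le> n \<Longrightarrow> sum \<mu> {q\<in>P. ?cl m q = l} \<le> cell_weight h s m"
        "\<And>p. p \<in> P \<Longrightarrow> L p \<le> n" "sum \<mu> P = (\<Sum>z\<in>(\<lambda>p. (L p, ?cl (L p) p)) ` P. cell_weight h s (fst z))"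
      using frostman_nested_partitions[of P "cell_weight h s" ?cl n, OF P(1) w graph_cell_nested[OF less_imp_le[OF h]]]
      by blast
    define Q where "Q = (\<lambda>p. (L p, ?cl (L p) p)) ` P"
    have Q: "finite Q" using P by (simp add: Q_def)
    have "c \<le> (\<Sum>z\<in>Q. cell_weight h s (fst z))"
    proof (cases "\<forall>z\<in>Q. 2 powr (1 - h * real (fst z)) \<le> \<delta>")
      case True
      define C where "C z = (\<lambda>u. (u, H u)) ` {u\<in>V. ?cl (fst z) u = snd z}" for z
      have Cd: "ediam ?d (C z) \<le> ennreal (2 powr (1 - h * real (fst z)))" for z
        by (intro ediam_le) (auto simp: C_def intro!: graph_cell_diam h)
      have cover: "?A \<subseteq> (\<Union>z\<in>Q. C z)"
      proof
        fix x assume "x \<in> ?A"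
        then obtain u where u: "u \<in> V" "x = (u, H u)" by (auto simp: graph_on_def)
        define p where "p = rep (?cl n u)"
        have p: "p \<in> P" "?cl n p = ?cl n u" using u rep by (auto simp: P_def p_def)
        \<comment> \<open>Points \<open>u\<close> outside \<open>P\<close> are covered as well:
          \<open>u\<close> shares its finest cell with its representative \<open>p\<close>, hence
          also the coarser cell chosen by \<open>p\<close>.\<close>
        have "?cl (L p) p = ?cl (L p) u"
          using \<mu>(3)[OF p(1)] p(2) by (induction rule: inc_induct) (use h in \<open>auto intro: graph_cell_nested\<close>)
        then show "x \<in> (\<Union>z\<in>Q. C z)" using p u by (intro UN_I[of "(L p, ?cl (L p) p)"]) (auto simp: Q_def C_def)
      qed
      have "1 \<le> hausdorff_pre ?d s ?A \<delta>" by (rule \<delta>(2))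
      also have "\<dots> \<le> (\<Sum>z\<in>Q. ennreal (enn2real (ediam ?d (C z)) powr s))"
        using True by (intro hausdorff_pre_finite_cover Q cover order_trans[OF Cd] ennreal_leI) auto
      also have "\<dots> \<le> (\<Sum>z\<in>Q. ennreal (cell_weight h s (fst z)))"
        unfolding cell_weight_def using s
        by (intro sum_mono ennreal_leI powr_mono2 enn2real_ediam_le Cd) auto
      also have "\<dots> = ennreal (\<Sum>z\<in>Q. cell_weight h s (fst z))" using w by (intro sum_ennreal) auto
      finally have "1 \<le> (\<Sum>z\<in>Q. cell_weight h s (fst z))"
        by (simp add: ennreal_1[symmetric] ennreal_le_iff sum_nonneg w del: ennreal_1)
      then show ?thesis by (simp add: c_def)
    next
      case False
      then obtain z where z: "z \<in> Q" "\<delta> < 2 powr (1 - h * real (fst z))" by (auto simp: not_le)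
      have "\<delta> powr s \<le> cell_weight h s (fst z)" unfolding cell_weight_def using z \<delta> s by (intro powr_mono2) auto
      also have "\<dots> \<le> (\<Sum>z\<in>Q. cell_weight h s (fst z))" using Q z w by (intro member_le_sum) auto
      finally show ?thesis by (simp add: c_def)
    qed
    then have "c \<le> sum \<mu> P" using \<mu>(4) by (simp add: Q_def)
    then show ?thesis using P \<mu>(1,2) by blast
  qed
  then show ?thesis using c by blast
qed

section \<open>Dyadic decomposition of the energy\<close>

lemma greatest_initial_index:
  assumes "Q 0"
  shows "\<exists>j\<le>n. Q j \<and> (j < n \<longrightarrow> \<not> Q (Suc j))"
proof (induction n)
  case (Suc n)
  then obtain j where "j \<le> n" "Q j" "j < n \<longrightarrow> \<not> Q (Suc j)" by blast
  then show ?case by (cases "Q (Suc j) \<and> j = n") (auto intro: exI[of _ j] exI[of _ "Suc j"] simp: less_Suc_eq)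
qed (use assms in auto)

text \<open>Here \<open>a\<close> and \<open>b\<close> stand for the time and Hurst distances of two
  points and \<open>K\<close> for the mean of the truncated kernel. The scale \<open>j\<close>
  follows \<open>a\<close> and \<open>i\<close> follows \<open>b\<close>; \<open>i\<close> stops at
  \<open>cell_exponent h j\<close>, beyond which \<open>a powr h\<close> governs the maximum. The
  truncation is tuned so that \<open>\<epsilon> powr - s' = 2 powr (real n * (s' - 1 + h))\<close>,
  the order of the kernel bound in the finest block.\<close>

lemma kernel_dyadic_bound:
  fixes a b K A :: real
  assumes h: "0 < h" "h < 1" and s': "1 < s'" and A: "1 \<le> A"
    and ab: "0 \<le> a" "a \<le> 1" "0 \<le> b" "b \<le> 1"
    and \<epsilon>: "\<epsilon> = 2 powr - (real n * ((s' - 1 + h) / s'))"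
    and K1: "K \<le> \<epsilon> powr - s'"
    and K2: "0 < a \<Longrightarrow> K \<le> A * max a \<epsilon> powr (1 - s') / max (a powr h) b"
    and a0: "a = 0 \<Longrightarrow> b = 0"
  shows "\<exists>j\<le>n. \<exists>i\<le>cell_exponent h j. a \<le> 2 powr - real j \<and> b \<le> 2 powr - real i \<and>
     K \<le> A * 2 powr (s' + 1) * (2 powr (real j * (s' - 1)) * 2 ^ i)"
proof -
  obtain j where j: "j \<le> n" "a \<le> 2 powr - real j" and jn: "j < n \<Longrightarrow> 2 powr - real (Suc j) < a"
    using greatest_initial_index[of "\<lambda>j. a \<le> 2 powr - real j" n] ab by (auto simp: not_le)
  obtain i where i: "i \<le> cell_exponent h j" "b \<le> 2 powr - real i" and ij: "i < cell_exponent h j \<Longrightarrow> 2 powr - real (Suc i) < b"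
    using greatest_initial_index[of "\<lambda>i. b \<le> 2 powr - real i" "cell_exponent h j"] ab by (auto simp: not_le)
  have pi: "2 ^ i = 2 powr real i" by (simp add: powr_realpow)
  have eps0: "0 < \<epsilon>" by (simp add: \<epsilon>)
  have goal: "K \<le> A * 2 powr (s' + 1) * (2 powr (real j * (s' - 1)) * 2 ^ i)"
  \<comment> \<open>In the finest block \<open>a\<close> and \<open>b\<close> have no lower bound,
    and \<open>a\<close> may vanish, so the trivial bound \<open>K1\<close> is used. In every other
    block one of them is bounded below, which forces \<open>0 < a\<close> and gives access to
    \<open>K2\<close>.\<close>
  proof (cases "j = n \<and> i = cell_exponent h j")
    case True
    have "K \<le> 2 powr (real n * (s' - 1 + h))"
      using K1 s' by (simp add: \<epsilon> powr_powr)
    also have "\<dots> \<le> 2 powr ((s' + 1) + (real j * (s' - 1) + real i))"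
    proof (intro powr_mono)
      show "real n * (s' - 1 + h) \<le> (s' + 1) + (real j * (s' - 1) + real i)"
        using True cell_exponent_bounds(2)[of h j] h s' by (simp add: algebra_simps)
    qed simp
    also have "\<dots> = 1 * (2 powr (s' + 1) * (2 powr (real j * (s' - 1)) * 2 ^ i))" by (simp add: powr_add pi)
    also have "\<dots> \<le> A * (2 powr (s' + 1) * (2 powr (real j * (s' - 1)) * 2 ^ i))"
      using A by (intro mult_right_mono) auto
    finally show ?thesis by (simp add: mult.assoc)
  next
    case False
    have a: "0 < a"
    proof (cases "j < n")
      case True
      have "0 < 2 powr - real (Suc j)" by simp
      then show ?thesis using jn[OF True] by linarith
    next
      case False
      then have "i < cell_exponent h j" using \<open>\<not> (j = n \<and> i = cell_exponent h j)\<close> i j by auto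
      moreover have "0 < 2 powr - real (Suc i)" by simp
      ultimately have "0 < b" using ij by linarith
      then show ?thesis using a0 ab by linarith
    qed
    \<comment> \<open>For \<open>j < n\<close> this rests on the lower bound for \<open>a\<close>.
      For \<open>j = n\<close> it rests on the truncation: the ratio in the exponent of
      \<open>\<epsilon>\<close> is at most \<open>1\<close>, so
      \<open>2 powr - real n \<le> \<epsilon>\<close>.\<close>
    have X: "max a \<epsilon> powr (1 - s') \<le> 2 powr ((real j + 1) * (s' - 1))"
    proof (cases "j < n")
      case True
      have "max a \<epsilon> powr (1 - s') \<le> (2 powr - real (Suc j)) powr (1 - s')"
        using jn[OF True] s' by (intro powr_mono2') auto
      then show ?thesis by (simp add: powr_powr algebra_simps)
    next
      case False
      then have "j = n" using j by simp
      have "(s' - 1 + h) / s' \<le> 1" using h s' by (simp add: field_simps)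
      then have "real n * ((s' - 1 + h) / s') \<le> real n * 1" by (intro mult_left_mono) auto
      then have "2 powr - real n \<le> \<epsilon>" unfolding \<epsilon> by (intro powr_mono) auto
      then have "max a \<epsilon> powr (1 - s') \<le> (2 powr - real n) powr (1 - s')"
        using s' by (intro powr_mono2') auto
      also have "\<dots> = 2 powr (real j * (s' - 1))" using \<open>j = n\<close> by (simp add: powr_powr algebra_simps)
      also have "\<dots> \<le> 2 powr ((real j + 1) * (s' - 1))" using s' by (intro powr_mono) (auto simp: algebra_simps)
      finally show ?thesis .
    qed
    \<comment> \<open>The offset \<open>2\<close> comes from the case
      \<open>i = cell_exponent h j\<close>: the maximum is at least
      \<open>2 powr - (h * (real j + 1))\<close>, where \<open>h * real j < real i + 1\<close> and
      \<open>h < 1\<close>.\<close>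
    have Y: "2 powr - (real i + 2) \<le> max (a powr h) b"
    proof (cases "i < cell_exponent h j")
      case True
      have "2 powr - (real i + 2) \<le> 2 powr - real (Suc i)" by (intro powr_mono) auto
      then show ?thesis using ij[OF True] by linarith
    next
      case False
      then have ii: "i = cell_exponent h j" using i by simp
      then have "j < n" using \<open>\<not> (j = n \<and> i = cell_exponent h j)\<close> j by auto
      from jn[OF this] have "(2 powr - real (Suc j)) powr h \<le> a powr h" using h by (intro powr_mono2) auto
      moreover have "2 powr - (real i + 2) \<le> (2 powr - real (Suc j)) powr h"
        unfolding powr_powr using cell_exponent_bounds(2)[of h j] h ii by (intro powr_mono) (auto simp: algebra_simps)
      ultimately show ?thesis by linarith
    qed
    have "K \<le> A * max a \<epsilon> powr (1 - s') / max (a powr h) b" by (rule K2[OF a])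
    also have "\<dots> \<le> A * 2 powr ((real j + 1) * (s' - 1)) / 2 powr - (real i + 2)"
      using X Y A by (intro frac_le mult_left_mono mult_nonneg_nonneg) auto
    also have "\<dots> = A * 2 powr ((real j + 1) * (s' - 1) - - (real i + 2))"
      by (simp only: times_divide_eq_right[symmetric] powr_diff)
    also have "(real j + 1) * (s' - 1) - - (real i + 2) = (s' + 1) + (real j * (s' - 1) + real i)"
      by (simp add: algebra_simps)
    also have "A * 2 powr ((s' + 1) + (real j * (s' - 1) + real i)) = A * 2 powr (s' + 1) * (2 powr (real j * (s' - 1)) * 2 ^ i)" by (simp add: powr_add pi mult.assoc)
    finally show ?thesis .
  qed
  show ?thesis using i j goal by blast
qed

text \<open>The \<open>9\<close> is \<open>3\<close> columns times at most \<open>3 * N\<close>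
  rows: the neighbourhood meets only cells of level \<open>j\<close> whose time index differs by at
  most \<open>1\<close> and whose height index differs by at most
  \<open>N = 2 ^ (cell_exponent h j - i)\<close>.\<close>

lemma dyadic_neighbourhood_mass:
  fixes H :: "real \<Rightarrow> real" and \<mu> :: "real \<Rightarrow> real"
  assumes P: "finite P" and \<mu>: "\<And>u. 0 \<le> \<mu> u"
    and mass: "\<And>l. sum \<mu> {q\<in>P. graph_cell h H j q = l} \<le> w" and i: "i \<le> cell_exponent h j"
  shows "sum \<mu> {v\<in>P. \<bar>u - v\<bar> \<le> 2 powr - real j \<and> \<bar>H u - H v\<bar> \<le> 2 powr - real i} \<le> 9 * 2 ^ (cell_exponent h j - i) * w"
proof -
  define k where "k = cell_exponent h j"
  define N :: nat where "N = 2 ^ (k - i)"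
  have N: "1 \<le> N" by (simp add: N_def)
  define S where "S = {v\<in>P. \<bar>u - v\<bar> \<le> 2 powr - real j \<and> \<bar>H u - H v\<bar> \<le> 2 powr - real i}"
  define x y where "x = \<lfloor>2 ^ j * u\<rfloor>" and "y = \<lfloor>2 ^ k * H u\<rfloor>"
  define T where "T = {x - 1..x + 1} \<times> {y - int N..y + int N}"
  have sub: "graph_cell h H j ` S \<subseteq> T"
  proof
    fix l assume "l \<in> graph_cell h H j ` S"
    then obtain v where v: "v \<in> S" "l = graph_cell h H j v" by blast
    have "2 ^ j * \<bar>u - v\<bar> \<le> 2 ^ j * 2 powr - real j" using v(1) by (intro mult_left_mono) (auto simp: S_def)
    also have "\<dots> = 1" by (simp add: powr_minus powr_realpow)
    finally have 1: "\<bar>2 ^ j * u - 2 ^ j * v\<bar> \<le> 1" by (simp add: right_diff_distrib[symmetric] abs_mult)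
    have "2 ^ k * \<bar>H u - H v\<bar> \<le> 2 ^ k * 2 powr - real i" using v(1) by (intro mult_left_mono) (auto simp: S_def)
    also have "\<dots> = 2 ^ (k - i)" using i by (simp add: powr_minus powr_realpow k_def power_diff field_simps)
    also have "\<dots> = real N" by (simp add: N_def)
    finally have 2: "\<bar>2 ^ k * H u - 2 ^ k * H v\<bar> \<le> of_int (int N)" by (simp add: right_diff_distrib[symmetric] abs_mult)
    have "\<lfloor>2 ^ k * H v\<rfloor> \<le> \<lfloor>2 ^ k * H u + of_int (int N)\<rfloor>" "\<lfloor>2 ^ k * H u\<rfloor> \<le> \<lfloor>2 ^ k * H v + of_int (int N)\<rfloor>"
      using 2 by (intro floor_mono; linarith)+
    then have "\<lfloor>2 ^ k * H v\<rfloor> \<in> {y - int N..y + int N}" unfolding floor_add_int[symmetric] y_def by auto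
    moreover have "\<lfloor>2 ^ j * v\<rfloor> \<in> {x - 1..x + 1}" using 1 unfolding x_def by (simp; linarith)
    ultimately show "l \<in> T" unfolding v(2) graph_cell_def T_def k_def by simp
  qed
  have "sum \<mu> S = (\<Sum>l\<in>T. sum \<mu> {v\<in>S. graph_cell h H j v = l})"
    using P sub by (intro sum.group[symmetric]) (auto simp: S_def T_def)
  also have "\<dots> \<le> (\<Sum>l\<in>T. w)"
  proof (intro sum_mono)
    fix l
    have "sum \<mu> {v\<in>S. graph_cell h H j v = l} \<le> sum \<mu> {q\<in>P. graph_cell h H j q = l}"
      using P \<mu> by (intro sum_mono2) (auto simp: S_def)
    then show "sum \<mu> {v\<in>S. graph_cell h H j v = l} \<le> w" using mass[of l] by linarith
  qed
  also have "\<dots> = real (card T) * w" by simp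
  also have "\<dots> \<le> real (9 * N) * w"
  proof (intro mult_right_mono)
    have "card T = 3 * (2 * N + 1)" unfolding T_def by (simp add: card_cartesian_product nat_add_distrib)
    then have "card T = 6 * N + 3" by simp
    then have "card T \<le> 9 * N" using N by linarith
    then show "real (card T) \<le> real (9 * N)" by (simp only: of_nat_le_iff)
    show "0 \<le> w" using mass[of "(0,0)"] \<mu> by (meson order_trans sum_nonneg)
  qed
  finally show ?thesis by (simp add: S_def N_def k_def)
qed

text \<open>One factor \<open>9 * 2 powr s\<close> bounds the total mass, the other comes from the
  mass of a block; the squared denominator sums the series of \<open>real (Suc j) * x ^ j\<close>
  with \<open>x = 2 powr - (h * (s - 1) - (s' - 1))\<close>. The point is that no level
  \<open>n\<close> occurs.\<close>

definition energy_bound :: "real \<Rightarrow> real \<Rightarrow> real \<Rightarrow> real \<Rightarrow> real" where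
  "energy_bound h s s' A = A * 2 powr (s' + 1) * (9 * 2 powr s) * (9 * 2 powr s) / (1 - 2 powr - (h * (s - 1) - (s' - 1)))\<^sup>2"

text \<open>In the block \<open>(j, i)\<close> the factor \<open>2 ^ i\<close> of the kernel cancels
  against \<open>2 ^ (cell_exponent h j - i)\<close> in the mass, so \<open>i\<close> survives only
  through the number of its values, at most \<open>j + 1\<close>. What remains is a series in powers
  of some \<open>x < 1\<close>, because \<open>s' < 1 + h * (s - 1)\<close>.\<close>

lemma energy_le:
  fixes H :: "real \<Rightarrow> real" and \<mu> :: "real \<Rightarrow> real" and K :: "real \<Rightarrow> real \<Rightarrow> real"
  assumes P: "finite P" and \<mu>: "\<And>u. 0 \<le> \<mu> u"
    and mass: "\<And>m l. m \<le> n \<Longrightarrow> sum \<mu> {q\<in>P. graph_cell h H m q = l} \<le> cell_weight h s m"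
    and diam: "\<And>u v. u \<in> P \<Longrightarrow> v \<in> P \<Longrightarrow> \<bar>u - v\<bar> \<le> 1 \<and> \<bar>H u - H v\<bar> \<le> 1"
    and h: "0 < h" "h < 1" and s: "1 < s'" "s' < 1 + h * (s - 1)" and A: "1 \<le> A"
    and \<epsilon>: "\<epsilon> = 2 powr - (real n * ((s' - 1 + h) / s'))"
    and K1: "\<And>u v. u \<in> P \<Longrightarrow> v \<in> P \<Longrightarrow> K u v \<le> \<epsilon> powr - s'"
    and K2: "\<And>u v. u \<in> P \<Longrightarrow> v \<in> P \<Longrightarrow> u \<noteq> v \<Longrightarrow>
      K u v \<le> A * max \<bar>u - v\<bar> \<epsilon> powr (1 - s') / max (\<bar>u - v\<bar> powr h) \<bar>H u - H v\<bar>"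
  shows "(\<Sum>u\<in>P. \<Sum>v\<in>P. \<mu> u * \<mu> v * K u v) \<le> energy_bound h s s' A"
proof -
  define B where "B = A * 2 powr (s' + 1)"
  have B: "0 \<le> B" using A by (simp add: B_def)
  define x where "x = 2 powr - (h * (s - 1) - (s' - 1))"
  have x: "0 < x" "x < 1" using s by (auto simp: x_def powr_less_one)
  define \<Lambda> where "\<Lambda> = 9 * 2 powr s"
  define near where "near i j u v = (if \<bar>u - v\<bar> \<le> 2 powr - real j \<and> \<bar>H u - H v\<bar> \<le> 2 powr - real i then 1 else 0 :: real)" for i j :: nat and u v
  have tot: "sum \<mu> P \<le> \<Lambda>"
  proof (cases "P = {}")
    case False
    then obtain u where u: "u \<in> P" by blast
    have "{v\<in>P. \<bar>u - v\<bar> \<le> 2 powr - real 0 \<and> \<bar>H u - H v\<bar> \<le> 2 powr - real 0} = P" using diam[OF u] by auto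
    then show ?thesis using dyadic_neighbourhood_mass[where j = 0 and i = 0 and u = u and P = P and \<mu> = \<mu> and h = h and H = H and w = "cell_weight h s 0"]
      P \<mu> mass[of 0] by (simp add: \<Lambda>_def cell_weight_def cell_exponent_def)
  qed (simp add: \<Lambda>_def)
  have pt: "K u v \<le> B * (\<Sum>j\<le>n. \<Sum>i\<le>cell_exponent h j. 2 powr (real j * (s' - 1)) * 2 ^ i * near i j u v)"
    if uv: "u \<in> P" "v \<in> P" for u v
  proof -
    have "\<exists>j\<le>n. \<exists>i\<le>cell_exponent h j. \<bar>u - v\<bar> \<le> 2 powr - real j \<and> \<bar>H u - H v\<bar> \<le> 2 powr - real i \<and>
        K u v \<le> A * 2 powr (s' + 1) * (2 powr (real j * (s' - 1)) * 2 ^ i)"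
      using K1[OF uv] K2[OF uv] diam[OF uv] by (intro kernel_dyadic_bound[OF h s(1) A _ _ _ _ \<epsilon>]) auto
    then obtain j i where ji: "j \<le> n" "i \<le> cell_exponent h j" "\<bar>u - v\<bar> \<le> 2 powr - real j" "\<bar>H u - H v\<bar> \<le> 2 powr - real i"
        "K u v \<le> B * (2 powr (real j * (s' - 1)) * 2 ^ i)" unfolding B_def by blast
    have "2 powr (real j * (s' - 1)) * 2 ^ i = 2 powr (real j * (s' - 1)) * 2 ^ i * near i j u v"
      using ji by (simp add: near_def)
    also have "\<dots> \<le> (\<Sum>i\<le>cell_exponent h j. 2 powr (real j * (s' - 1)) * 2 ^ i * near i j u v)"
      using ji by (intro member_le_sum) (auto simp: near_def)
    also have "\<dots> \<le> (\<Sum>j\<le>n. \<Sum>i\<le>cell_exponent h j. 2 powr (real j * (s' - 1)) * 2 ^ i * near i j u v)"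
      using ji by (intro member_le_sum sum_nonneg) (auto simp: near_def)
    finally have "B * (2 powr (real j * (s' - 1)) * 2 ^ i)
        \<le> B * (\<Sum>j\<le>n. \<Sum>i\<le>cell_exponent h j. 2 powr (real j * (s' - 1)) * 2 ^ i * near i j u v)"
      using B by (intro mult_left_mono)
    then show ?thesis using ji(5) by linarith
  qed
  have row: "(\<Sum>v\<in>P. \<mu> v * K u v) \<le> B * (\<Lambda> / (1 - x)\<^sup>2)" if u: "u \<in> P" for u
  proof -
    have "(\<Sum>v\<in>P. \<mu> v * K u v) \<le> (\<Sum>v\<in>P. \<mu> v * (B * (\<Sum>j\<le>n. \<Sum>i\<le>cell_exponent h j. 2 powr (real j * (s' - 1)) * 2 ^ i * near i j u v)))"
      using \<mu> by (intro sum_mono mult_left_mono pt u) auto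
    also have "\<dots> = B * (\<Sum>v\<in>P. \<Sum>j\<le>n. \<Sum>i\<le>cell_exponent h j. \<mu> v * (2 powr (real j * (s' - 1)) * 2 ^ i * near i j u v))"
      by (simp add: sum_distrib_left mult_ac)
    also have "(\<Sum>v\<in>P. \<Sum>j\<le>n. \<Sum>i\<le>cell_exponent h j. \<mu> v * (2 powr (real j * (s' - 1)) * 2 ^ i * near i j u v))
        = (\<Sum>j\<le>n. \<Sum>v\<in>P. \<Sum>i\<le>cell_exponent h j. \<mu> v * (2 powr (real j * (s' - 1)) * 2 ^ i * near i j u v))"
      by (rule sum.swap)
    also have "\<dots> = (\<Sum>j\<le>n. \<Sum>i\<le>cell_exponent h j. \<Sum>v\<in>P. \<mu> v * (2 powr (real j * (s' - 1)) * 2 ^ i * near i j u v))"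
      by (intro sum.cong refl sum.swap)
    also have "\<dots> \<le> (\<Sum>j\<le>n. \<Sum>i\<le>cell_exponent h j. \<Lambda> * (2 powr (real j * (s' - 1)) * 2 powr (h * real j) * 2 powr - (s * h * real j)))"
    proof (intro sum_mono)
      fix j i assume j: "j \<in> {..n}" and i: "i \<in> {..cell_exponent h j}"
      have "(\<Sum>v\<in>P. \<mu> v * (2 powr (real j * (s' - 1)) * 2 ^ i * near i j u v))
          = 2 powr (real j * (s' - 1)) * 2 ^ i * (\<Sum>v\<in>P. \<mu> v * near i j u v)"
        by (simp add: sum_distrib_left mult_ac)
      also have "(\<Sum>v\<in>P. \<mu> v * near i j u v) = sum \<mu> {v\<in>P. \<bar>u - v\<bar> \<le> 2 powr - real j \<and> \<bar>H u - H v\<bar> \<le> 2 powr - real i}"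
        using P by (subst sum.inter_filter) (auto intro!: sum.cong simp: near_def)
      also have "2 powr (real j * (s' - 1)) * 2 ^ i * sum \<mu> {v\<in>P. \<bar>u - v\<bar> \<le> 2 powr - real j \<and> \<bar>H u - H v\<bar> \<le> 2 powr - real i}
          \<le> 2 powr (real j * (s' - 1)) * 2 ^ i * (9 * 2 ^ (cell_exponent h j - i) * cell_weight h s j)"
        using i j P \<mu> mass by (intro mult_left_mono dyadic_neighbourhood_mass) auto
      also have "\<dots> = 9 * (2 powr (real j * (s' - 1)) * 2 powr real (cell_exponent h j) * cell_weight h s j)"
        using i by (simp add: power_diff powr_realpow)
      also have "\<dots> \<le> 9 * (2 powr (real j * (s' - 1)) * 2 powr (h * real j) * cell_weight h s j)"
        using cell_exponent_bounds(1)[of h j] h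
        by (intro mult_left_mono mult_right_mono powr_mono) (auto simp: cell_weight_def)
      also have "cell_weight h s j = 2 powr s * 2 powr - (s * h * real j)"
        by (simp add: cell_weight_def powr_powr powr_add[symmetric] algebra_simps)
      finally show "(\<Sum>v\<in>P. \<mu> v * (2 powr (real j * (s' - 1)) * 2 ^ i * near i j u v))
          \<le> \<Lambda> * (2 powr (real j * (s' - 1)) * 2 powr (h * real j) * 2 powr - (s * h * real j))"
        by (simp add: \<Lambda>_def mult_ac)
    qed
    also have "\<dots> = (\<Sum>j\<le>n. \<Lambda> * (real (Suc (cell_exponent h j)) * x ^ j))"
    proof (intro sum.cong refl)
      fix j
      have "2 powr (real j * (s' - 1)) * 2 powr (h * real j) * 2 powr - (s * h * real j) = x powr real j"
        by (simp add: x_def powr_powr powr_add[symmetric] algebra_simps)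
      also have "\<dots> = x ^ j" using x by (simp add: powr_realpow)
      finally show "(\<Sum>i\<le>cell_exponent h j. \<Lambda> * (2 powr (real j * (s' - 1)) * 2 powr (h * real j) * 2 powr - (s * h * real j)))
          = \<Lambda> * (real (Suc (cell_exponent h j)) * x ^ j)" by simp
    qed
    also have "\<dots> \<le> (\<Sum>j\<le>n. \<Lambda> * (real (Suc j) * x ^ j))"
    proof (intro sum_mono mult_left_mono mult_right_mono)
      fix j
      have "real (cell_exponent h j) \<le> h * real j" using cell_exponent_bounds h by simp
      also have "\<dots> \<le> 1 * real j" using h by (intro mult_right_mono) auto
      finally show "real (Suc (cell_exponent h j)) \<le> real (Suc j)" by simp
    qed (use x in \<open>auto simp: \<Lambda>_def\<close>)
    also have "\<dots> = \<Lambda> * (\<Sum>j\<le>n. real (Suc j) * x ^ j)" by (simp add: sum_distrib_left)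
    also have "(\<Sum>j\<le>n. real (Suc j) * x ^ j) \<le> 1 / (1 - x)\<^sup>2"
    proof -
      have S: "(\<lambda>j. of_nat (Suc j) * x ^ j) sums (1 / (1 - x)\<^sup>2)" using x by (intro geometric_deriv_sums) auto
      have "(\<Sum>j\<le>n. real (Suc j) * x ^ j) \<le> (\<Sum>j. real (Suc j) * x ^ j)"
        using x S by (intro sum_le_suminf) (auto simp: sums_iff)
      then show ?thesis using S by (simp add: sums_iff)
    qed
    finally show ?thesis using B by (simp add: mult_left_mono \<Lambda>_def)
  qed
  have "(\<Sum>u\<in>P. \<Sum>v\<in>P. \<mu> u * \<mu> v * K u v) = (\<Sum>u\<in>P. \<mu> u * (\<Sum>v\<in>P. \<mu> v * K u v))"
    by (simp add: sum_distrib_left mult.assoc)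
  also have "\<dots> \<le> (\<Sum>u\<in>P. \<mu> u * (B * (\<Lambda> / (1 - x)\<^sup>2)))"
    using \<mu> by (intro sum_mono mult_left_mono row) auto
  also have "\<dots> = sum \<mu> P * (B * (\<Lambda> / (1 - x)\<^sup>2))" by (rule sum_distrib_right[symmetric])
  also have "\<dots> \<le> \<Lambda> * (B * (\<Lambda> / (1 - x)\<^sup>2))" using tot B by (intro mult_right_mono) (auto simp: \<Lambda>_def)
  also have "\<dots> = energy_bound h s s' A" by (simp add: energy_bound_def B_def \<Lambda>_def x_def mult_ac)
  finally show ?thesis .
qed

text \<open>
  Mass distribution principle for a sequence of discrete measures, so that no weak limit has to
  be taken: by compactness a cover may be assumed finite, and then every measure of the sequence
  whose truncation level is fine enough sees it.
\<close>
lemma hausdorff_dim_graph_ge_energy: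
  fixes X :: "real \<Rightarrow> real"
  assumes X: "continuous_on {p..q} X" and s: "0 < s" and c: "0 < c"
    and \<epsilon>: "\<And>n. 0 < \<epsilon> n" "\<epsilon> \<longlonglongrightarrow> 0"
    and P: "\<And>n. finite (P n)" "\<And>n. P n \<subseteq> {p..q}" and \<mu>: "\<And>n u. 0 \<le> \<mu> n u" "\<And>n. c \<le> sum (\<mu> n) (P n)"
    and E: "\<exists>\<^sub>F n in sequentially.
      (\<Sum>u\<in>P n. \<Sum>v\<in>P n. \<mu> n u * \<mu> n v * max (max \<bar>u - v\<bar> (\<epsilon> n)) \<bar>X u - X v\<bar> powr - s) \<le> K"
  shows "ereal s \<le> hausdorff_dim dist (graph_on X {p..q})"
proof (rule hausdorff_dim_ge, rule notI)
  let ?A = "graph_on X {p..q}"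
  assume zero: "hausdorff_outer dist s ?A = 0"
  \<comment> \<open>The final estimate reads \<open>c\<^sup>2 \<le> (\<bar>K\<bar> + 1) * (2 *
    \<eta>) = c\<^sup>2 / 2\<close>, the contradiction sought.\<close>
  define \<eta> where "\<eta> = c\<^sup>2 / (4 * (\<bar>K\<bar> + 1))"
  have \<eta>: "0 < \<eta>" using c by (simp add: \<eta>_def)
  have "hausdorff_pre dist s ?A 1 < ennreal \<eta>"
    using hausdorff_pre_le_outer[of 1 dist s ?A] zero \<eta> by simp
  then obtain C where C: "C \<in> delta_covers dist 1 ?A"
    and CS: "(\<Sum>i. ennreal (enn2real (ediam dist (C i)) powr s)) < ennreal \<eta>"
    unfolding hausdorff_pre_def INF_less_iff by blast
  define d where "d i = enn2real (ediam dist (C i))" for i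
  \<comment> \<open>Enlarged diameters, positive even where \<open>d i = 0\<close>. The enlargement
    is made in the \<open>s\<close>-th powers, so that the total excess is controlled by
    \<open>\<eta>\<close>.\<close>
  define e where "e i = (d i powr s + \<eta> * (1/2)^Suc i) powr (1 / s)" for i
  have es: "e i powr s = d i powr s + \<eta> * (1/2)^Suc i" for i
    using s \<eta> by (simp add: e_def powr_powr add_nonneg_nonneg)
  have d0: "0 \<le> d i" for i by (simp add: d_def)
  have de: "d i < e i" for i
  proof -
    have "d i = (d i powr s) powr (1 / s)" using s d0 by (simp add: powr_powr)
    also have "\<dots> < e i" unfolding e_def using s \<eta> by (intro powr_less_mono2) auto
    finally show ?thesis .
  qed
  have e0: "0 < e i" for i using de[of i] d0[of i] by linarith
  \<comment> \<open>Compactness asks for open sets; the radius is half the excess, so distances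
    within \<open>U i\<close> stay at most \<open>e i\<close>.\<close>
  define U where "U i = (\<Union>z\<in>C i. ball z ((e i - d i) / 2))" for i
  have Uo: "open (U i)" for i unfolding U_def by (intro open_UN ballI open_ball)
  have Ud: "dist y y' \<le> e i" if yU: "y \<in> U i" "y' \<in> U i" for i y y'
  proof -
    obtain z z' where z: "z \<in> C i" "z' \<in> C i" "dist z y < (e i - d i) / 2" "dist z' y' < (e i - d i) / 2"
      using yU unfolding U_def by (elim UN_E) (auto simp only: mem_ball)
    have "dist z z' \<le> d i"
      unfolding d_def using C z by (intro dist_le_enn2real_ediam[of dist _ 1]) (auto simp: delta_covers_def)
    moreover have "dist y y' \<le> dist z y + dist z z' + dist z' y'"
      by (metis dist_commute dist_triangle add.commute add_mono_thms_linordered_semiring(3) order_trans dist_triangle2 dist_triangle3)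
    moreover have "(e i - d i) / 2 + (e i - d i) / 2 = e i - d i" by (rule field_sum_of_halves)
    ultimately show ?thesis using z(3,4) by linarith
  qed
  have "compact ?A"
    unfolding graph_on_def using X by (intro compact_continuous_image continuous_intros) auto
  moreover have "?A \<subseteq> (\<Union>i\<in>UNIV. U i)"
  proof
    fix y assume "y \<in> ?A"
    then obtain i where "y \<in> C i" using C by (auto simp: delta_covers_def)
    then show "y \<in> (\<Union>i\<in>UNIV. U i)" using de[of i] by (auto simp: U_def intro!: exI[of _ i] bexI[of _ y])
  qed
  ultimately obtain I where I: "finite I" "?A \<subseteq> (\<Union>i\<in>I. U i)"
    using compactE_image[of ?A UNIV U] Uo by metis
  have sumE: "(\<Sum>i\<in>I. e i powr s) \<le> 2 * \<eta>"
  proof -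
    have "ennreal (\<Sum>i\<in>I. d i powr s) = (\<Sum>i\<in>I. ennreal (d i powr s))" by (simp add: sum_ennreal)
    also have "\<dots> \<le> (\<Sum>i. ennreal (d i powr s))" using I by (intro sum_le_suminf) auto
    also have "\<dots> < ennreal \<eta>" using CS by (simp add: d_def)
    finally have 1: "(\<Sum>i\<in>I. d i powr s) < \<eta>" by (simp add: ennreal_less_iff sum_nonneg)
    have "(\<Sum>i\<in>I. \<eta> * (1/2)^Suc i) \<le> (\<Sum>i. \<eta> * (1/2)^Suc i)"
      using \<eta> I power_half_series by (intro sum_le_suminf summable_mult) (auto simp: sums_iff)
    also have "\<dots> = \<eta>" using sums_mult[OF power_half_series, of \<eta>] unfolding sums_iff by simp
    finally have 2: "(\<Sum>i\<in>I. \<eta> * (1/2)^Suc i) \<le> \<eta>" .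
    show ?thesis unfolding es sum.distrib using 1 2 by linarith
  qed
  have "\<forall>\<^sub>F n in sequentially. \<forall>i\<in>I. \<epsilon> n < e i"
    using I(1) by (rule eventually_ball_finite)
      (use \<epsilon>(2) de d0 in \<open>auto intro!: order_tendstoD(2) intro: le_less_trans\<close>)
  with E have "\<exists>\<^sub>F n in sequentially. (\<Sum>u\<in>P n. \<Sum>v\<in>P n. \<mu> n u * \<mu> n v * max (max \<bar>u - v\<bar> (\<epsilon> n)) \<bar>X u - X v\<bar> powr - s) \<le> K
      \<and> (\<forall>i\<in>I. \<epsilon> n < e i)" by (rule frequently_eventually_frequently)
  \<comment> \<open>One level suffices at which the energy is bounded and the truncation lies below
    the finitely many \<open>e i\<close>: then the truncation does not spoil the lower bound of the
    kernel on pairs in a common \<open>U i\<close>.\<close>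
  from frequently_ex[OF this] obtain n where n: "\<forall>i\<in>I. \<epsilon> n < e i" and
     En: "(\<Sum>u\<in>P n. \<Sum>v\<in>P n. \<mu> n u * \<mu> n v * max (max \<bar>u - v\<bar> (\<epsilon> n)) \<bar>X u - X v\<bar> powr - s) \<le> K"
    by (elim exE conjE)
  define \<kappa> where "\<kappa> u v = max (max \<bar>u - v\<bar> (\<epsilon> n)) \<bar>X u - X v\<bar> powr - s" for u v
  let ?\<mu> = "\<mu> n" and ?P = "P n"
  have "\<exists>i\<in>I. (u, X u) \<in> U i" if "u \<in> ?P" for u
    using I(2) P(2)[of n] that by (auto simp: graph_on_def)
  \<comment> \<open>Each point is assigned to one of the sets containing it, so that no mass is
    counted twice.\<close>
  then obtain \<iota> where \<iota>: "\<And>u. u \<in> ?P \<Longrightarrow> \<iota> u \<in> I \<and> (u, X u) \<in> U (\<iota> u)" by metis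
  define m where "m i = sum ?\<mu> {u\<in>?P. \<iota> u = i}" for i
  have "c \<le> (\<Sum>i\<in>I. m i)"
  proof -
    have "\<iota> ` ?P \<subseteq> I" using \<iota> by blast
    from sum.group[OF P(1)[of n] I(1) this, of ?\<mu>] show ?thesis using \<mu>(2)[of n] by (simp add: m_def)
  qed
  then have "c\<^sup>2 \<le> (\<Sum>i\<in>I. m i)\<^sup>2" using c by (intro power_mono) auto
  \<comment> \<open>Splitting off \<open>e i powr (s / 2)\<close> prepares Cauchy-Schwarz: one
    factor becomes the cover sum, the other is dominated by the energy, whose kernel is at least
    \<open>e i powr - s\<close> on pairs within one class.\<close>
  also have "\<dots> = (\<Sum>i\<in>I. (m i * e i powr (- s / 2)) * e i powr (s / 2))\<^sup>2"
    using e0 by (simp add: mult.assoc powr_add[symmetric] less_imp_neq[symmetric])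
  also have "\<dots> \<le> (\<Sum>i\<in>I. (m i * e i powr (- s / 2))\<^sup>2) * (\<Sum>i\<in>I. (e i powr (s / 2))\<^sup>2)"
    by (rule Cauchy_Schwarz_ineq_sum)
  also have "(\<Sum>i\<in>I. (e i powr (s / 2))\<^sup>2) = (\<Sum>i\<in>I. e i powr s)"
    by (simp add: power2_eq_square powr_add[symmetric])
  also have "(\<Sum>i\<in>I. (m i * e i powr (- s / 2))\<^sup>2) = (\<Sum>i\<in>I. \<Sum>u\<in>{u\<in>?P. \<iota> u = i}. \<Sum>v\<in>{u\<in>?P. \<iota> u = i}. ?\<mu> u * ?\<mu> v * e i powr - s)"
  proof (intro sum.cong refl)
    fix i
    have "(m i * e i powr (- s / 2))\<^sup>2 = m i * m i * e i powr - s"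
      by (simp add: power2_eq_square powr_add[symmetric] mult_ac)
    then show "(m i * e i powr (- s / 2))\<^sup>2 = (\<Sum>u\<in>{u\<in>?P. \<iota> u = i}. \<Sum>v\<in>{u\<in>?P. \<iota> u = i}. ?\<mu> u * ?\<mu> v * e i powr - s)"
      unfolding m_def sum_product by (simp only: sum_distrib_right)
  qed
  also have "\<dots> \<le> (\<Sum>i\<in>I. \<Sum>u\<in>{u\<in>?P. \<iota> u = i}. \<Sum>v\<in>?P. ?\<mu> u * ?\<mu> v * \<kappa> u v)"
  proof (intro sum_mono)
    fix i u assume i: "i \<in> I" and u: "u \<in> {u\<in>?P. \<iota> u = i}"
    have "(\<Sum>v\<in>{u\<in>?P. \<iota> u = i}. ?\<mu> u * ?\<mu> v * e i powr - s) \<le> (\<Sum>v\<in>{u\<in>?P. \<iota> u = i}. ?\<mu> u * ?\<mu> v * \<kappa> u v)"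
    proof (intro sum_mono mult_left_mono mult_nonneg_nonneg \<mu>(1))
      fix v assume v: "v \<in> {u\<in>?P. \<iota> u = i}"
      have D: "dist (u, X u) (v, X v) \<le> e i" using \<iota>[of u] \<iota>[of v] u v by (intro Ud) auto
      have "\<bar>u - v\<bar> \<le> e i" "\<bar>X u - X v\<bar> \<le> e i"
        using order_trans[OF dist_fst_le D] order_trans[OF dist_snd_le D] by (simp_all add: dist_real_def)
      then have "max (max \<bar>u - v\<bar> (\<epsilon> n)) \<bar>X u - X v\<bar> \<le> e i" using n i by (simp add: less_imp_le)
      then show "e i powr - s \<le> \<kappa> u v"
        unfolding \<kappa>_def using s \<epsilon>(1)[of n] by (intro powr_mono2') (auto simp: less_max_iff_disj)
    qed
    also have "\<dots> \<le> (\<Sum>v\<in>?P. ?\<mu> u * ?\<mu> v * \<kappa> u v)"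
      using P(1) \<mu>(1) by (intro sum_mono2) (auto simp: \<kappa>_def)
    finally show "(\<Sum>v\<in>{u\<in>?P. \<iota> u = i}. ?\<mu> u * ?\<mu> v * e i powr - s) \<le> (\<Sum>v\<in>?P. ?\<mu> u * ?\<mu> v * \<kappa> u v)" .
  qed
  also have "(\<Sum>i\<in>I. \<Sum>u\<in>{u\<in>?P. \<iota> u = i}. \<Sum>v\<in>?P. ?\<mu> u * ?\<mu> v * \<kappa> u v) = (\<Sum>u\<in>?P. \<Sum>v\<in>?P. ?\<mu> u * ?\<mu> v * \<kappa> u v)"
    using \<iota> by (intro sum.group P(1) I(1)) auto
  finally have fin: "c\<^sup>2 \<le> (\<Sum>u\<in>?P. \<Sum>v\<in>?P. ?\<mu> u * ?\<mu> v * \<kappa> u v) * (\<Sum>i\<in>I. e i powr s)"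
    by (simp add: mult_right_mono sum_nonneg)
  have "(\<Sum>u\<in>?P. \<Sum>v\<in>?P. ?\<mu> u * ?\<mu> v * \<kappa> u v) \<le> \<bar>K\<bar> + 1" using En unfolding \<kappa>_def by linarith
  then have "(\<Sum>u\<in>?P. \<Sum>v\<in>?P. ?\<mu> u * ?\<mu> v * \<kappa> u v) * (\<Sum>i\<in>I. e i powr s) \<le> (\<bar>K\<bar> + 1) * (2 * \<eta>)"
    using sumE by (intro mult_mono) (auto intro!: sum_nonneg)
  also have "\<dots> = c\<^sup>2 / 2" by (simp add: \<eta>_def field_simps)
  finally have "c\<^sup>2 \<le> c\<^sup>2 / 2" using fin by linarith
  then show False using c by simp
qed

section \<open>Wiener integrals are Gaussian\<close>

text \<open>Encoded as a scaled standard normal law rather than by a density, so that the degenerate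
  case \<open>v = 0\<close> is included.\<close>

definition centred_gaussian :: "'a measure \<Rightarrow> ('a \<Rightarrow> real) \<Rightarrow> real \<Rightarrow> bool" where
  "centred_gaussian M Y v \<longleftrightarrow> Y \<in> borel_measurable M \<and>
     distr M borel Y = distr std_normal_distribution borel (\<lambda>x. sqrt v * x)"

lemma char_scaled_std_normal:
  "char (distr std_normal_distribution borel (\<lambda>x. c * x)) t = exp (- of_real (t\<^sup>2 * c\<^sup>2 / 2))"
proof -
  have "char (distr std_normal_distribution borel (\<lambda>x. c * x)) t = char std_normal_distribution (t * c)"
    unfolding char_def by (subst integral_distr) (auto simp: mult.assoc)
  then show ?thesis
    by (simp add: char_std_normal_distribution exp_of_real[symmetric] power_mult_distrib)
qed

lemma centred_gaussianI_char:
  assumes "prob_space M" "Y \<in> borel_measurable M" "0 \<le> v"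
    and "\<And>t. char (distr M borel Y) t = exp (- of_real (t\<^sup>2 * v / 2))"
  shows "centred_gaussian M Y v"
  unfolding centred_gaussian_def
proof
  interpret M: prob_space M by fact
  interpret N: prob_space std_normal_distribution by (rule prob_space_normal_density) simp
  show "distr M borel Y = distr std_normal_distribution borel (\<lambda>x. sqrt v * x)"
  proof (rule Levy_uniqueness)
    show "real_distribution (distr M borel Y)"
      using assms(2) by (intro real_distribution.intro M.prob_space_distr) (auto simp: real_distribution_axioms_def)
    show "real_distribution (distr std_normal_distribution borel (\<lambda>x. sqrt v * x))"
      by (intro real_distribution.intro N.prob_space_distr) (auto simp: real_distribution_axioms_def)
    show "char (distr M borel Y) = char (distr std_normal_distribution borel (\<lambda>x. sqrt v * x))"
      using assms by (auto simp: char_scaled_std_normal fun_eq_iff)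
  qed
qed fact

lemma cmod_iexp_diff_le: "cmod (iexp a - iexp b) \<le> \<bar>a - b\<bar>"
proof -
  have "iexp a - iexp b = iexp b * (iexp (a - b) - 1)"
    by (simp add: algebra_simps flip: exp_add)
  moreover have "cmod (iexp (a - b) - 1) \<le> \<bar>a - b\<bar>"
    using iexp_approx1[of "a - b" 0] by simp
  ultimately show ?thesis by (simp add: norm_mult)
qed

text \<open>The Lipschitz estimate for \<open>iexp\<close> is turned into an integral of squares by
  \<open>z \<le> \<delta> + z\<^sup>2 / \<delta>\<close>, with \<open>\<delta>\<close>
  arbitrary.\<close>

lemma char_distr_tendsto_L2:
  assumes "prob_space M" and Y[measurable]: "Y \<in> borel_measurable M" and S[measurable]: "\<And>n. S n \<in> borel_measurable M"
    and lim: "(\<lambda>n. \<integral>\<^sup>+\<omega>. ennreal ((Y \<omega> - S n \<omega>)\<^sup>2) \<partial>M) \<longlonglongrightarrow> 0"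
  shows "(\<lambda>n. char (distr M borel (S n)) t) \<longlonglongrightarrow> char (distr M borel Y) t"
proof -
  interpret prob_space M by fact
  define e where "e n = (\<integral>\<^sup>+\<omega>. ennreal ((Y \<omega> - S n \<omega>)\<^sup>2) \<partial>M)" for n
  have ch: "char (distr M borel Z) t = (CLINT \<omega>|M. iexp (t * Z \<omega>))" if "Z \<in> borel_measurable M" for Z
    using that unfolding char_def by (subst integral_distr) auto
  have int: "integrable M (\<lambda>\<omega>. iexp (t * Z \<omega>))" if [measurable]: "Z \<in> borel_measurable M" for Z
    by (intro integrable_const_bound[where B = 1]) auto
  have bnd: "ennreal (cmod (char (distr M borel (S n)) t - char (distr M borel Y) t))
      \<le> ennreal \<delta> + ennreal (t\<^sup>2 / \<delta>) * e n" if d: "0 < \<delta>" for \<delta> n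
  proof -
    have "char (distr M borel (S n)) t - char (distr M borel Y) t
        = (CLINT \<omega>|M. iexp (t * S n \<omega>) - iexp (t * Y \<omega>))"
      using int by (simp add: ch)
    then have "ennreal (cmod (char (distr M borel (S n)) t - char (distr M borel Y) t))
        \<le> (\<integral>\<^sup>+\<omega>. ennreal (cmod (iexp (t * S n \<omega>) - iexp (t * Y \<omega>))) \<partial>M)"
      using int by (simp only:) (intro integral_norm_bound_ennreal Bochner_Integration.integrable_diff, auto)
    also have "\<dots> \<le> (\<integral>\<^sup>+\<omega>. ennreal \<delta> + ennreal (t\<^sup>2 / \<delta>) * ennreal ((Y \<omega> - S n \<omega>)\<^sup>2) \<partial>M)"
    proof (intro nn_integral_mono)
      fix \<omega>
      define z where "z = \<bar>t * (Y \<omega> - S n \<omega>)\<bar>"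
      have "cmod (iexp (t * S n \<omega>) - iexp (t * Y \<omega>)) \<le> z"
        using cmod_iexp_diff_le[of "t * S n \<omega>" "t * Y \<omega>"] by (simp add: z_def abs_minus_commute algebra_simps)
      also have "z \<le> \<delta> + z\<^sup>2 / \<delta>"
      proof -
        have "0 \<le> (z - \<delta>)\<^sup>2 + z * \<delta>" using d by (auto simp: z_def)
        then have "z * \<delta> \<le> \<delta>\<^sup>2 + z\<^sup>2" by (simp add: power2_diff algebra_simps)
        then show ?thesis using d by (simp add: field_simps power2_eq_square)
      qed
      also have "z\<^sup>2 / \<delta> = t\<^sup>2 / \<delta> * (Y \<omega> - S n \<omega>)\<^sup>2" by (simp add: z_def power_mult_distrib)
      finally have "ennreal (cmod (iexp (t * S n \<omega>) - iexp (t * Y \<omega>)))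
          \<le> ennreal (\<delta> + t\<^sup>2 / \<delta> * (Y \<omega> - S n \<omega>)\<^sup>2)" by (rule ennreal_leI)
      also have "\<dots> = ennreal \<delta> + ennreal (t\<^sup>2 / \<delta>) * ennreal ((Y \<omega> - S n \<omega>)\<^sup>2)"
        using d by (simp only: ennreal_plus ennreal_mult zero_le_power2 divide_nonneg_pos mult_nonneg_nonneg less_imp_le)
      finally show "ennreal (cmod (iexp (t * S n \<omega>) - iexp (t * Y \<omega>)))
          \<le> ennreal \<delta> + ennreal (t\<^sup>2 / \<delta>) * ennreal ((Y \<omega> - S n \<omega>)\<^sup>2)" .
    qed
    also have "\<dots> = ennreal \<delta> + ennreal (t\<^sup>2 / \<delta>) * e n"
      by (subst nn_integral_add) (auto simp: nn_integral_cmult e_def emeasure_space_1)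
    finally show ?thesis .
  qed
  show ?thesis
  proof (rule LIMSEQ_I)
    fix r :: real assume r: "0 < r"
    define \<delta> where "\<delta> = r / 2"
    have d: "0 < \<delta>" using r by (simp add: \<delta>_def)
    have "(\<lambda>n. ennreal \<delta> + ennreal (t\<^sup>2 / \<delta>) * e n) \<longlonglongrightarrow> ennreal \<delta> + ennreal (t\<^sup>2 / \<delta>) * 0"
      using lim unfolding e_def by (intro tendsto_add tendsto_const ennreal_tendsto_cmult) auto
    then have "\<forall>\<^sub>F n in sequentially. ennreal \<delta> + ennreal (t\<^sup>2 / \<delta>) * e n < ennreal r"
      by (rule order_tendstoD(2)) (use r in \<open>auto simp: \<delta>_def ennreal_less_iff\<close>)
    then obtain N where N: "\<And>n. N \<le> n \<Longrightarrow> ennreal \<delta> + ennreal (t\<^sup>2 / \<delta>) * e n < ennreal r"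
      unfolding eventually_sequentially by blast
    have "cmod (char (distr M borel (S n)) t - char (distr M borel Y) t) < r" if "N \<le> n" for n
      using le_less_trans[OF bnd[OF d] N[OF that]] by (simp add: ennreal_less_iff)
    then show "\<exists>N. \<forall>n\<ge>N. cmod (char (distr M borel (S n)) t - char (distr M borel Y) t) < r" by blast
  qed
qed

text \<open>A weighted substitute for the triangle inequality of the square-integrable norm, stated
  for extended integrals. Pointwise it rearranges
  \<open>0 \<le> (\<delta> * a + b)\<^sup>2 / \<delta>\<close> with \<open>a = f x\<close> and
  \<open>b = f x - g x\<close>.\<close>

lemma nn_integral_square_le:
  fixes f g :: "'b \<Rightarrow> real"
  assumes [measurable]: "f \<in> borel_measurable N" "g \<in> borel_measurable N" and d: "0 < \<delta>"
  shows "(\<integral>\<^sup>+x. ennreal ((g x)\<^sup>2) \<partial>N) \<le> ennreal (1 + \<delta>) * (\<integral>\<^sup>+x. ennreal ((f x)\<^sup>2) \<partial>N)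
           + ennreal (1 + 1 / \<delta>) * (\<integral>\<^sup>+x. ennreal ((f x - g x)\<^sup>2) \<partial>N)"
proof -
  have "(\<integral>\<^sup>+x. ennreal ((g x)\<^sup>2) \<partial>N) \<le>
      (\<integral>\<^sup>+x. ennreal (1 + \<delta>) * ennreal ((f x)\<^sup>2) + ennreal (1 + 1 / \<delta>) * ennreal ((f x - g x)\<^sup>2) \<partial>N)"
  proof (intro nn_integral_mono)
    fix x
    define a b where "a = f x" and "b = f x - g x"
    have "0 \<le> (\<delta> * a + b)\<^sup>2 / \<delta>" using d by simp
    also have "(\<delta> * a + b)\<^sup>2 / \<delta> = (1 + \<delta>) * a\<^sup>2 + (1 + 1 / \<delta>) * b\<^sup>2 - (a - b)\<^sup>2"
      using d by (simp add: field_simps power2_eq_square)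
    finally have "(g x)\<^sup>2 \<le> (1 + \<delta>) * (f x)\<^sup>2 + (1 + 1 / \<delta>) * (f x - g x)\<^sup>2"
      by (simp add: a_def b_def)
    then have "ennreal ((g x)\<^sup>2) \<le> ennreal ((1 + \<delta>) * (f x)\<^sup>2 + (1 + 1 / \<delta>) * (f x - g x)\<^sup>2)"
      by (rule ennreal_leI)
    also have "\<dots> = ennreal (1 + \<delta>) * ennreal ((f x)\<^sup>2) + ennreal (1 + 1 / \<delta>) * ennreal ((f x - g x)\<^sup>2)"
      using d by (subst ennreal_plus) (auto simp: ennreal_mult)
    finally show "ennreal ((g x)\<^sup>2) \<le> ennreal (1 + \<delta>) * ennreal ((f x)\<^sup>2) + ennreal (1 + 1 / \<delta>) * ennreal ((f x - g x)\<^sup>2)" .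
  qed
  also have "\<dots> = ennreal (1 + \<delta>) * (\<integral>\<^sup>+x. ennreal ((f x)\<^sup>2) \<partial>N)
           + ennreal (1 + 1 / \<delta>) * (\<integral>\<^sup>+x. ennreal ((f x - g x)\<^sup>2) \<partial>N)"
    by (subst nn_integral_add) (auto simp: nn_integral_cmult)
  finally show ?thesis .
qed

text \<open>The weighted inequality is applied in both directions, with \<open>s n\<close> and
  \<open>f\<close> exchanged. Weight \<open>1\<close> gives finiteness and a bound on the norms,
  small weights give convergence.\<close>

lemma L2_norm_tendsto:
  fixes f :: "'b \<Rightarrow> real"
  assumes [measurable]: "f \<in> borel_measurable N" "\<And>n. s n \<in> borel_measurable N"
    and fin: "\<And>n. (\<integral>\<^sup>+x. ennreal ((s n x)\<^sup>2) \<partial>N) < \<infinity>"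
    and lim: "(\<lambda>n. \<integral>\<^sup>+x. ennreal ((f x - s n x)\<^sup>2) \<partial>N) \<longlonglongrightarrow> 0"
  shows "(\<integral>\<^sup>+x. ennreal ((f x)\<^sup>2) \<partial>N) < \<infinity>"
    and "(\<lambda>n. enn2real (\<integral>\<^sup>+x. ennreal ((s n x)\<^sup>2) \<partial>N)) \<longlonglongrightarrow> enn2real (\<integral>\<^sup>+x. ennreal ((f x)\<^sup>2) \<partial>N)"
proof -
  let ?e = "\<lambda>n. \<integral>\<^sup>+x. ennreal ((f x - s n x)\<^sup>2) \<partial>N"
  let ?v = "\<lambda>n. \<integral>\<^sup>+x. ennreal ((s n x)\<^sup>2) \<partial>N"
  let ?V = "\<integral>\<^sup>+x. ennreal ((f x)\<^sup>2) \<partial>N"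
  have up: "?v n \<le> ennreal (1 + \<delta>) * ?V + ennreal (1 + 1 / \<delta>) * ?e n" if "0 < \<delta>" for \<delta> n
    using nn_integral_square_le[of f N "s n" \<delta>] that by simp
  have lo: "?V \<le> ennreal (1 + \<delta>) * ?v n + ennreal (1 + 1 / \<delta>) * ?e n" if "0 < \<delta>" for \<delta> n
    using nn_integral_square_le[of "s n" N f \<delta>] that by (simp add: power2_commute)
  have e1: "\<forall>\<^sub>F n in sequentially. ?e n < 1" using lim by (rule order_tendstoD(2)) simp
  then obtain n where "?e n < 1" using eventually_happens by fastforce
  then have "ennreal (1 + 1) * ?v n + ennreal (1 + 1 / 1) * ?e n < \<infinity>"
    using fin[of n] by (auto simp: ennreal_mult_less_top intro: less_trans)
  then show V: "?V < \<infinity>" using lo[of 1 n] by (auto elim: le_less_trans)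
  define V where "V = enn2real ?V"
  have V': "?V = ennreal V" "0 \<le> V" using V by (auto simp: V_def)
  have v': "?v n = ennreal (enn2real (?v n))" for n using fin[of n] by simp
  have elim: "(\<lambda>n. enn2real (?e n)) \<longlonglongrightarrow> 0" using lim by (intro tendsto_enn2real) auto
  have bnd: "\<forall>\<^sub>F n in sequentially. \<bar>enn2real (?v n) - V\<bar> \<le> \<delta> * (2 * V + 2) + (1 + 1 / \<delta>) * enn2real (?e n)"
    if d: "0 < \<delta>" for \<delta>
    using e1
  proof eventually_elim
    case (elim n)
    define E where "E = enn2real (?e n)"
    define v where "v = enn2real (?v n)"
    have E: "?e n = ennreal E" "0 \<le> E" "E < 1"
      using elim unfolding E_def by (cases "?e n"; auto simp: ennreal_less_one_iff)+
    have v: "?v n = ennreal v" "0 \<le> v" using v'[of n] by (auto simp: v_def)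
    have 1: "v \<le> (1 + r) * V + (1 + 1 / r) * E" if "0 < r" for r
      using up[OF that, of n] unfolding E(1) v(1) V'(1) using that E(2) V'(2)
      by (simp flip: ennreal_mult ennreal_plus add: ennreal_le_iff)
    have 2: "V \<le> (1 + r) * v + (1 + 1 / r) * E" if "0 < r" for r
      using lo[OF that, of n] unfolding E(1) v(1) V'(1) using that E(2) v(2)
      by (simp flip: ennreal_mult ennreal_plus add: ennreal_le_iff)
    have "v \<le> 2 * V + 2" using 1[of 1] E by simp
    then have "\<delta> * v \<le> \<delta> * (2 * V + 2)" "\<delta> * V \<le> \<delta> * (2 * V + 2)"
      using d V'(2) by (auto intro!: mult_left_mono)
    then show ?case unfolding v_def[symmetric] E_def[symmetric] using 1[OF d] 2[OF d]
      by (simp add: abs_le_iff algebra_simps)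
  qed
  show "(\<lambda>n. enn2real (?v n)) \<longlonglongrightarrow> enn2real ?V"
    unfolding V_def[symmetric]
  proof (rule tendstoI)
    fix r :: real assume r: "0 < r"
    \<comment> \<open>Makes the part of the bound that does not depend on \<open>n\<close> equal to
      \<open>r / 2\<close>.\<close>
    define \<delta> where "\<delta> = r / (2 * (2 * V + 2))"
    have d: "0 < \<delta>" using r V' by (simp add: \<delta>_def)
    have "(\<lambda>n. \<delta> * (2 * V + 2) + (1 + 1 / \<delta>) * enn2real (?e n)) \<longlonglongrightarrow> \<delta> * (2 * V + 2) + (1 + 1 / \<delta>) * 0"
      by (intro tendsto_add tendsto_mult tendsto_const elim)
    moreover have "\<delta> * (2 * V + 2) + (1 + 1 / \<delta>) * 0 = r / 2"
      using V' unfolding \<delta>_def by (auto simp: divide_simps add_nonneg_eq_0_iff)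
    ultimately have "(\<lambda>n. \<delta> * (2 * V + 2) + (1 + 1 / \<delta>) * enn2real (?e n)) \<longlonglongrightarrow> r / 2" by (simp only:)
    then have "\<forall>\<^sub>F n in sequentially. \<delta> * (2 * V + 2) + (1 + 1 / \<delta>) * enn2real (?e n) < r"
      by (rule order_tendstoD(2)) (use r in simp)
    with bnd[OF d] show "\<forall>\<^sub>F n in sequentially. dist (enn2real (?v n)) V < r"
      by eventually_elim (simp add: dist_real_def)
  qed
qed

lemma simple_bochner_integrableD:
  assumes "Bochner_Integration.simple_bochner_integrable lborel (s :: real \<Rightarrow> real)"
  shows "finite (range s)" "s \<in> borel_measurable borel" "{u. s u = y} \<in> sets borel"
    "y \<noteq> 0 \<Longrightarrow> emeasure lborel {u. s u = y} < \<infinity>"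
proof -
  have s: "simple_function lborel s" "emeasure lborel {u \<in> space lborel. s u \<noteq> 0} \<noteq> \<infinity>"
    using assms by (auto elim: Bochner_Integration.simple_bochner_integrable.cases)
  show "finite (range s)" using simple_functionD(1)[OF s(1)] by simp
  show m: "s \<in> borel_measurable borel" using borel_measurable_simple_function[OF s(1)] by simp
  have "s -` {y} \<inter> space borel \<in> sets borel" using m by (rule measurable_sets) simp
  then show m': "{u. s u = y} \<in> sets borel" by (simp add: vimage_def)
  assume "y \<noteq> 0"
  moreover have "{u. s u \<noteq> 0} \<in> sets borel" using m by measurable
  ultimately have "emeasure lborel {u. s u = y} \<le> emeasure lborel {u. s u \<noteq> 0}"
    by (intro emeasure_mono) auto
  also have "\<dots> < \<infinity>" using s(2) by (simp add: less_top)
  finally show "emeasure lborel {u. s u = y} < \<infinity>" .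
qed

lemma nn_integral_square_combination_tendsto_0:
  fixes p q :: "nat \<Rightarrow> 'b \<Rightarrow> real"
  assumes [measurable]: "\<And>n. p n \<in> borel_measurable N" "\<And>n. q n \<in> borel_measurable N"
    and "(\<lambda>n. \<integral>\<^sup>+x. ennreal ((p n x)\<^sup>2) \<partial>N) \<longlonglongrightarrow> 0" "(\<lambda>n. \<integral>\<^sup>+x. ennreal ((q n x)\<^sup>2) \<partial>N) \<longlonglongrightarrow> 0"
  shows "(\<lambda>n. \<integral>\<^sup>+x. ennreal ((a * p n x + b * q n x)\<^sup>2) \<partial>N) \<longlonglongrightarrow> 0"
proof (rule tendsto_sandwich[OF _ _ tendsto_const])
  show "\<forall>\<^sub>F n in sequentially. (\<integral>\<^sup>+x. ennreal ((a * p n x + b * q n x)\<^sup>2) \<partial>N) \<le>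
      ennreal (2 * a\<^sup>2) * (\<integral>\<^sup>+x. ennreal ((p n x)\<^sup>2) \<partial>N) + ennreal (2 * b\<^sup>2) * (\<integral>\<^sup>+x. ennreal ((q n x)\<^sup>2) \<partial>N)"
  proof (intro always_eventually allI)
    fix n
    have "(\<integral>\<^sup>+x. ennreal ((a * p n x + b * q n x)\<^sup>2) \<partial>N) \<le>
      (\<integral>\<^sup>+x. ennreal (2 * a\<^sup>2) * ennreal ((p n x)\<^sup>2) + ennreal (2 * b\<^sup>2) * ennreal ((q n x)\<^sup>2) \<partial>N)"
    proof (intro nn_integral_mono)
      fix x
      have "0 \<le> (a * p n x - b * q n x)\<^sup>2" by simp
      then have "(a * p n x + b * q n x)\<^sup>2 \<le> 2 * a\<^sup>2 * (p n x)\<^sup>2 + 2 * b\<^sup>2 * (q n x)\<^sup>2"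
        by (simp add: power2_sum power2_diff power_mult_distrib)
      then have "ennreal ((a * p n x + b * q n x)\<^sup>2) \<le> ennreal (2 * a\<^sup>2 * (p n x)\<^sup>2 + 2 * b\<^sup>2 * (q n x)\<^sup>2)"
        by (rule ennreal_leI)
      then show "ennreal ((a * p n x + b * q n x)\<^sup>2)
          \<le> ennreal (2 * a\<^sup>2) * ennreal ((p n x)\<^sup>2) + ennreal (2 * b\<^sup>2) * ennreal ((q n x)\<^sup>2)"
        by (simp add: ennreal_plus ennreal_mult)
    qed
    also have "\<dots> = ennreal (2 * a\<^sup>2) * (\<integral>\<^sup>+x. ennreal ((p n x)\<^sup>2) \<partial>N) + ennreal (2 * b\<^sup>2) * (\<integral>\<^sup>+x. ennreal ((q n x)\<^sup>2) \<partial>N)"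
      by (subst nn_integral_add) (auto simp: nn_integral_cmult)
    finally show "(\<integral>\<^sup>+x. ennreal ((a * p n x + b * q n x)\<^sup>2) \<partial>N) \<le> \<dots>" .
  qed
  have "(\<lambda>n. ennreal (2 * a\<^sup>2) * (\<integral>\<^sup>+x. ennreal ((p n x)\<^sup>2) \<partial>N) + ennreal (2 * b\<^sup>2) * (\<integral>\<^sup>+x. ennreal ((q n x)\<^sup>2) \<partial>N))
      \<longlonglongrightarrow> ennreal (2 * a\<^sup>2) * 0 + ennreal (2 * b\<^sup>2) * 0"
    using assms(3,4) by (intro tendsto_add ennreal_tendsto_cmult) auto
  then show "(\<lambda>n. ennreal (2 * a\<^sup>2) * (\<integral>\<^sup>+x. ennreal ((p n x)\<^sup>2) \<partial>N) + ennreal (2 * b\<^sup>2) * (\<integral>\<^sup>+x. ennreal ((q n x)\<^sup>2) \<partial>N))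
      \<longlonglongrightarrow> 0" by simp
qed auto

section \<open>Simple Wiener integrals: additivity, linearity and law\<close>

locale white_noise_space = prob_space M for M :: "'a measure" +
  fixes W :: "real set \<Rightarrow> 'a \<Rightarrow> real"
  assumes white_noise: "white_noise M W"
begin

lemma W_measurable [measurable]:
  assumes "A \<in> sets borel" "emeasure lborel A < \<infinity>" shows "W A \<in> borel_measurable M"
proof (cases "emeasure lborel A = 0")
  case False
  then have "distributed M lborel (W A) (\<lambda>x. ennreal (normal_density 0 (sqrt (measure lborel A)) x))"
    using white_noise assms unfolding white_noise_def by (auto simp: zero_less_iff_neq_zero)
  then show ?thesis by (auto simp: distributed_def)
qed (use white_noise assms in \<open>auto simp: white_noise_def\<close>)

lemma W_null:
  assumes "A \<in> sets borel" "emeasure lborel A = 0" shows "AE \<omega> in M. W A \<omega> = 0"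
  using white_noise assms by (auto simp: white_noise_def)

lemma char_W:
  assumes A: "A \<in> sets borel" "emeasure lborel A < \<infinity>"
  shows "char (distr M borel (\<lambda>\<omega>. y * W A \<omega>)) t = exp (- of_real (t\<^sup>2 * (y\<^sup>2 * measure lborel A) / 2))"
proof -
  note [measurable] = W_measurable[OF A]
  have ch: "char (distr M borel (\<lambda>\<omega>. y * W A \<omega>)) t = (CLINT \<omega>|M. iexp (t * y * W A \<omega>))"
    unfolding char_def by (subst integral_distr) (auto simp: mult.assoc)
  show ?thesis
  proof (cases "emeasure lborel A = 0")
    case True
    then have "(CLINT \<omega>|M. iexp (t * y * W A \<omega>)) = (CLINT \<omega>|M. 1)"
      using W_null[OF A(1) True] by (intro integral_cong_AE) auto
    moreover have "measure lborel A = 0" using True by (simp add: measure_def)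
    ultimately show ?thesis using ch by (simp add: prob_space)
  next
    case False
    define \<sigma> where "\<sigma> = sqrt (measure lborel A)"
    have "measure lborel A \<noteq> 0"
      using False A by (metis emeasure_eq_ennreal_measure ennreal_0 infinity_ennreal_def less_irrefl)
    then have \<sigma>: "0 < \<sigma>" "\<sigma>\<^sup>2 = measure lborel A" by (auto simp: \<sigma>_def less_le)
    have "distributed M lborel (W A) (\<lambda>x. ennreal (normal_density 0 \<sigma> x))"
      using white_noise A False unfolding white_noise_def \<sigma>_def by (auto simp: zero_less_iff_neq_zero)
    then have "distributed M lborel (\<lambda>\<omega>. (W A \<omega> - 0) / \<sigma>) (\<lambda>x. ennreal (std_normal_density x))"
      using \<sigma>(1) by (subst (asm) normal_standard_normal_convert) auto
    then have D: "distr M lborel (\<lambda>\<omega>. W A \<omega> / \<sigma>) = std_normal_distribution"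
      by (simp add: distributed_def)
    have "(CLINT \<omega>|M. iexp (t * y * W A \<omega>)) = (CLINT \<omega>|M. iexp (t * y * \<sigma> * (W A \<omega> / \<sigma>)))"
      using \<sigma>(1) by (simp add: mult.assoc)
    also have "\<dots> = char (distr M lborel (\<lambda>\<omega>. W A \<omega> / \<sigma>)) (t * y * \<sigma>)"
      unfolding char_def by (subst integral_distr) auto
    also have "\<dots> = exp (- of_real ((t * y * \<sigma>)\<^sup>2 / 2))"
      unfolding D by (simp add: char_std_normal_distribution exp_of_real[symmetric])
    finally have "char (distr M borel (\<lambda>\<omega>. y * W A \<omega>)) t = exp (- of_real ((t * y * \<sigma>)\<^sup>2 / 2))"
      using ch by (rule trans[rotated])
    moreover have "(t * y * \<sigma>)\<^sup>2 = t\<^sup>2 * (y\<^sup>2 * measure lborel A)"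
      using \<sigma> by (simp add: power_mult_distrib)
    ultimately show ?thesis by (simp only:)
  qed
qed

text \<open>Countable additivity, applied to the family continued by empty sets. Even
  \<open>W {}\<close> vanishes only almost surely, and the null set depends on the family.\<close>

lemma W_finite_additive:
  assumes "finite K" "disjoint_family_on F K" and F: "\<And>k. k \<in> K \<Longrightarrow> F k \<in> sets borel \<and> emeasure lborel (F k) < \<infinity>"
  shows "AE \<omega> in M. W (\<Union>k\<in>K. F k) \<omega> = (\<Sum>k\<in>K. W (F k) \<omega>)"
proof -
  obtain g where g: "bij_betw g {..<card K} K"
    using assms(1) by (metis atLeast0LessThan ex_bij_betw_nat_finite)
  define A where "A i = (if i < card K then F (g i) else {})" for i
  have gK: "g i \<in> K" if "i < card K" for i using bij_betwE[OF g] that by auto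
  have U: "(\<Union>i. A i) = (\<Union>k\<in>K. F k)"
  proof -
    have "(\<Union>i. A i) = (\<Union>i\<in>{..<card K}. F (g i))" by (auto simp: A_def split: if_splits)
    also have "\<dots> = (\<Union>k\<in>g ` {..<card K}. F k)" by blast
    finally show ?thesis by (simp only: bij_betw_imp_surj_on[OF g])
  qed
  have "disjoint_family A"
    unfolding disjoint_family_on_def
  proof safe
    fix i j x assume ij: "i \<noteq> j" and x: "x \<in> A i" "x \<in> A j"
    then have "i < card K" "j < card K" by (auto simp: A_def split: if_splits)
    moreover from this have "g i \<noteq> g j" using g ij by (auto simp: bij_betw_def inj_on_def)
    ultimately show "x \<in> {}" using assms(2) x gK unfolding disjoint_family_on_def A_def by fastforce
  qed
  moreover have "\<forall>i. A i \<in> sets borel" using F gK by (auto simp: A_def)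
  moreover have "emeasure lborel (\<Union>i. A i) < \<infinity>"
  proof -
    have "emeasure lborel (\<Union>k\<in>K. F k) \<le> (\<Sum>k\<in>K. emeasure lborel (F k))"
      using F assms(1) by (intro emeasure_subadditive_finite) auto
    also have "\<dots> < \<infinity>" using F assms(1) by (simp add: less_top sum_Pinfty)
    finally show ?thesis by (simp add: U)
  qed
  ultimately have "AE \<omega> in M. (\<lambda>i. W (A i) \<omega>) sums W (\<Union>i. A i) \<omega>"
    using white_noise unfolding white_noise_def by blast
  moreover have "AE \<omega> in M. W {} \<omega> = 0" by (rule W_null) auto
  ultimately show ?thesis
  proof eventually_elim
    case (elim \<omega>)
    have "(\<lambda>i. W (A i) \<omega>) sums (\<Sum>i<card K. W (A i) \<omega>)"
      using elim(2) by (intro sums_finite) (auto simp: A_def)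
    moreover have "(\<Sum>i<card K. W (A i) \<omega>) = (\<Sum>i<card K. W (F (g i)) \<omega>)"
      by (intro sum.cong) (auto simp: A_def)
    moreover have "\<dots> = (\<Sum>k\<in>K. W (F k) \<omega>)" by (rule sum.reindex_bij_betw[OF g])
    ultimately show ?case using elim(1) sums_unique2 unfolding U by metis
  qed
qed

text \<open>Level sets of \<open>g\<close> on which \<open>\<phi>\<close> takes the same value are
  merged by additivity of \<open>W\<close>, which holds only almost surely. This is the tool for
  passing to a common refinement of two step functions.\<close>

lemma simple_wiener_integral_comp:
  assumes g: "finite (range g)" and meas: "\<And>k. {u. g u = k} \<in> sets borel"
    and fin: "\<And>k. \<phi> k \<noteq> 0 \<Longrightarrow> emeasure lborel {u. g u = k} < \<infinity>"
  shows "AE \<omega> in M. simple_wiener_integral W (\<lambda>u. \<phi> (g u)) \<omega> = (\<Sum>k\<in>range g. \<phi> k * W {u. g u = k} \<omega>)"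
proof -
  \<comment> \<open>The value \<open>0\<close> is left out because its level set may have infinite
    measure, where additivity says nothing; its term is zero anyway.\<close>
  have "AE \<omega> in M. \<forall>y\<in>range (\<lambda>u. \<phi> (g u)) - {0}.
      W {u. \<phi> (g u) = y} \<omega> = (\<Sum>k\<in>{k\<in>range g. \<phi> k = y}. W {u. g u = k} \<omega>)"
  proof (rule AE_finite_allI)
    show "finite (range (\<lambda>u. \<phi> (g u)) - {0})"
      using finite_imageI[OF g, of \<phi>] by (simp add: image_image)
    fix y assume "y \<in> range (\<lambda>u. \<phi> (g u)) - {0}"
    then have "AE \<omega> in M. W (\<Union>k\<in>{k\<in>range g. \<phi> k = y}. {u. g u = k}) \<omega>
        = (\<Sum>k\<in>{k\<in>range g. \<phi> k = y}. W {u. g u = k} \<omega>)"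
      using g meas fin by (intro W_finite_additive) (auto simp: disjoint_family_on_def)
    moreover have "(\<Union>k\<in>{k\<in>range g. \<phi> k = y}. {u. g u = k}) = {u. \<phi> (g u) = y}" by auto
    ultimately show "AE \<omega> in M. W {u. \<phi> (g u) = y} \<omega> = (\<Sum>k\<in>{k\<in>range g. \<phi> k = y}. W {u. g u = k} \<omega>)"
      by simp
  qed
  then show ?thesis
  proof eventually_elim
    case (elim \<omega>)
    have R: "range (\<lambda>u. \<phi> (g u)) = \<phi> ` range g" by auto
    have "simple_wiener_integral W (\<lambda>u. \<phi> (g u)) \<omega>
        = (\<Sum>y\<in>\<phi> ` range g. \<Sum>k\<in>{k\<in>range g. \<phi> k = y}. \<phi> k * W {u. g u = k} \<omega>)"
      unfolding simple_wiener_integral_def R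
    proof (rule sum.cong)
      fix y assume y: "y \<in> \<phi> ` range g"
      show "y * W {u. \<phi> (g u) = y} \<omega> = (\<Sum>k\<in>{k\<in>range g. \<phi> k = y}. \<phi> k * W {u. g u = k} \<omega>)"
      proof (cases "y = 0")
        case False
        then have "W {u. \<phi> (g u) = y} \<omega> = (\<Sum>k\<in>{k\<in>range g. \<phi> k = y}. W {u. g u = k} \<omega>)"
          using elim y R by blast
        then show ?thesis by (simp add: sum_distrib_left)
      qed simp
    qed simp
    also have "\<dots> = (\<Sum>k\<in>range g. \<phi> k * W {u. g u = k} \<omega>)"
      by (rule sum.image_gen[OF g, symmetric])
    finally show ?case .
  qed
qed

lemma simple_wiener_integral_measurable:
  assumes "Bochner_Integration.simple_bochner_integrable lborel s"
  shows "simple_wiener_integral W s \<in> borel_measurable M"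
proof -
  have "(\<lambda>\<omega>. y * W {u. s u = y} \<omega>) \<in> borel_measurable M" for y
  proof (cases "y = 0")
    case False
    then have "W {u. s u = y} \<in> borel_measurable M"
      using simple_bochner_integrableD(3,4)[OF assms, of y] by (intro W_measurable) auto
    then show ?thesis by (intro borel_measurable_times) auto
  qed simp
  then show ?thesis unfolding simple_wiener_integral_def[abs_def] by (intro borel_measurable_sum)
qed

text \<open>Both step functions and their combination are functions of the pair
  \<open>g u = (s u, r u)\<close>, and every joint level set except that of \<open>0\<close> has
  finite measure.\<close>

lemma simple_wiener_integral_linear:
  assumes s: "Bochner_Integration.simple_bochner_integrable lborel s" and r: "Bochner_Integration.simple_bochner_integrable lborel r"
  shows "AE \<omega> in M. simple_wiener_integral W (\<lambda>u. a * s u + b * r u) \<omega>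
      = a * simple_wiener_integral W s \<omega> + b * simple_wiener_integral W r \<omega>"
proof -
  define g where "g u = (s u, r u)" for u
  have gf: "finite (range g)"
    by (rule finite_subset[of _ "range s \<times> range r"])
       (use simple_bochner_integrableD(1)[OF s] simple_bochner_integrableD(1)[OF r] in \<open>auto simp: g_def\<close>)
  have geq: "{u. g u = k} = {u. s u = fst k} \<inter> {u. r u = snd k}" for k by (auto simp: g_def)
  have gm: "{u. g u = k} \<in> sets borel" for k
    unfolding geq using simple_bochner_integrableD(3)[OF s] simple_bochner_integrableD(3)[OF r] by auto
  have fin: "emeasure lborel {u. g u = k} < \<infinity>" if "k \<noteq> 0" for k
  proof (cases "fst k = 0")
    case False
    have "emeasure lborel {u. g u = k} \<le> emeasure lborel {u. s u = fst k}"
      using simple_bochner_integrableD(3)[OF s] by (intro emeasure_mono) (auto simp: geq)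
    then show ?thesis using simple_bochner_integrableD(4)[OF s False] by (auto elim: le_less_trans)
  next
    case True
    then have nz: "snd k \<noteq> 0" using that by (metis prod.collapse zero_prod_def)
    have "emeasure lborel {u. g u = k} \<le> emeasure lborel {u. r u = snd k}"
      using simple_bochner_integrableD(3)[OF r] by (intro emeasure_mono) (auto simp: geq)
    then show ?thesis using simple_bochner_integrableD(4)[OF r nz] by (auto elim: le_less_trans)
  qed
  have c: "AE \<omega> in M. simple_wiener_integral W (\<lambda>u. \<phi> (g u)) \<omega> = (\<Sum>k\<in>range g. \<phi> k * W {u. g u = k} \<omega>)"
    if "\<phi> 0 = 0" for \<phi>
  proof (rule simple_wiener_integral_comp[OF gf gm])
    fix k assume "\<phi> k \<noteq> 0"
    then have "k \<noteq> 0" using that by metis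
    then show "emeasure lborel {u. g u = k} < \<infinity>" by (rule fin)
  qed
  show ?thesis
    using c[of "\<lambda>k. a * fst k + b * snd k", simplified] c[of fst, simplified] c[of snd, simplified]
  proof eventually_elim
    case (elim \<omega>)
    have e: "(\<lambda>u. fst (g u)) = s" "(\<lambda>u. snd (g u)) = r" "(\<lambda>u. a * fst (g u) + b * snd (g u)) = (\<lambda>u. a * s u + b * r u)"
      by (auto simp: g_def)
    show ?case using elim unfolding e
      by (simp add: sum_distrib_left sum.distrib[symmetric] algebra_simps)
  qed
qed

text \<open>The level sets of nonzero values are disjoint, so the integral is a finite sum of
  independent Gaussian terms whose variances add up to the squared norm.\<close>

lemma char_simple_wiener_integral:
  assumes s: "Bochner_Integration.simple_bochner_integrable lborel s"
  shows "(\<integral>\<^sup>+u. ennreal ((s u)\<^sup>2) \<partial>lborel) < \<infinity>"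
    and "char (distr M borel (simple_wiener_integral W s)) t
      = exp (- of_real (t\<^sup>2 * enn2real (\<integral>\<^sup>+u. ennreal ((s u)\<^sup>2) \<partial>lborel) / 2))"
proof -
  note sD = simple_bochner_integrableD[OF s]
  define I where "I = range s - {0}"
  have fI: "finite I" using sD(1) by (simp add: I_def)
  define v where "v = (\<Sum>y\<in>I. y\<^sup>2 * measure lborel {u. s u = y})"
  have lvl: "emeasure lborel {u. s u = y} = ennreal (measure lborel {u. s u = y})" if "y \<in> I" for y
    using sD(4)[of y] that by (intro emeasure_eq_ennreal_measure) (auto simp: I_def)
  have "(\<integral>\<^sup>+u. ennreal ((s u)\<^sup>2) \<partial>lborel) = (\<integral>\<^sup>+u. (\<Sum>y\<in>I. ennreal (y\<^sup>2) * indicator {u. s u = y} u) \<partial>lborel)"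
  proof (intro nn_integral_cong)
    fix u
    have "(\<Sum>y\<in>I. ennreal (y\<^sup>2) * indicator {u. s u = y} u) = (\<Sum>y\<in>I. if y = s u then ennreal (y\<^sup>2) else 0)"
      by (intro sum.cong) (auto simp: indicator_def)
    also have "\<dots> = ennreal ((s u)\<^sup>2)" using fI by (simp add: sum.delta) (simp add: I_def)
    finally show "ennreal ((s u)\<^sup>2) = (\<Sum>y\<in>I. ennreal (y\<^sup>2) * indicator {u. s u = y} u)" ..
  qed
  also have "\<dots> = (\<Sum>y\<in>I. ennreal (y\<^sup>2) * emeasure lborel {u. s u = y})"
    using sD(3) by (subst nn_integral_sum) (auto simp: nn_integral_cmult_indicator)
  also have "\<dots> = (\<Sum>y\<in>I. ennreal (y\<^sup>2 * measure lborel {u. s u = y}))"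
    by (intro sum.cong) (auto simp: lvl ennreal_mult)
  also have "\<dots> = ennreal v" unfolding v_def by (intro sum_ennreal) auto
  finally have int: "(\<integral>\<^sup>+u. ennreal ((s u)\<^sup>2) \<partial>lborel) = ennreal v" .
  then show "(\<integral>\<^sup>+u. ennreal ((s u)\<^sup>2) \<partial>lborel) < \<infinity>" by simp
  have v0: "0 \<le> v" unfolding v_def by (intro sum_nonneg) auto
  obtain g where g: "bij_betw g {..<card I} I"
    using fI by (metis atLeast0LessThan ex_bij_betw_nat_finite)
  have gI: "g i \<in> I" if "i < card I" for i using bij_betwE[OF g] that by auto
  \<comment> \<open>Independence is postulated for sequences of sets, so the finitely many level
    sets are continued by empty ones.\<close>
  define A where "A i = (if i < card I then {u. s u = g i} else {})" for i
  have Af: "A i \<in> sets borel" "emeasure lborel (A i) < \<infinity>" for i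
    using sD(3,4) gI by (auto simp: A_def I_def)
  have "disjoint_family A"
    using g unfolding disjoint_family_on_def by (auto simp: A_def bij_betw_def inj_on_def split: if_splits)
  then have "indep_vars (\<lambda>_. borel) (\<lambda>i. W (A i)) UNIV"
    using white_noise Af unfolding white_noise_def by blast
  then have "indep_vars (\<lambda>_. borel) (\<lambda>i. W (A i)) {..<card I}" by (rule indep_vars_subset) simp
  then have ind: "indep_vars (\<lambda>_. borel) (\<lambda>i \<omega>. g i * W (A i) \<omega>) {..<card I}"
    by (rule indep_vars_compose2[where Y = "\<lambda>i x. g i * x"]) auto
  have "simple_wiener_integral W s = (\<lambda>\<omega>. \<Sum>i<card I. g i * W (A i) \<omega>)"
  proof
    fix \<omega>
    have "simple_wiener_integral W s \<omega> = (\<Sum>y\<in>I. y * W {u. s u = y} \<omega>)"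
      unfolding simple_wiener_integral_def I_def using sD(1) by (intro sum.mono_neutral_right) auto
    also have "\<dots> = (\<Sum>i<card I. g i * W {u. s u = g i} \<omega>)"
      by (rule sum.reindex_bij_betw[OF g, symmetric])
    also have "\<dots> = (\<Sum>i<card I. g i * W (A i) \<omega>)" by (intro sum.cong) (auto simp: A_def)
    finally show "simple_wiener_integral W s \<omega> = (\<Sum>i<card I. g i * W (A i) \<omega>)" .
  qed
  then have "char (distr M borel (simple_wiener_integral W s)) t
      = (\<Prod>i<card I. char (distr M borel (\<lambda>\<omega>. g i * W (A i) \<omega>)) t)"
    using char_distr_sum[OF ind] by simp
  also have "\<dots> = (\<Prod>i<card I. exp (- of_real (t\<^sup>2 * ((g i)\<^sup>2 * measure lborel {u. s u = g i}) / 2)))"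
  proof (intro prod.cong refl)
    fix i assume "i \<in> {..<card I}"
    then have "A i = {u. s u = g i}" by (simp add: A_def)
    then show "char (distr M borel (\<lambda>\<omega>. g i * W (A i) \<omega>)) t
        = exp (- of_real (t\<^sup>2 * ((g i)\<^sup>2 * measure lborel {u. s u = g i}) / 2))"
      using char_W[OF Af[of i], of "g i" t] by (simp only:)
  qed
  also have "\<dots> = (\<Prod>y\<in>I. exp (- of_real (t\<^sup>2 * (y\<^sup>2 * measure lborel {u. s u = y}) / 2)))"
    by (rule prod.reindex_bij_betw[OF g])
  also have "\<dots> = exp (\<Sum>y\<in>I. - of_real (t\<^sup>2 * (y\<^sup>2 * measure lborel {u. s u = y}) / 2))"
    using fI by (rule exp_sum[symmetric])
  also have "(\<Sum>y\<in>I. - of_real (t\<^sup>2 * (y\<^sup>2 * measure lborel {u. s u = y}) / 2)) = - complex_of_real (t\<^sup>2 * v / 2)"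
    by (simp add: v_def sum_distrib_left sum_divide_distrib sum_negf)
  finally show "char (distr M borel (simple_wiener_integral W s)) t
      = exp (- of_real (t\<^sup>2 * enn2real (\<integral>\<^sup>+u. ennreal ((s u)\<^sup>2) \<partial>lborel) / 2))"
    using int v0 by simp
qed

lemma has_wiener_integral_cong_AE:
  assumes "has_wiener_integral M W f Y" "AE \<omega> in M. Y' \<omega> = Y \<omega>" "Y' \<in> borel_measurable M"
  shows "has_wiener_integral M W f Y'"
proof -
  have "(\<integral>\<^sup>+\<omega>. ennreal ((Y' \<omega> - Z \<omega>)\<^sup>2) \<partial>M) = (\<integral>\<^sup>+\<omega>. ennreal ((Y \<omega> - Z \<omega>)\<^sup>2) \<partial>M)" for Z
    using assms(2) by (intro nn_integral_cong_AE) auto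
  then show ?thesis using assms(1,3) unfolding has_wiener_integral_def by simp
qed

lemma has_wiener_integral_linear:
  assumes Y: "has_wiener_integral M W f Y" and Z: "has_wiener_integral M W g Z"
  shows "has_wiener_integral M W (\<lambda>u. a * f u + b * g u) (\<lambda>\<omega>. a * Y \<omega> + b * Z \<omega>)"
proof -
  obtain s where s: "\<And>n. Bochner_Integration.simple_bochner_integrable lborel (s n)"
      "(\<lambda>n. \<integral>\<^sup>+u. ennreal ((f u - s n u)\<^sup>2) \<partial>lborel) \<longlonglongrightarrow> 0"
      "(\<lambda>n. \<integral>\<^sup>+\<omega>. ennreal ((Y \<omega> - simple_wiener_integral W (s n) \<omega>)\<^sup>2) \<partial>M) \<longlonglongrightarrow> 0"
    using Y unfolding has_wiener_integral_def by blast
  obtain r where r: "\<And>n. Bochner_Integration.simple_bochner_integrable lborel (r n)"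
      "(\<lambda>n. \<integral>\<^sup>+u. ennreal ((g u - r n u)\<^sup>2) \<partial>lborel) \<longlonglongrightarrow> 0"
      "(\<lambda>n. \<integral>\<^sup>+\<omega>. ennreal ((Z \<omega> - simple_wiener_integral W (r n) \<omega>)\<^sup>2) \<partial>M) \<longlonglongrightarrow> 0"
    using Z unfolding has_wiener_integral_def by blast
  have [measurable]: "f \<in> borel_measurable lborel" "g \<in> borel_measurable lborel"
      "Y \<in> borel_measurable M" "Z \<in> borel_measurable M"
    using Y Z by (auto simp: has_wiener_integral_def)
  have [measurable]: "s n \<in> borel_measurable lborel" "r n \<in> borel_measurable lborel" for n
    using simple_bochner_integrableD(2)[OF s(1)] simple_bochner_integrableD(2)[OF r(1)] by auto
  have [measurable]: "simple_wiener_integral W (s n) \<in> borel_measurable M"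
      "simple_wiener_integral W (r n) \<in> borel_measurable M" for n
    using s(1) r(1) by (auto intro: simple_wiener_integral_measurable)
  let ?s = "\<lambda>n u. a * s n u + b * r n u"
  have "Bochner_Integration.simple_bochner_integrable lborel (?s n)" for n
    by (rule simple_bochner_integrable_compose2[where p = "\<lambda>x y. a * x + b * y", OF _ s(1) r(1)]) simp
  moreover have "(\<lambda>n. \<integral>\<^sup>+u. ennreal ((a * f u + b * g u - ?s n u)\<^sup>2) \<partial>lborel) \<longlonglongrightarrow> 0"
  proof -
    have "(\<lambda>n. \<integral>\<^sup>+u. ennreal ((a * (f u - s n u) + b * (g u - r n u))\<^sup>2) \<partial>lborel) \<longlonglongrightarrow> 0"
      using s(2) r(2) by (intro nn_integral_square_combination_tendsto_0) auto
    then show ?thesis by (simp add: algebra_simps)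
  qed
  moreover have "(\<lambda>n. \<integral>\<^sup>+\<omega>. ennreal ((a * Y \<omega> + b * Z \<omega> - simple_wiener_integral W (?s n) \<omega>)\<^sup>2) \<partial>M) \<longlonglongrightarrow> 0"
  proof -
    have "(\<lambda>n. \<integral>\<^sup>+\<omega>. ennreal ((a * (Y \<omega> - simple_wiener_integral W (s n) \<omega>)
        + b * (Z \<omega> - simple_wiener_integral W (r n) \<omega>))\<^sup>2) \<partial>M) \<longlonglongrightarrow> 0"
      using s(3) r(3) by (intro nn_integral_square_combination_tendsto_0) auto
    moreover have "(\<integral>\<^sup>+\<omega>. ennreal ((a * Y \<omega> + b * Z \<omega> - simple_wiener_integral W (?s n) \<omega>)\<^sup>2) \<partial>M)
        = (\<integral>\<^sup>+\<omega>. ennreal ((a * (Y \<omega> - simple_wiener_integral W (s n) \<omega>)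
        + b * (Z \<omega> - simple_wiener_integral W (r n) \<omega>))\<^sup>2) \<partial>M)" for n
      using simple_wiener_integral_linear[OF s(1)[of n] r(1)[of n], of a b]
      by (intro nn_integral_cong_AE) (auto simp: algebra_simps)
    ultimately show ?thesis by simp
  qed
  ultimately show ?thesis unfolding has_wiener_integral_def by (intro conjI exI[of _ ?s]) auto
qed

text \<open>Along the approximating step functions the characteristic functions have two limits:
  that of \<open>Y\<close>, by mean-square convergence, and the Gaussian one, because the norms
  converge.\<close>

lemma has_wiener_integral_gaussian:
  assumes Y: "has_wiener_integral M W f Y"
  shows "(\<integral>\<^sup>+u. ennreal ((f u)\<^sup>2) \<partial>lborel) < \<infinity>"
    and "centred_gaussian M Y (enn2real (\<integral>\<^sup>+u. ennreal ((f u)\<^sup>2) \<partial>lborel))"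
proof -
  obtain s where s: "\<And>n. Bochner_Integration.simple_bochner_integrable lborel (s n)"
      "(\<lambda>n. \<integral>\<^sup>+u. ennreal ((f u - s n u)\<^sup>2) \<partial>lborel) \<longlonglongrightarrow> 0"
      "(\<lambda>n. \<integral>\<^sup>+\<omega>. ennreal ((Y \<omega> - simple_wiener_integral W (s n) \<omega>)\<^sup>2) \<partial>M) \<longlonglongrightarrow> 0"
    using Y unfolding has_wiener_integral_def by blast
  have m: "f \<in> borel_measurable lborel" "Y \<in> borel_measurable M"
    using Y by (auto simp: has_wiener_integral_def)
  have sm: "s n \<in> borel_measurable lborel" for n
    using simple_bochner_integrableD(2)[OF s(1)] by auto
  note lim = L2_norm_tendsto[OF m(1) sm char_simple_wiener_integral(1)[OF s(1)] s(2)]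
  show "(\<integral>\<^sup>+u. ennreal ((f u)\<^sup>2) \<partial>lborel) < \<infinity>" by (rule lim(1))
  show "centred_gaussian M Y (enn2real (\<integral>\<^sup>+u. ennreal ((f u)\<^sup>2) \<partial>lborel))"
  proof (rule centred_gaussianI_char)
    fix t
    have "(\<lambda>n. char (distr M borel (simple_wiener_integral W (s n))) t) \<longlonglongrightarrow> char (distr M borel Y) t"
      using s(1,3) m(2) by (intro char_distr_tendsto_L2 simple_wiener_integral_measurable) (auto intro: prob_space_axioms)
    moreover have "(\<lambda>n. char (distr M borel (simple_wiener_integral W (s n))) t)
        \<longlonglongrightarrow> exp (- of_real (t\<^sup>2 * enn2real (\<integral>\<^sup>+u. ennreal ((f u)\<^sup>2) \<partial>lborel) / 2))"
      unfolding char_simple_wiener_integral(2)[OF s(1)]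
      by (intro tendsto_intros lim(2)) auto
    ultimately show "char (distr M borel Y) t = exp (- of_real (t\<^sup>2 * enn2real (\<integral>\<^sup>+u. ennreal ((f u)\<^sup>2) \<partial>lborel) / 2))"
      by (rule LIMSEQ_unique)
  qed (use m prob_space_axioms in auto)
qed

end

section \<open>Lower bound for the variance of increments\<close>

definition normalized_powr :: "real \<Rightarrow> real \<Rightarrow> real" where
  "normalized_powr H x = rGamma (H + 1/2) * x powr (H - 1/2)"

definition normalized_powr_deriv :: "real \<Rightarrow> real \<Rightarrow> real" where
  "normalized_powr_deriv H x = rGamma (H + 1/2) * x powr (H - 1/2) * (ln x - Digamma (H + 1/2))"

text \<open>The moving average kernel of Mandelbrot and Van Ness with both one-sided parts;
  \<open>field_kernel\<close> is then the integrand whose Wiener integral is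
  \<open>B t H\<close>.\<close>

definition ma_kernel :: "real \<Rightarrow> real \<Rightarrow> real \<Rightarrow> real \<Rightarrow> real" where
  "ma_kernel ap am H x = rGamma (H + 1/2) * (ap * pos_powr x (H - 1/2) + am * neg_powr x (H - 1/2))"

definition field_kernel :: "real \<Rightarrow> real \<Rightarrow> real \<Rightarrow> real \<Rightarrow> real \<Rightarrow> real" where
  "field_kernel ap am t H u = ma_kernel ap am H (t - u) - ma_kernel ap am H (- u)"

lemma ma_kernel_pos: "0 < x \<Longrightarrow> ma_kernel ap am H x = ap * normalized_powr H x"
  by (simp add: ma_kernel_def normalized_powr_def pos_powr_def neg_powr_def)

lemma ma_kernel_neg: "x < 0 \<Longrightarrow> ma_kernel ap am H x = am * normalized_powr H (- x)"
  by (simp add: ma_kernel_def normalized_powr_def pos_powr_def neg_powr_def)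

lemma ma_kernel_measurable [measurable]: "ma_kernel ap am H \<in> borel_measurable borel"
  unfolding ma_kernel_def[abs_def] pos_powr_def neg_powr_def by measurable

lemma field_kernel_measurable [measurable]: "field_kernel ap am t H \<in> borel_measurable borel"
  unfolding field_kernel_def[abs_def] by measurable

lemma not_nonpos_Int_of_pos: "0 < (x::real) \<Longrightarrow> x \<notin> \<int>\<^sub>\<le>\<^sub>0"
  by (auto elim!: nonpos_Ints_cases)

lemma rGamma_real_pos: "0 < (x::real) \<Longrightarrow> 0 < rGamma x"
  using Gamma_real_pos[of x] by (simp add: rGamma_inverse_Gamma)

lemma normalized_powr_pos: "0 < H \<Longrightarrow> 0 < x \<Longrightarrow> 0 < normalized_powr H x"
  by (simp add: normalized_powr_def rGamma_real_pos)

lemma normalized_powr_mult: "0 < c \<Longrightarrow> 0 < x \<Longrightarrow> normalized_powr H (c * x) = c powr (H - 1/2) * normalized_powr H x"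
  by (simp add: normalized_powr_def powr_mult)

lemma DERIV_normalized_powr_H:
  assumes "0 < H" "0 < x"
  shows "((\<lambda>H. normalized_powr H x) has_real_derivative normalized_powr_deriv H x) (at H)"
  unfolding normalized_powr_def normalized_powr_deriv_def
  using assms not_nonpos_Int_of_pos[of "H + 1/2"]
  by (auto intro!: derivative_eq_intros simp: algebra_simps)

lemma DERIV_normalized_powr_x:
  assumes "0 < x"
  shows "(normalized_powr H has_real_derivative rGamma (H + 1/2) * ((H - 1/2) * x powr (H - 1/2 - 1))) (at x)"
  unfolding normalized_powr_def[abs_def]
  using has_real_derivative_powr[OF assms, of "H - 1/2"] by (rule DERIV_cmult)

lemma isCont_Digamma_shift: "0 < H \<Longrightarrow> isCont (\<lambda>z. Digamma (fst z + 1/2)) (H::real, x::real)"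
  using not_nonpos_Int_of_pos[of "H + 1/2"]
  by (intro isCont_o2[OF _ DERIV_isCont[OF has_field_derivative_Polygamma]]) (auto intro!: continuous_intros)

lemma isCont_rGamma_shift: "isCont (\<lambda>z. rGamma (fst z + 1/2)) (H::real, x::real)"
  by (intro isCont_o2[OF _ DERIV_isCont[OF has_field_derivative_rGamma]]) (auto intro!: continuous_intros)

lemma isCont_normalized_powr:
  "0 < x \<Longrightarrow> isCont (\<lambda>z. normalized_powr (fst z) (snd z)) (H, x)"
  unfolding normalized_powr_def by (intro continuous_intros isCont_rGamma_shift) auto

lemma isCont_normalized_powr_deriv:
  "0 < H \<Longrightarrow> 0 < x \<Longrightarrow> isCont (\<lambda>z. normalized_powr_deriv (fst z) (snd z)) (H, x)"
  unfolding normalized_powr_deriv_def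
  by (intro continuous_intros isCont_rGamma_shift isCont_Digamma_shift) auto

lemma isCont_pairD:
  fixes f :: "real \<Rightarrow> real \<Rightarrow> real"
  assumes "isCont (\<lambda>z. f (fst z) (snd z)) (a, b)" "0 < e"
  shows "\<exists>d>0. \<forall>x y. \<bar>x - a\<bar> < d \<longrightarrow> \<bar>y - b\<bar> < d \<longrightarrow> \<bar>f x y - f a b\<bar> < e"
proof -
  obtain d where d: "d > 0" "\<And>z. dist z (a, b) < d \<Longrightarrow> dist (f (fst z) (snd z)) (f a b) < e"
    using assms unfolding continuous_at_eps_delta by force
  have "\<bar>f x y - f a b\<bar> < e" if "\<bar>x - a\<bar> < d / 2" "\<bar>y - b\<bar> < d / 2" for x y
  proof -
    have "dist (x, y) (a, b) \<le> \<bar>x - a\<bar> + \<bar>y - b\<bar>"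
      by (auto simp: dist_Pair_Pair dist_real_def intro!: sqrt_sum_squares_le_sum order_trans[OF sqrt_sum_squares_le_sum_abs])
    then show ?thesis using d(2)[of "(x, y)"] that by (simp add: dist_real_def)
  qed
  then show ?thesis using d(1) by (intro exI[of _ "d / 2"]) auto
qed

lemma pos_lower_bound:
  fixes S :: "real set"
  assumes "finite S" "\<And>x. x \<in> S \<Longrightarrow> 0 < x"
  shows "\<exists>d>0. \<forall>x\<in>S. d \<le> x"
proof (cases "S = {}")
  case False
  then show ?thesis using assms by (intro exI[of _ "Min S"]) auto
qed (auto intro: exI[of _ 1])

lemma MVT_ball:
  fixes f f' :: "real \<Rightarrow> real"
  assumes "\<And>x. \<bar>x - c\<bar> < d \<Longrightarrow> (f has_real_derivative f' x) (at x)" "\<bar>a - c\<bar> < d" "\<bar>b - c\<bar> < d"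
  shows "\<exists>z. \<bar>z - c\<bar> < d \<and> f b - f a = (b - a) * f' z"
proof (cases a b rule: linorder_cases)
  case less
  then obtain z where "a < z" "z < b" "f b - f a = (b - a) * f' z"
    using MVT2[of a b f f'] assms by (auto simp: abs_less_iff)
  then show ?thesis using assms by (intro exI[of _ z]) (auto simp: abs_less_iff)
next
  case greater
  then obtain z where z: "b < z" "z < a" "f a - f b = (a - b) * f' z"
    using MVT2[of b a f f'] assms by (auto simp: abs_less_iff)
  then have "f b - f a = (b - a) * f' z" by (simp add: algebra_simps)
  then show ?thesis using z assms by (intro exI[of _ z]) (auto simp: abs_less_iff)
qed (use assms in auto)

text \<open>By the mean value theorem it suffices that the derivative in \<open>x\<close>, a
  positive multiple of \<open>a * (ln x - \<psi>) + 1\<close> with \<open>a = H - 1/2\<close>, has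
  no zero far out. There the logarithm is large, and for \<open>a = 0\<close> the expression is
  \<open>1\<close>.\<close>

lemma normalized_powr_deriv_neq:
  assumes H: "0 < H"
  shows "\<exists>X>0. \<forall>x\<ge>X. \<forall>T>0. normalized_powr_deriv H (x + T) \<noteq> normalized_powr_deriv H x"
proof -
  define a where "a = H - 1/2"
  define \<psi> where "\<psi> = Digamma (H + 1/2)"
  \<comment> \<open>Beyond \<open>X\<close> the difference \<open>ln y - \<psi>\<close> exceeds
    \<open>1 / \<bar>a\<bar>\<close>, so \<open>a * (ln y - \<psi>)\<close> cannot equal
    \<open>-1\<close>. For \<open>a = 0\<close> the quotient is \<open>0\<close> by
    convention.\<close>
  define X where "X = exp (\<bar>\<psi>\<bar> + 1 / \<bar>a\<bar> + 1)"
  have nz: "a * (ln y - \<psi>) + 1 \<noteq> 0" if y: "X \<le> y" for y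
  proof -
    have "ln X \<le> ln y" using y by (subst ln_le_cancel_iff) (auto simp: X_def intro: less_le_trans[OF exp_gt_zero])
    then have l: "\<bar>\<psi>\<bar> + 1 / \<bar>a\<bar> + 1 \<le> ln y" by (simp add: X_def)
    consider "a = 0" | "0 < a" | "a < 0" by linarith
    then show ?thesis
    proof cases
      case 2
      have "0 \<le> ln y - \<psi>" using l 2 by (smt (verit) divide_nonneg_pos)
      then show ?thesis using 2 by (smt (verit) mult_nonneg_nonneg)
    next
      case 3
      have "1 / \<bar>a\<bar> < ln y - \<psi>" using l by linarith
      then have "\<bar>a\<bar> * (1 / \<bar>a\<bar>) < \<bar>a\<bar> * (ln y - \<psi>)" using 3 by (intro mult_strict_left_mono) auto
      then show ?thesis using 3 by simp
    qed simp
  qed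
  have "normalized_powr_deriv H (x + T) \<noteq> normalized_powr_deriv H x" if x: "X \<le> x" and T: "0 < T" for x T
  proof -
    have X0: "0 < X" by (simp add: X_def)
    have "\<exists>z>x. z < x + T \<and> (x + T) powr a * (ln (x + T) - \<psi>) - x powr a * (ln x - \<psi>)
       = (x + T - x) * (z powr (a - 1) * (a * (ln z - \<psi>) + 1))"
    proof (rule MVT2)
      fix y assume "x \<le> y" "y \<le> x + T"
      then have "0 < y" using X0 x by linarith
      then show "((\<lambda>y. y powr a * (ln y - \<psi>)) has_real_derivative y powr (a - 1) * (a * (ln y - \<psi>) + 1)) (at y)"
        by (auto intro!: derivative_eq_intros simp: powr_diff field_simps)
    qed (use T in auto)
    then obtain z where z: "x < z" and e: "(x + T) powr a * (ln (x + T) - \<psi>) - x powr a * (ln x - \<psi>)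
       = T * (z powr (a - 1) * (a * (ln z - \<psi>) + 1))" by auto
    have "z powr (a - 1) \<noteq> 0" using z x X0 by simp
    then have "(x + T) powr a * (ln (x + T) - \<psi>) \<noteq> x powr a * (ln x - \<psi>)"
      using e nz[of z] z x T by auto
    moreover have "rGamma (H + 1/2) \<noteq> 0" using rGamma_real_pos[of "H + 1/2"] H by simp
    ultimately show ?thesis by (simp add: normalized_powr_deriv_def a_def \<psi>_def mult.assoc)
  qed
  then show ?thesis by (intro exI[of _ X]) (auto simp: X_def)
qed

lemma normalized_powr_lipschitz_H:
  assumes "0 < h" "0 < b"
  shows "\<exists>d>0. \<exists>C\<ge>0. \<forall>H H' x. \<bar>H - h\<bar> < d \<longrightarrow> \<bar>H' - h\<bar> < d \<longrightarrow> \<bar>x - b\<bar> < d \<longrightarrow>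
           \<bar>normalized_powr H x - normalized_powr H' x\<bar> \<le> C * \<bar>H - H'\<bar>"
proof -
  obtain d where d: "0 < d" and n: "\<And>H x. \<bar>H - h\<bar> < d \<Longrightarrow> \<bar>x - b\<bar> < d \<Longrightarrow>
      \<bar>normalized_powr_deriv H x - normalized_powr_deriv h b\<bar> < 1"
    using isCont_pairD[OF isCont_normalized_powr_deriv[OF assms], of 1] by force
  define e where "e = min (d) (min (h) (b))"
  define C where "C = \<bar>normalized_powr_deriv h b\<bar> + 1"
  have e: "0 < e" "e \<le> d" "e \<le> h" "e \<le> b" using d assms unfolding e_def by simp_all
  have main: "\<bar>normalized_powr H x - normalized_powr H' x\<bar> \<le> C * \<bar>H - H'\<bar>"
    if H: "\<bar>H - h\<bar> < e" "\<bar>H' - h\<bar> < e" "\<bar>x - b\<bar> < e" for H H' x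
  proof -
    obtain z where z: "\<bar>z - h\<bar> < e" "normalized_powr H x - normalized_powr H' x = (H - H') * normalized_powr_deriv z x"
      using MVT_ball[of h e "\<lambda>H. normalized_powr H x" "\<lambda>H. normalized_powr_deriv H x" H' H]
        DERIV_normalized_powr_H[of _ x] H e by (force simp: abs_less_iff)
    have "\<bar>normalized_powr_deriv z x\<bar> \<le> C" using n[of z x] z H e unfolding C_def by linarith
    then have "\<bar>H - H'\<bar> * \<bar>normalized_powr_deriv z x\<bar> \<le> \<bar>H - H'\<bar> * C" by (intro mult_left_mono) auto
    then show ?thesis unfolding z(2) by (simp add: abs_mult mult.commute)
  qed
  have "0 \<le> C" by (simp add: C_def)
  then show ?thesis using e(1) main by blast
qed

text \<open>The Hurst parameter and the argument \<open>y\<close> are changed one after the other.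
  Changing \<open>H\<close> alone moves the difference at a rate close to the nonzero gap of the two
  derivatives; changing \<open>y\<close> alone costs at most a Lipschitz term.\<close>

lemma normalized_powr_increment_lower:
  assumes h: "0 < h" and y0: "0 < y0" and x0: "0 < x0"
    and ne: "normalized_powr_deriv h y0 \<noteq> normalized_powr_deriv h x0"
  shows "\<exists>d>0. \<exists>c>0. \<exists>C\<ge>0. \<forall>H H' y y' x. \<bar>H - h\<bar> < d \<longrightarrow> \<bar>H' - h\<bar> < d \<longrightarrow>
     \<bar>y - y0\<bar> < d \<longrightarrow> \<bar>y' - y0\<bar> < d \<longrightarrow> \<bar>x - x0\<bar> < d \<longrightarrow> 0 < y \<and> 0 < y' \<and> 0 < x \<and>
     c * \<bar>H - H'\<bar> - C * \<bar>y - y'\<bar> \<le>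
       \<bar>(normalized_powr H y - normalized_powr H x) - (normalized_powr H' y' - normalized_powr H' x)\<bar>"
proof -
  let ?n = normalized_powr and ?D = normalized_powr_deriv
  define E where "E H x = rGamma (H + 1/2) * ((H - 1/2) * x powr (H - 1/2 - 1))" for H x :: real
  \<comment> \<open>Half the gap of the derivatives at the base point; two continuity errors below
    \<open>c / 2\<close> then still leave \<open>c\<close>.\<close>
  define c where "c = \<bar>?D h y0 - ?D h x0\<bar> / 2"
  have c: "0 < c" using ne by (simp add: c_def)
  obtain d1 where d1: "0 < d1" "\<And>H x. \<bar>H - h\<bar> < d1 \<Longrightarrow> \<bar>x - y0\<bar> < d1 \<Longrightarrow> \<bar>?D H x - ?D h y0\<bar> < c / 2"
    using isCont_pairD[OF isCont_normalized_powr_deriv[OF h y0], of "c / 2"] c by force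
  obtain d2 where d2: "0 < d2" "\<And>H x. \<bar>H - h\<bar> < d2 \<Longrightarrow> \<bar>x - x0\<bar> < d2 \<Longrightarrow> \<bar>?D H x - ?D h x0\<bar> < c / 2"
    using isCont_pairD[OF isCont_normalized_powr_deriv[OF h x0], of "c / 2"] c by force
  have "isCont (\<lambda>z. E (fst z) (snd z)) (h, y0)"
    unfolding E_def using y0 by (intro continuous_intros isCont_rGamma_shift) auto
  then obtain d3 where d3: "0 < d3" "\<And>H x. \<bar>H - h\<bar> < d3 \<Longrightarrow> \<bar>x - y0\<bar> < d3 \<Longrightarrow> \<bar>E H x - E h y0\<bar> < 1"
    using isCont_pairD[where f = E and a = h and b = y0 and e = 1] by force
  define C where "C = \<bar>E h y0\<bar> + 1"
  have "\<exists>d>0. \<forall>x\<in>{d1, d2, d3, h, y0, x0}. d \<le> x"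
    by (rule pos_lower_bound) (use d1(1) d2(1) d3(1) h y0 x0 in auto)
  then obtain d where d: "0 < d" "d \<le> d1" "d \<le> d2" "d \<le> d3" "d \<le> h" "d \<le> y0" "d \<le> x0" by auto
  have main: "0 < y \<and> 0 < y' \<and> 0 < x \<and> c * \<bar>H - H'\<bar> - C * \<bar>y - y'\<bar> \<le> \<bar>(?n H y - ?n H x) - (?n H' y' - ?n H' x)\<bar>"
    if A: "\<bar>H - h\<bar> < d" "\<bar>H' - h\<bar> < d" "\<bar>y - y0\<bar> < d" "\<bar>y' - y0\<bar> < d" "\<bar>x - x0\<bar> < d" for H H' y y' x
  proof -
    have "0 < y" using A(3) d(6) by linarith
    moreover have "0 < y'" using A(4) d(6) by linarith
    moreover have "0 < x" using A(5) d(7) by linarith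
    ultimately have pos: "0 < y" "0 < y'" "0 < x" .
    have "((\<lambda>H. ?n H y - ?n H x) has_real_derivative ?D z y - ?D z x) (at z)" if "\<bar>z - h\<bar> < d" for z
      using that pos(1,3) d(5) by (intro DERIV_diff DERIV_normalized_powr_H) linarith+
    then obtain z where z: "\<bar>z - h\<bar> < d" and
        e1: "(?n H y - ?n H x) - (?n H' y - ?n H' x) = (H - H') * (?D z y - ?D z x)"
      using MVT_ball[of h d "\<lambda>H. ?n H y - ?n H x" "\<lambda>H. ?D H y - ?D H x" H' H] A by blast
    have "\<bar>?D z y - ?D h y0\<bar> < c / 2" using z A(3) d(2) by (intro d1(2)) linarith+
    moreover have "\<bar>?D z x - ?D h x0\<bar> < c / 2" using z A(5) d(3) by (intro d2(2)) linarith+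
    moreover have "\<bar>?D h y0 - ?D h x0\<bar> = 2 * c" by (simp add: c_def)
    ultimately have "c \<le> \<bar>?D z y - ?D z x\<bar>" by linarith
    then have l1: "c * \<bar>H - H'\<bar> \<le> \<bar>(?n H y - ?n H x) - (?n H' y - ?n H' x)\<bar>"
      unfolding e1 abs_mult by (subst mult.commute) (rule mult_left_mono, auto)
    have "(?n H' has_real_derivative E H' z) (at z)" if "\<bar>z - y0\<bar> < d" for z
      unfolding E_def using that d(6) by (intro DERIV_normalized_powr_x) linarith
    then obtain w where w: "\<bar>w - y0\<bar> < d" and e2: "?n H' y - ?n H' y' = (y - y') * E H' w"
      using MVT_ball[of y0 d "?n H'" "E H'" y' y] A by blast
    have "\<bar>E H' w - E h y0\<bar> < 1" using w A(2) d(4) by (intro d3(2)) linarith+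
    then have "\<bar>E H' w\<bar> \<le> C" unfolding C_def by linarith
    then have l2: "\<bar>?n H' y - ?n H' y'\<bar> \<le> C * \<bar>y - y'\<bar>"
      unfolding e2 abs_mult by (subst (2) mult.commute) (rule mult_left_mono, auto)
    show ?thesis using l1 l2 by (intro conjI pos) linarith
  qed
  have "0 \<le> C" by (simp add: C_def)
  then show ?thesis
    by - (rule exI[of _ d], rule conjI, rule d(1), rule exI[of _ c], rule conjI, rule c,
          rule exI[of _ C], rule conjI, assumption, intro allI impI, rule main)
qed

text \<open>
  Away from the interval between \<open>0\<close> and \<open>t\<close> the kernel is smooth in \<open>(t, H)\<close>, and its derivative
  in \<open>H\<close> does not vanish far out: the logarithm coming from that derivative dominates.
\<close>
lemma field_kernel_far_lower:
  assumes h: "0 < h" and a: "(ap, am) \<noteq> (0, 0)" and t0: "t0 \<noteq> 0"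
  shows "\<exists>u0. \<exists>d>0. \<exists>c>0. \<exists>C\<ge>0. \<forall>t s H H' u. \<bar>t - t0\<bar> < d \<longrightarrow> \<bar>s - t0\<bar> < d \<longrightarrow> \<bar>H - h\<bar> < d \<longrightarrow> \<bar>H' - h\<bar> < d
    \<longrightarrow> \<bar>u - u0\<bar> < d \<longrightarrow> c * \<bar>H - H'\<bar> - C * \<bar>t - s\<bar> \<le> \<bar>field_kernel ap am t H u - field_kernel ap am s H' u\<bar>"
proof -
  obtain X where X: "0 < X" "\<And>x T. X \<le> x \<Longrightarrow> 0 < T \<Longrightarrow> normalized_powr_deriv h (x + T) \<noteq> normalized_powr_deriv h x"
    using normalized_powr_deriv_neq[OF h] by blast
  \<comment> \<open>A reflection selects a side with nonzero coefficient:
    \<open>\<sigma> = 1\<close> looks to the far left with \<open>ap\<close>,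
    \<open>\<sigma> = -1\<close> to the far right with \<open>am\<close>.\<close>
  define \<sigma> where "\<sigma> = (if ap \<noteq> 0 then 1 else -1 :: real)"
  define b where "b = (if ap \<noteq> 0 then ap else am)"
  have b: "b \<noteq> 0" using a by (auto simp: b_def)
  have \<sigma>: "\<sigma> = 1 \<or> \<sigma> = -1" by (simp add: \<sigma>_def)
  have ker: "ma_kernel ap am H x = b * normalized_powr H (\<sigma> * x)" if "0 < \<sigma> * x" for H x
    using that ma_kernel_pos[of x] ma_kernel_neg[of x] unfolding b_def \<sigma>_def by (auto split: if_splits)
  define u0 where "u0 = \<sigma> * (min 0 (\<sigma> * t0) - X)"
  define y0 where "y0 = \<sigma> * (t0 - u0)"
  define x0 where "x0 = \<sigma> * (- u0)"
  have su: "\<sigma> * u0 = min 0 (\<sigma> * t0) - X" using \<sigma> by (auto simp: u0_def)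
  have y0': "y0 = \<sigma> * t0 - min 0 (\<sigma> * t0) + X" using su by (simp add: y0_def algebra_simps)
  have x0': "x0 = X - min 0 (\<sigma> * t0)" using su by (simp add: x0_def)
  have pos: "0 < y0" "0 < x0" using X(1) unfolding y0' x0' by linarith+
  have st: "\<sigma> * t0 \<noteq> 0" using t0 \<sigma> by auto
  \<comment> \<open>\<open>x0\<close> and \<open>y0\<close> are \<open>X\<close> and
    \<open>X + \<bar>t0\<bar>\<close> in some order, and these differ because
    \<open>t0 \<noteq> 0\<close>.\<close>
  have "normalized_powr_deriv h y0 \<noteq> normalized_powr_deriv h x0"
  proof (cases "0 < \<sigma> * t0")
    case True
    then show ?thesis using X(2)[of X "\<sigma> * t0"] by (simp add: y0' x0' add.commute)
  next
    case False
    then show ?thesis using X(2)[of X "- \<sigma> * t0"] st by (simp add: y0' x0') 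
  qed
  then obtain d c C where d: "0 < d" "0 < c" "0 \<le> C" and D: "\<And>H H' y y' x. \<bar>H - h\<bar> < d \<Longrightarrow> \<bar>H' - h\<bar> < d \<Longrightarrow>
     \<bar>y - y0\<bar> < d \<Longrightarrow> \<bar>y' - y0\<bar> < d \<Longrightarrow> \<bar>x - x0\<bar> < d \<Longrightarrow> 0 < y \<and> 0 < y' \<and> 0 < x \<and>
     c * \<bar>H - H'\<bar> - C * \<bar>y - y'\<bar> \<le>
       \<bar>(normalized_powr H y - normalized_powr H x) - (normalized_powr H' y' - normalized_powr H' x)\<bar>"
    using normalized_powr_increment_lower[OF h pos] by blast
  have main: "\<bar>b\<bar> * c * \<bar>H - H'\<bar> - \<bar>b\<bar> * C * \<bar>t - s\<bar> \<le> \<bar>field_kernel ap am t H u - field_kernel ap am s H' u\<bar>"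
    if A: "\<bar>t - t0\<bar> < d / 2" "\<bar>s - t0\<bar> < d / 2" "\<bar>H - h\<bar> < d / 2" "\<bar>H' - h\<bar> < d / 2" "\<bar>u - u0\<bar> < d / 2" for t s H H' u
  proof -
    define y y' x where "y = \<sigma> * (t - u)" and "y' = \<sigma> * (s - u)" and "x = \<sigma> * (- u)"
    have near: "\<bar>y - y0\<bar> < d \<and> \<bar>y' - y0\<bar> < d \<and> \<bar>x - x0\<bar> < d \<and> \<bar>y - y'\<bar> = \<bar>t - s\<bar>"
      using \<sigma>
    proof (elim disjE)
      assume "\<sigma> = 1"
      then have "y = t - u" "y' = s - u" "x = - u" "y0 = t0 - u0" "x0 = - u0"
        by (simp_all add: y_def y'_def x_def y0_def x0_def)
      then show "\<bar>y - y0\<bar> < d \<and> \<bar>y' - y0\<bar> < d \<and> \<bar>x - x0\<bar> < d \<and> \<bar>y - y'\<bar> = \<bar>t - s\<bar>"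
        using A(1,2,5) by (intro conjI) linarith+
    next
      assume "\<sigma> = -1"
      then have "y = u - t" "y' = u - s" "x = u" "y0 = u0 - t0" "x0 = u0"
        by (simp_all add: y_def y'_def x_def y0_def x0_def)
      then show "\<bar>y - y0\<bar> < d \<and> \<bar>y' - y0\<bar> < d \<and> \<bar>x - x0\<bar> < d \<and> \<bar>y - y'\<bar> = \<bar>t - s\<bar>"
        using A(1,2,5) by (intro conjI) linarith+
    qed
    have *: "0 < y \<and> 0 < y' \<and> 0 < x \<and> c * \<bar>H - H'\<bar> - C * \<bar>y - y'\<bar> \<le>
       \<bar>(normalized_powr H y - normalized_powr H x) - (normalized_powr H' y' - normalized_powr H' x)\<bar>"
      using A(3,4) d(1) near by (intro D) auto
    then have "field_kernel ap am t H u - field_kernel ap am s H' u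
      = b * ((normalized_powr H y - normalized_powr H x) - (normalized_powr H' y' - normalized_powr H' x))"
      using ker[of "t - u"] ker[of "s - u"] ker[of "- u"]
      by (simp add: field_kernel_def y_def y'_def x_def algebra_simps)
    moreover have "\<bar>b\<bar> * (c * \<bar>H - H'\<bar> - C * \<bar>t - s\<bar>) \<le>
        \<bar>b\<bar> * \<bar>(normalized_powr H y - normalized_powr H x) - (normalized_powr H' y' - normalized_powr H' x)\<bar>"
      using * near by (intro mult_left_mono) auto
    ultimately have "\<bar>b\<bar> * (c * \<bar>H - H'\<bar> - C * \<bar>t - s\<bar>) \<le> \<bar>field_kernel ap am t H u - field_kernel ap am s H' u\<bar>"
      by (simp only: abs_mult)
    then show ?thesis by (simp only: right_diff_distrib mult.assoc)
  qed
  have "0 < d / 2" "0 < \<bar>b\<bar> * c" "0 \<le> \<bar>b\<bar> * C" using d b by auto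
  then show ?thesis
    by - (rule exI[of _ u0], rule exI[of _ "d / 2"], rule conjI, assumption, rule exI[of _ "\<bar>b\<bar> * c"],
          rule conjI, assumption, rule exI[of _ "\<bar>b\<bar> * C"], rule conjI, assumption, intro allI impI, rule main)
qed

section \<open>Kernel increments near the singularities, and the combined lower bound\<close>

lemma exp_minus_one_bound: "\<bar>x\<bar> \<le> 1/2 \<Longrightarrow> \<bar>exp x - 1\<bar> \<le> 2 * \<bar>x\<bar>" for x :: real
proof -
  assume x: "\<bar>x\<bar> \<le> 1/2"
  have 1: "1 + x \<le> exp x" by simp
  have "1 - x \<le> exp (- x)" using exp_ge_add_one_self[of "- x"] by simp
  then have "exp x * (1 - x) \<le> 1" by (simp add: exp_minus field_simps)
  then have "exp x \<le> 1 / (1 - x)" using x by (simp add: field_simps)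
  also have "\<dots> \<le> 1 + 2 * \<bar>x\<bar>"
  proof -
    have "x * (2 * \<bar>x\<bar>) \<le> 1/2 * (2 * \<bar>x\<bar>)" using x by (intro mult_right_mono) auto
    then have "1 \<le> (1 + 2 * \<bar>x\<bar>) * (1 - x)" by (simp add: algebra_simps abs_if split: if_splits)
    then show ?thesis using x by (simp add: pos_divide_le_eq)
  qed
  finally show ?thesis using 1 by linarith
qed

text \<open>
  On the time interval between \<open>s\<close> and \<open>t\<close> the two one-sided singularities enter with different
  coefficients, and rescaling turns them into a fixed nonzero profile near the midpoint.
\<close>
lemma field_kernel_near_lower:
  assumes h0: "0 < h0" and a: "ap \<noteq> am" and t0: "t0 \<noteq> 0"
  shows "\<exists>d>0. \<exists>c>0. \<exists>\<eta>>0. \<forall>t s H H' h u. \<bar>t - t0\<bar> < d \<longrightarrow> \<bar>s - t0\<bar> < d \<longrightarrow> s < t \<longrightarrow> \<bar>H - h0\<bar> < d \<longrightarrow> \<bar>H' - h0\<bar> < d \<longrightarrow>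
    H \<le> h \<longrightarrow> \<bar>H - H'\<bar> \<le> (t - s) powr h \<longrightarrow> \<bar>(t - u) / (t - s) - 1/2\<bar> < \<eta> \<longrightarrow>
    c * (t - s) powr (h - 1/2) \<le> \<bar>field_kernel ap am t H u - field_kernel ap am s H' u\<bar>"
proof -
  let ?n = normalized_powr
  define v where "v = ?n h0 (1/2)"
  have v: "0 < v" using h0 by (simp add: v_def normalized_powr_pos)
  \<comment> \<open>Half the size of the limiting profile \<open>(ap - am) * v\<close> at the
    midpoint; the perturbed profile \<open>P\<close> will stay above it.\<close>
  define k where "k = \<bar>ap - am\<bar> * v / 2"
  have k: "0 < k" using a v by (simp add: k_def)
  \<comment> \<open>Small enough that the errors in the two one-sided parts, at most
    \<open>e\<close> and \<open>5 * e\<close>, move the profile by at most \<open>k\<close>.\<close>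
  define e where "e = min v (k / (2 * (\<bar>ap\<bar> + 5 * \<bar>am\<bar> + 1)))"
  have A0: "0 < \<bar>ap\<bar> + 5 * \<bar>am\<bar> + 1" by linarith
  have e: "0 < e" "e \<le> v" "e * (\<bar>ap\<bar> + 5 * \<bar>am\<bar> + 1) \<le> k"
  proof -
    show "0 < e" "e \<le> v" using v k A0 unfolding e_def by simp_all
    have "e \<le> k / (2 * (\<bar>ap\<bar> + 5 * \<bar>am\<bar> + 1))" by (simp add: e_def)
    then have "e * (2 * (\<bar>ap\<bar> + 5 * \<bar>am\<bar> + 1)) \<le> k" using A0 by (simp add: pos_le_divide_eq)
    moreover have "e * (\<bar>ap\<bar> + 5 * \<bar>am\<bar> + 1) \<le> e * (2 * (\<bar>ap\<bar> + 5 * \<bar>am\<bar> + 1))"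
      using A0 \<open>0 < e\<close> by (intro mult_left_mono) auto
    ultimately show "e * (\<bar>ap\<bar> + 5 * \<bar>am\<bar> + 1) \<le> k" by linarith
  qed
  obtain d1 where d1: "0 < d1" "\<And>H x. \<bar>H - h0\<bar> < d1 \<Longrightarrow> \<bar>x - 1/2\<bar> < d1 \<Longrightarrow> \<bar>?n H x - v\<bar> < e"
    using isCont_pairD[OF isCont_normalized_powr[of "1/2" h0] e(1)] unfolding v_def by force
  obtain d2 C where d2: "0 < d2" "0 \<le> C" "\<And>H H' x. \<bar>H - h0\<bar> < d2 \<Longrightarrow> \<bar>H' - h0\<bar> < d2 \<Longrightarrow> \<bar>x - \<bar>t0\<bar>\<bar> < d2 \<Longrightarrow>
           \<bar>?n H x - ?n H' x\<bar> \<le> C * \<bar>H - H'\<bar>"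
    using normalized_powr_lipschitz_H[OF h0, of "\<bar>t0\<bar>"] t0 by force
  define C' where "C' = (\<bar>ap\<bar> + \<bar>am\<bar>) * C"
  have C': "0 \<le> C'" using d2 by (simp add: C'_def)
  \<comment> \<open>The two singularities scale with different exponents, which leaves a factor
    \<open>\<tau> powr (H' - H)\<close>. Since
    \<open>\<bar>H - H'\<bar> \<le> \<tau> powr h\<close>, its logarithm is at most
    \<open>\<tau> powr (h0 / 2) * \<bar>ln \<tau>\<bar>\<close> in size, so the factor is close to
    \<open>1\<close>.\<close>
  have "((\<lambda>x. x powr (h0 / 2) * \<bar>ln x\<bar>) \<longlongrightarrow> 0) (at_right 0)"
    using h0 by real_asymp
  then have "\<forall>\<^sub>F x in at_right 0. x powr (h0 / 2) * \<bar>ln x\<bar> < min (1/2) (e / (2 * v))"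
    by (rule order_tendstoD(2)) (use e v in auto)
  then obtain d3 where d3: "0 < d3" "\<And>x. 0 < x \<Longrightarrow> x < d3 \<Longrightarrow> x powr (h0 / 2) * \<bar>ln x\<bar> < min (1/2) (e / (2 * v))"
    unfolding eventually_at_right_field by auto
  \<comment> \<open>The remaining terms of the kernels are of order \<open>\<tau> powr h\<close>,
    smaller than \<open>\<tau> powr (h - 1/2)\<close> by a factor \<open>sqrt \<tau>\<close>;
    \<open>d4\<close> makes them at most \<open>k / 2\<close> times the latter.\<close>
  define d4 where "d4 = (k / (2 * (C' + 1)))\<^sup>2"
  have d4: "0 < d4" using k C' by (simp add: d4_def)
  have d4': "C' * sqrt x \<le> k / 2" if "0 \<le> x" "x \<le> d4" for x
  proof -
    have "sqrt x \<le> k / (2 * (C' + 1))" using that k C' unfolding d4_def by (metis real_sqrt_le_mono real_sqrt_abs abs_of_nonneg divide_nonneg_nonneg less_imp_le add_nonneg_nonneg mult_nonneg_nonneg zero_le_numeral zero_le_one)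
    then have "(C' + 1) * sqrt x \<le> (C' + 1) * (k / (2 * (C' + 1)))" using C' by (intro mult_left_mono) auto
    also have "\<dots> = k / 2" using C' by (auto simp: divide_simps add_nonneg_eq_0_iff)
    finally show ?thesis using that by (simp add: algebra_simps) (smt (verit) real_sqrt_ge_zero)
  qed
  have "\<exists>d>0. \<forall>x\<in>{d1, d2, d3 / 2, d4 / 2, \<bar>t0\<bar>, h0 / 2, 1/2}. d \<le> x"
    by (rule pos_lower_bound) (use d1(1) d2(1) d3(1) d4 t0 h0 in auto)
  then obtain d where d: "0 < d" "d \<le> d1" "d \<le> d2" "d \<le> d3 / 2" "d \<le> d4 / 2" "d \<le> \<bar>t0\<bar>" "d \<le> h0 / 2" "d \<le> 1/2" by auto
  define \<eta> where "\<eta> = min d1 (1/2)"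
  have main: "k / 2 * (t - s) powr (h - 1/2) \<le> \<bar>field_kernel ap am t H u - field_kernel ap am s H' u\<bar>"
    if A: "\<bar>t - t0\<bar> < d" "\<bar>s - t0\<bar> < d" "s < t" "\<bar>H - h0\<bar> < d" "\<bar>H' - h0\<bar> < d" "H \<le> h" "\<bar>H - H'\<bar> \<le> (t - s) powr h"
      and u: "\<bar>(t - u) / (t - s) - 1/2\<bar> < \<eta>" for t s H H' h u
  proof -
    define \<tau> where "\<tau> = t - s"
    define z where "z = (t - u) / (t - s)"
    have "0 < \<tau>" "\<tau> < 2 * d" unfolding \<tau>_def using A(1-3) by linarith+
    then have \<tau>: "0 < \<tau>" "\<tau> < d3" "\<tau> \<le> d4" "\<tau> < 1" using d(4,5,8) by linarith+
    have "\<bar>z - 1/2\<bar> < d1" "\<bar>z - 1/2\<bar> < 1/2" using u by (simp_all add: z_def \<eta>_def)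
    then have z: "\<bar>z - 1/2\<bar> < d1" "\<bar>(1 - z) - 1/2\<bar> < d1" "0 < z" "z < 1" by linarith+
    have tu: "t - u = \<tau> * z" using A by (simp add: \<tau>_def z_def)
    then have us: "u - s = \<tau> * (1 - z)" unfolding \<tau>_def by (simp add: algebra_simps)
    have "0 < t - u" "0 < u - s" using tu us \<tau> z by auto
    then have us': "s < u" "u < t" by auto
    have sgn: "0 < u \<longleftrightarrow> 0 < t0" "u \<noteq> 0" "\<bar>\<bar>u\<bar> - \<bar>t0\<bar>\<bar> < d2"
    proof -
      have ut: "\<bar>u - t0\<bar> < d" using us' A(1,2) by linarith
      show "0 < u \<longleftrightarrow> 0 < t0" "u \<noteq> 0" using ut d(6) t0 by linarith+
      show "\<bar>\<bar>u\<bar> - \<bar>t0\<bar>\<bar> < d2" using ut d(3) by linarith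
    qed
    define l where "l = \<tau> powr (H' - H)"
    define P where "P = ap * ?n H z - am * (?n H' (1 - z) * l)"
    have l: "\<bar>l - 1\<bar> \<le> e / v"
    proof -
      define w where "w = (H' - H) * ln \<tau>"
      have "h0 / 2 \<le> h" using A(4,6) d(7) by linarith
      then have "\<tau> powr h \<le> \<tau> powr (h0 / 2)" using \<tau> by (intro powr_mono') auto
      then have "\<bar>H' - H\<bar> \<le> \<tau> powr (h0 / 2)" using A(7) by (simp add: \<tau>_def abs_minus_commute)
      then have "\<bar>w\<bar> \<le> \<tau> powr (h0 / 2) * \<bar>ln \<tau>\<bar>" by (simp add: w_def abs_mult mult_right_mono)
      then have "\<bar>w\<bar> < min (1/2) (e / (2 * v))" using d3(2)[of \<tau>] \<tau> by linarith
      then have w: "\<bar>w\<bar> \<le> 1/2" "\<bar>w\<bar> \<le> e / (2 * v)" by auto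
      have "l = exp w" using \<tau> by (simp add: l_def w_def powr_def)
      then have "\<bar>l - 1\<bar> \<le> 2 * \<bar>w\<bar>" using exp_minus_one_bound[OF w(1)] by simp
      also have "\<dots> \<le> e / v" using w(2) by (simp add: field_simps)
      finally show ?thesis .
    qed
    have n1: "\<bar>?n H z - v\<bar> < e" "\<bar>?n H' (1 - z) - v\<bar> < e"
      using A(4,5) d(2) z(1,2) by (auto intro!: d1(2))
    have n2: "\<bar>?n H' (1 - z) * l - v\<bar> \<le> 5 * e"
    proof -
      have "\<bar>?n H' (1 - z)\<bar> \<le> 2 * v" using n1(2) e(2) v by linarith
      then have "\<bar>?n H' (1 - z)\<bar> * \<bar>l - 1\<bar> \<le> 2 * v * (e / v)" using l v e by (intro mult_mono) auto
      then have "\<bar>?n H' (1 - z) * (l - 1)\<bar> \<le> 2 * e" using v by (simp add: abs_mult)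
      then show ?thesis using n1(2) e(1) by (simp add: algebra_simps)
    qed
    have P: "k \<le> \<bar>P\<bar>"
    proof -
      have "\<bar>P - (ap - am) * v\<bar> = \<bar>ap * (?n H z - v) - am * (?n H' (1 - z) * l - v)\<bar>"
        by (simp add: P_def algebra_simps)
      also have "\<dots> \<le> \<bar>ap\<bar> * \<bar>?n H z - v\<bar> + \<bar>am\<bar> * \<bar>?n H' (1 - z) * l - v\<bar>"
        by (metis abs_mult abs_triangle_ineq4)
      also have "\<dots> \<le> \<bar>ap\<bar> * e + \<bar>am\<bar> * (5 * e)"
        using n1 n2 by (intro add_mono mult_left_mono) auto
      also have "\<dots> \<le> k" using e(1,3) by (simp add: algebra_simps)
      finally have "\<bar>P - (ap - am) * v\<bar> \<le> k" .
      moreover have "\<bar>(ap - am) * v\<bar> = 2 * k" using v by (simp add: k_def abs_mult)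
      ultimately show ?thesis by linarith
    qed
    \<comment> \<open>Since \<open>t0 \<noteq> 0\<close>, the time \<open>u\<close> keeps its sign
      and stays near \<open>t0\<close>, so this part is Lipschitz in the Hurst parameter.\<close>
    define R where "R = ma_kernel ap am H (- u) - ma_kernel ap am H' (- u)"
    have R: "\<bar>R\<bar> \<le> C' * \<tau> powr h"
    proof -
      have d2': "\<bar>?n H \<bar>u\<bar> - ?n H' \<bar>u\<bar>\<bar> \<le> C * \<bar>H - H'\<bar>" using sgn(3) A(4,5) d(3) by (intro d2(3)) auto
      have "R = (if 0 < u then am else ap) * (?n H \<bar>u\<bar> - ?n H' \<bar>u\<bar>)"
        using sgn(2) ma_kernel_pos[of "- u" ap am] ma_kernel_neg[of "- u" ap am]
        by (auto simp: R_def algebra_simps)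
      then have "\<bar>R\<bar> \<le> (\<bar>ap\<bar> + \<bar>am\<bar>) * (C * \<bar>H - H'\<bar>)"
        using d2' by (simp only: abs_mult) (intro mult_mono, auto)
      also have "\<dots> \<le> (\<bar>ap\<bar> + \<bar>am\<bar>) * (C * \<tau> powr h)"
        using A(7) d2(2) by (intro mult_left_mono) (auto simp: \<tau>_def)
      finally show ?thesis by (simp add: C'_def mult.assoc)
    qed
    have F: "field_kernel ap am t H u - field_kernel ap am s H' u = \<tau> powr (H - 1/2) * P - R"
    proof -
      have "ma_kernel ap am H (t - u) = ap * (\<tau> powr (H - 1/2) * ?n H z)"
        using ma_kernel_pos[of "t - u"] us' \<tau> z by (simp add: tu normalized_powr_mult)
      moreover have "ma_kernel ap am H' (s - u) = am * (\<tau> powr (H' - 1/2) * ?n H' (1 - z))"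
        using ma_kernel_neg[of "s - u"] us' \<tau> z by (simp add: us normalized_powr_mult)
      moreover have "\<tau> powr (H' - 1/2) = \<tau> powr (H - 1/2) * l"
        by (simp add: l_def powr_add[symmetric])
      ultimately show ?thesis by (simp add: field_kernel_def P_def R_def algebra_simps)
    qed
    have "\<tau> powr (h - 1/2) \<le> \<tau> powr (H - 1/2)" using \<tau> A(6) by (intro powr_mono') auto
    then have "k * \<tau> powr (h - 1/2) \<le> \<bar>P\<bar> * \<tau> powr (H - 1/2)" using P k by (intro mult_mono) auto
    then have 1: "k * \<tau> powr (h - 1/2) \<le> \<bar>\<tau> powr (H - 1/2) * P\<bar>" by (simp add: abs_mult mult.commute)
    have "\<tau> powr h = \<tau> powr (h - 1/2) * sqrt \<tau>" using \<tau> by (simp add: powr_half_sqrt[symmetric] powr_add[symmetric])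
    then have "\<bar>R\<bar> \<le> (C' * sqrt \<tau>) * \<tau> powr (h - 1/2)" using R by (simp add: mult_ac)
    also have "\<dots> \<le> k / 2 * \<tau> powr (h - 1/2)" using d4'[of \<tau>] \<tau> by (intro mult_right_mono) auto
    finally have "k / 2 * \<tau> powr (h - 1/2) \<le> \<bar>\<tau> powr (H - 1/2) * P - R\<bar>" using 1 by linarith
    then show ?thesis unfolding F \<tau>_def .
  qed
  have "0 < \<eta>" "0 < k / 2" using d1 k by (simp_all add: \<eta>_def)
  then show ?thesis
    by - (rule exI[of _ d], rule conjI, rule d(1), rule exI[of _ "k / 2"], rule conjI, assumption,
          rule exI[of _ \<eta>], rule conjI, assumption, intro allI impI, rule main)
qed

lemma nn_integral_square_interval_lower:
  fixes f :: "real \<Rightarrow> real"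
  assumes [measurable]: "f \<in> borel_measurable borel" and l: "\<And>u. \<bar>u - b\<bar> < r \<Longrightarrow> m \<le> \<bar>f u\<bar>" and "0 \<le> m" "0 \<le> r"
  shows "ennreal (2 * r * m\<^sup>2) \<le> (\<integral>\<^sup>+u. ennreal ((f u)\<^sup>2) \<partial>lborel)"
proof -
  have "ennreal (2 * r * m\<^sup>2) = ennreal (m\<^sup>2) * emeasure lborel {b - r <..< b + r}"
    using assms by (simp add: ennreal_mult[symmetric] mult.commute)
  also have "\<dots> = (\<integral>\<^sup>+u. ennreal (m\<^sup>2) * indicator {b - r <..< b + r} u \<partial>lborel)"
    by (subst nn_integral_cmult_indicator) auto
  also have "\<dots> \<le> (\<integral>\<^sup>+u. ennreal ((f u)\<^sup>2) \<partial>lborel)"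
  proof (intro nn_integral_mono)
    fix u
    show "ennreal (m\<^sup>2) * indicator {b - r <..< b + r} u \<le> ennreal ((f u)\<^sup>2)"
      using l[of u] assms(3) power_mono[of m "\<bar>f u\<bar>" 2] by (auto simp: indicator_def intro!: ennreal_leI)
  qed
  finally show ?thesis .
qed

text \<open>When \<open>\<bar>H - H'\<bar>\<close> is the smaller term, the near bound is integrated
  over an interval of length proportional to \<open>\<bar>t - s\<bar>\<close>. Otherwise the far
  bound applies and its error \<open>C * \<bar>t - s\<bar>\<close> is absorbed, as
  \<open>\<bar>t - s\<bar>\<close> is at most the small factor
  \<open>\<bar>t - s\<bar> powr (1 - h)\<close> times \<open>\<bar>H - H'\<bar>\<close>. The
  conditions \<open>H \<le> h\<close> and \<open>H' \<le> h\<close> ensure that increments in short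
  time are no smaller than the exponent \<open>h\<close> predicts.\<close>

lemma field_kernel_lower:
  assumes h0: "0 < h0" "h0 < 1" and a: "ap \<noteq> am" and t0: "t0 \<noteq> 0"
  shows "\<exists>d>0. \<exists>c>0. \<forall>t s H H' h. \<bar>t - t0\<bar> < d \<longrightarrow> \<bar>s - t0\<bar> < d \<longrightarrow> \<bar>H - h0\<bar> < d \<longrightarrow> \<bar>H' - h0\<bar> < d \<longrightarrow>
    H \<le> h \<longrightarrow> H' \<le> h \<longrightarrow> h < h0 + d \<longrightarrow>
    ennreal (c * (max (\<bar>t - s\<bar> powr h) \<bar>H - H'\<bar>)\<^sup>2)
      \<le> (\<integral>\<^sup>+u. ennreal ((field_kernel ap am t H u - field_kernel ap am s H' u)\<^sup>2) \<partial>lborel)"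
proof -
  obtain d1 c1 \<eta> where d1: "0 < d1" "0 < c1" "0 < \<eta>"
    and near: "\<And>t s H H' h u. \<bar>t - t0\<bar> < d1 \<Longrightarrow> \<bar>s - t0\<bar> < d1 \<Longrightarrow> s < t \<Longrightarrow> \<bar>H - h0\<bar> < d1 \<Longrightarrow> \<bar>H' - h0\<bar> < d1 \<Longrightarrow>
      H \<le> h \<Longrightarrow> \<bar>H - H'\<bar> \<le> (t - s) powr h \<Longrightarrow> \<bar>(t - u) / (t - s) - 1/2\<bar> < \<eta> \<Longrightarrow>
      c1 * (t - s) powr (h - 1/2) \<le> \<bar>field_kernel ap am t H u - field_kernel ap am s H' u\<bar>"
    using field_kernel_near_lower[OF h0(1) a t0] by blast
  have "(ap, am) \<noteq> (0, 0)" using a by auto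
  from field_kernel_far_lower[OF h0(1) this t0]
  obtain u0 d2 c2 C where d2: "0 < d2" "0 < c2" "0 \<le> C"
    and far: "\<And>t s H H' u. \<bar>t - t0\<bar> < d2 \<Longrightarrow> \<bar>s - t0\<bar> < d2 \<Longrightarrow> \<bar>H - h0\<bar> < d2 \<Longrightarrow> \<bar>H' - h0\<bar> < d2
    \<Longrightarrow> \<bar>u - u0\<bar> < d2 \<Longrightarrow> c2 * \<bar>H - H'\<bar> - C * \<bar>t - s\<bar> \<le> \<bar>field_kernel ap am t H u - field_kernel ap am s H' u\<bar>"
    by blast
  define q where "q = (1 - h0) / 2"
  have q: "0 < q" using h0 by (simp add: q_def)
  \<comment> \<open>Chosen so that \<open>r powr q = c2 / (2 * (C + 1))\<close>; then the error of
    the far bound is at most half of its main term.\<close>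
  define r where "r = (c2 / (2 * (C + 1))) powr (1 / q)"
  have r: "0 < r" using d2 by (simp add: r_def)
  have "\<exists>d>0. \<forall>x\<in>{d1, d2, q, r / 2, 1/2}. d \<le> x"
    by (rule pos_lower_bound) (use d1 d2 q r in auto)
  then obtain d where d: "0 < d" "d \<le> d1" "d \<le> d2" "d \<le> q" "d \<le> r / 2" "d \<le> 1/2" by auto
  define c where "c = min (2 * \<eta> * c1\<^sup>2) (2 * d2 * (c2 / 2)\<^sup>2)"
  have c: "0 < c" using d1 d2 by (simp add: c_def)
  let ?F = "\<lambda>t s H H' u. field_kernel ap am t H u - field_kernel ap am s H' u"
  let ?I = "\<lambda>t s H H'. \<integral>\<^sup>+u. ennreal ((?F t s H H' u)\<^sup>2) \<partial>lborel"
  have B: "ennreal (c * (max (\<bar>t - s\<bar> powr h) \<bar>H - H'\<bar>)\<^sup>2) \<le> ?I t s H H'"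
    if A: "\<bar>t - t0\<bar> < d" "\<bar>s - t0\<bar> < d" "\<bar>H - h0\<bar> < d" "\<bar>H' - h0\<bar> < d" "H \<le> h"
      and st: "s < t" and HH: "\<bar>H - H'\<bar> < \<bar>t - s\<bar> powr h" for t s H H' h
  proof -
    define \<tau> where "\<tau> = t - s"
    have \<tau>: "0 < \<tau>" using st by (simp add: \<tau>_def)
    have low: "c1 * \<tau> powr (h - 1/2) \<le> \<bar>?F t s H H' u\<bar>" if u: "\<bar>u - (t - \<tau> / 2)\<bar> < \<eta> * \<tau>" for u
    proof -
      have "(t - u) / (t - s) - 1/2 = - (u - (t - \<tau> / 2)) / \<tau>"
        using \<tau> by (simp add: \<tau>_def field_simps)
      then have "\<bar>(t - u) / (t - s) - 1/2\<bar> = \<bar>u - (t - \<tau> / 2)\<bar> / \<tau>" using \<tau> by (simp add: abs_minus_commute)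
      also have "\<dots> < \<eta>" using u \<tau> by (simp add: pos_divide_less_eq)
      finally show ?thesis using A d(2) st HH unfolding \<tau>_def by (intro near) auto
    qed
    have i1: "ennreal (2 * (\<eta> * \<tau>) * (c1 * \<tau> powr (h - 1/2))\<^sup>2) \<le> ?I t s H H'"
      using low d1 \<tau> by (intro nn_integral_square_interval_lower) auto
    have i2: "2 * (\<eta> * \<tau>) * (c1 * \<tau> powr (h - 1/2))\<^sup>2 = 2 * \<eta> * c1\<^sup>2 * (\<tau> powr h)\<^sup>2"
    proof -
      have "\<tau> powr (h - 1/2) * sqrt \<tau> = \<tau> powr h" using \<tau> by (simp add: powr_half_sqrt[symmetric] powr_add[symmetric])
      then have "(\<tau> powr h)\<^sup>2 = (\<tau> powr (h - 1/2))\<^sup>2 * \<tau>" using \<tau> by (metis power_mult_distrib real_sqrt_pow2 less_imp_le)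
      then show ?thesis by (simp add: power_mult_distrib)
    qed
    have i3: "c * (max (\<bar>t - s\<bar> powr h) \<bar>H - H'\<bar>)\<^sup>2 \<le> 2 * \<eta> * c1\<^sup>2 * (\<tau> powr h)\<^sup>2"
    proof -
      have "max (\<bar>t - s\<bar> powr h) \<bar>H - H'\<bar> = \<tau> powr h" using HH st by (simp add: \<tau>_def)
      then show ?thesis by (simp add: c_def mult_right_mono)
    qed
    show ?thesis by (rule order_trans[OF ennreal_leI i1]) (unfold i2, rule i3)
  qed
  have main: "ennreal (c * (max (\<bar>t - s\<bar> powr h) \<bar>H - H'\<bar>)\<^sup>2) \<le> ?I t s H H'"
    if A: "\<bar>t - t0\<bar> < d" "\<bar>s - t0\<bar> < d" "\<bar>H - h0\<bar> < d" "\<bar>H' - h0\<bar> < d" "H \<le> h" "H' \<le> h" "h < h0 + d" for t s H H' h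
  proof (cases "\<bar>H - H'\<bar> < \<bar>t - s\<bar> powr h")
    case True
    then have "t \<noteq> s" by auto
    then consider "s < t" | "t < s" by linarith
    then show ?thesis
    proof cases
      case 1
      then show ?thesis using A True by (intro B) auto
    next
      case 2
      have "ennreal (c * (max (\<bar>s - t\<bar> powr h) \<bar>H' - H\<bar>)\<^sup>2) \<le> ?I s t H' H"
        using A True 2 by (intro B) (auto simp: abs_minus_commute)
      then show ?thesis by (simp add: abs_minus_commute power2_commute)
    qed
  next
    case False
    define \<tau> where "\<tau> = \<bar>t - s\<bar>"
    have "\<tau> \<le> 2 * d" unfolding \<tau>_def using A(1,2) by linarith
    then have \<tau>: "0 \<le> \<tau>" "\<tau> \<le> r" "\<tau> \<le> 1" using d(5,6) by (auto simp: \<tau>_def)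
    have "d \<le> (1 - h0) / 2" using d(4) by (simp add: q_def)
    then have h1: "q \<le> 1 - h" using A(7) unfolding q_def by argo
    have "\<tau> = \<tau> powr (1 - h) * \<tau> powr h" using \<tau> by (simp add: powr_add[symmetric])
    also have "\<dots> \<le> \<tau> powr q * \<bar>H - H'\<bar>"
      using False \<tau> h1 q by (intro mult_mono powr_mono') (auto simp: \<tau>_def)
    also have "\<dots> \<le> r powr q * \<bar>H - H'\<bar>" using \<tau> q by (intro mult_right_mono powr_mono2) auto
    also have "r powr q = c2 / (2 * (C + 1))" using q d2 by (simp add: r_def powr_powr)
    finally have "(C + 1) * \<tau> \<le> (C + 1) * (c2 / (2 * (C + 1)) * \<bar>H - H'\<bar>)" using d2 by (intro mult_left_mono) auto
    also have "\<dots> = c2 / 2 * \<bar>H - H'\<bar>" using d2 by (auto simp: divide_simps add_nonneg_eq_0_iff)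
    finally have "C * \<tau> \<le> c2 / 2 * \<bar>H - H'\<bar>" using \<tau> by (simp add: algebra_simps)
    then have low: "c2 / 2 * \<bar>H - H'\<bar> \<le> \<bar>?F t s H H' u\<bar>" if "\<bar>u - u0\<bar> < d2" for u
      proof -
      have "c2 * \<bar>H - H'\<bar> - C * \<bar>t - s\<bar> \<le> \<bar>?F t s H H' u\<bar>" using that A(1-4) d(3) by (intro far) auto
      then show ?thesis using \<open>C * \<tau> \<le> c2 / 2 * \<bar>H - H'\<bar>\<close> unfolding \<tau>_def by linarith
    qed
    have i1: "ennreal (2 * d2 * (c2 / 2 * \<bar>H - H'\<bar>)\<^sup>2) \<le> ?I t s H H'"
      using low d2 by (intro nn_integral_square_interval_lower) auto
    have i2: "c * (max (\<bar>t - s\<bar> powr h) \<bar>H - H'\<bar>)\<^sup>2 \<le> 2 * d2 * (c2 / 2 * \<bar>H - H'\<bar>)\<^sup>2"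
    proof -
      have "max (\<bar>t - s\<bar> powr h) \<bar>H - H'\<bar> = \<bar>H - H'\<bar>" using False by simp
      moreover have "c * \<bar>H - H'\<bar>\<^sup>2 \<le> 2 * d2 * (c2 / 2)\<^sup>2 * \<bar>H - H'\<bar>\<^sup>2" by (intro mult_right_mono) (auto simp: c_def)
      ultimately show ?thesis by (simp only: power_mult_distrib mult.assoc)
    qed
    show ?thesis by (rule order_trans[OF ennreal_leI[OF i2] i1])
  qed
  show ?thesis
    by (rule exI[of _ d], rule conjI, rule d(1), rule exI[of _ c], rule conjI, rule c, intro allI impI, rule main)
qed

section \<open>Upper bound for the variance of increments\<close>

text \<open>An integrable majorant, uniform in the exponent, for squared unit increments of
  one-sided powers with exponents between \<open>a\<close> and \<open>b\<close>, where
  \<open>a \<le> 0\<close>. Its parts are the singularity at \<open>1\<close>, the singularity at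
  \<open>0\<close>, and the decay at minus infinity given by the mean value theorem.\<close>

definition one_sided_bound :: "real \<Rightarrow> real \<Rightarrow> real \<Rightarrow> real" where
  "one_sided_bound a b z = indicator {0..1} z * (1 - z) powr (2 * a) + indicator {-1..0} z * (4 * (- z) powr (2 * a))
     + indicator {..-1} z * (- z) powr (2 * b - 2)"

lemma one_sided_bound_measurable [measurable]: "one_sided_bound a b \<in> borel_measurable borel"
  unfolding one_sided_bound_def[abs_def] by measurable

lemma powr_square: "(x powr a)\<^sup>2 = x powr (2 * a)" for x a :: real
  by (simp add: power2_eq_square powr_add[symmetric])

lemma powr_increment_le_near:
  assumes "a \<le> c" "c \<le> 1" "a \<le> 0" "0 < x" "x \<le> (1::real)"
  shows "\<bar>(1 + x) powr c - x powr c\<bar> \<le> 2 * x powr a"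
proof (cases "0 \<le> c")
  case True
  have "x powr c \<le> (1 + x) powr c" using assms True by (intro powr_mono2) auto
  moreover have "(1 + x) powr c \<le> 2 powr c" using assms True by (intro powr_mono2) auto
  moreover have "2 powr c \<le> (2::real)" using powr_mono[of c 1 2] assms by simp
  moreover have "1 \<le> x powr a" using powr_mono'[of a 0 x] assms by simp
  ultimately show ?thesis using powr_ge_zero[of x c] by linarith
next
  case False
  have "(1 + x) powr c \<le> x powr c" using assms False by (intro powr_mono2') auto
  moreover have "x powr c \<le> x powr a" using assms by (intro powr_mono') auto
  ultimately show ?thesis using powr_ge_zero[of "1 + x" c] powr_ge_zero[of x a] by linarith
qed

lemma powr_increment_le_far:
  assumes "c \<le> b" "\<bar>c\<bar> \<le> 1" "b \<le> 1" "1 \<le> (x::real)"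
  shows "\<bar>(1 + x) powr c - x powr c\<bar> \<le> x powr (b - 1)"
proof -
  have "\<exists>z>x. z < 1 + x \<and> (1 + x) powr c - x powr c = (1 + x - x) * (c * z powr (c - 1))"
    using assms by (intro MVT2) (auto intro!: has_real_derivative_powr)
  then obtain z where z: "x < z" "(1 + x) powr c - x powr c = c * z powr (c - 1)" by auto
  have "\<bar>c\<bar> * z powr (c - 1) \<le> 1 * z powr (c - 1)" using assms by (intro mult_right_mono) auto
  also have "1 * z powr (c - 1) \<le> x powr (c - 1)" using assms z by (simp add: powr_mono2')
  also have "\<dots> \<le> x powr (b - 1)" using assms by (intro powr_mono) auto
  finally show ?thesis unfolding z by (simp add: abs_mult)
qed

lemma one_sided_increment_bound:
  assumes "a \<le> c" "a \<le> 0" "c \<le> b" "\<bar>c\<bar> \<le> 1" "b \<le> 1"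
  shows "(pos_powr (1 - z) c - pos_powr (- z) c)\<^sup>2 \<le> one_sided_bound a b z"
proof -
  have ge: "0 \<le> one_sided_bound a b z" for z by (simp add: one_sided_bound_def)
  consider "1 \<le> z" | "0 \<le> z" "z < 1" | "-1 \<le> z" "z < 0" | "z < -1" by linarith
  then show ?thesis
  proof cases
    case 1
    then show ?thesis using ge by (simp add: pos_powr_def)
  next
    case 2
    have "(1 - z) powr c \<le> (1 - z) powr a" using 2 assms by (intro powr_mono') auto
    then have "((1 - z) powr c)\<^sup>2 \<le> ((1 - z) powr a)\<^sup>2" by (intro power_mono) auto
    also have "\<dots> = (1 - z) powr (2 * a)" by (simp add: powr_square)
    also have "\<dots> \<le> one_sided_bound a b z" using 2 by (simp add: one_sided_bound_def)
    finally show ?thesis using 2 by (simp add: pos_powr_def)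
  next
    case 3
    have "\<bar>(1 + (- z)) powr c - (- z) powr c\<bar> \<le> 2 * (- z) powr a"
      using 3 assms by (intro powr_increment_le_near) auto
    then have "((1 - z) powr c - (- z) powr c)\<^sup>2 \<le> (2 * (- z) powr a)\<^sup>2"
      by (metis abs_ge_zero power2_abs power_mono uminus_add_conv_diff add.commute)
    also have "\<dots> = 4 * (- z) powr (2 * a)" by (simp add: power_mult_distrib powr_square)
    also have "\<dots> \<le> one_sided_bound a b z" using 3 by (simp add: one_sided_bound_def)
    finally show ?thesis using 3 by (simp add: pos_powr_def)
  next
    case 4
    have "\<bar>(1 + (- z)) powr c - (- z) powr c\<bar> \<le> (- z) powr (b - 1)"
      using 4 assms by (intro powr_increment_le_far) auto
    then have "((1 - z) powr c - (- z) powr c)\<^sup>2 \<le> ((- z) powr (b - 1))\<^sup>2"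
      by (metis abs_ge_zero power2_abs power_mono uminus_add_conv_diff add.commute)
    also have "\<dots> = (- z) powr (2 * b - 2)" by (simp add: powr_square right_diff_distrib)
    also have "\<dots> \<le> one_sided_bound a b z" using 4 by (simp add: one_sided_bound_def)
    finally show ?thesis using 4 by (simp add: pos_powr_def)
  qed
qed

lemma nn_integral_indicator_has_integral:
  fixes f :: "real \<Rightarrow> real"
  assumes "f \<in> borel_measurable borel" "\<And>x. 0 \<le> f x" "(f has_integral I) S" "S \<in> sets borel"
  shows "(\<integral>\<^sup>+x. ennreal (indicator S x * f x) \<partial>lborel) = ennreal I"
proof (rule nn_integral_has_integral_lborel)
  show "((\<lambda>x. indicator S x * f x) has_integral I) UNIV"
  proof -
    have "(\<lambda>x. indicator S x * f x) = (\<lambda>x. if x \<in> S then f x else 0)" by (auto simp: fun_eq_iff)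
    then show ?thesis using assms(3) has_integral_restrict_UNIV[of S f I] by simp
  qed
qed (use assms in auto)

text \<open>The two conditions are \<open>2 * a > -1\<close> at the singularities and
  \<open>2 * b - 2 < -1\<close> at infinity; for exponents \<open>H - 1/2\<close> they amount to
  \<open>0 < H < 1\<close>.\<close>

lemma one_sided_bound_integrable:
  assumes "-1/2 < a" "b < 1/2"
  shows "(\<integral>\<^sup>+z. ennreal (one_sided_bound a b z) \<partial>lborel) < \<infinity>"
proof -
  have I1: "(\<integral>\<^sup>+z. ennreal (indicator {0..1} z * z powr (2 * a)) \<partial>lborel) < \<infinity>"
    using nn_integral_indicator_has_integral[OF _ _ has_integral_powr_from_0[of "2 * a" 1]] assms by simp
  have I2: "(\<integral>\<^sup>+z. ennreal (indicator {1..} z * z powr (2 * b - 2)) \<partial>lborel) < \<infinity>"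
    using nn_integral_indicator_has_integral[OF _ _ has_integral_powr_to_inf[of "2 * b - 2" 1]] assms by simp
  have J1: "(\<integral>\<^sup>+z. ennreal (indicator {0..1} z * (1 - z) powr (2 * a)) \<partial>lborel) < \<infinity>"
  proof -
    have "indicator {0..1} (1 + -1 * z) = (indicator {0..1} z :: real)" for z :: real by (auto split: split_indicator)
    then show ?thesis using I1
      by (subst nn_integral_real_affine[of _ "-1" 1]) auto
  qed
  have J2: "(\<integral>\<^sup>+z. ennreal (indicator {-1..0} z * (- z) powr (2 * a)) \<partial>lborel) < \<infinity>"
  proof -
    have "indicator {-1..0} (0 + -1 * z) = (indicator {0..1} z :: real)" for z :: real by (auto split: split_indicator)
    then show ?thesis using I1
      by (subst nn_integral_real_affine[of _ "-1" 0]) auto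
  qed
  have J3: "(\<integral>\<^sup>+z. ennreal (indicator {..-1} z * (- z) powr (2 * b - 2)) \<partial>lborel) < \<infinity>"
  proof -
    have "indicator {..-1} (0 + -1 * z) = (indicator {1..} z :: real)" for z :: real by (auto split: split_indicator)
    then show ?thesis using I2
      by (subst nn_integral_real_affine[of _ "-1" 0]) auto
  qed
  have "(\<integral>\<^sup>+z. ennreal (one_sided_bound a b z) \<partial>lborel)
      = (\<integral>\<^sup>+z. ennreal (indicator {0..1} z * (1 - z) powr (2 * a)) + 4 * ennreal (indicator {-1..0} z * (- z) powr (2 * a))
        + ennreal (indicator {..-1} z * (- z) powr (2 * b - 2)) \<partial>lborel)"
  proof (intro nn_integral_cong)
    fix z :: real
    have "4 * ennreal (indicator {-1..0} z * (- z) powr (2 * a)) = ennreal (indicator {-1..0} z * (4 * (- z) powr (2 * a)))"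
      by (simp add: ennreal_mult' indicator_def)
    then show "ennreal (one_sided_bound a b z) = ennreal (indicator {0..1} z * (1 - z) powr (2 * a))
        + 4 * ennreal (indicator {-1..0} z * (- z) powr (2 * a)) + ennreal (indicator {..-1} z * (- z) powr (2 * b - 2))"
      by (simp add: one_sided_bound_def ennreal_plus)
  qed
  also have "\<dots> = (\<integral>\<^sup>+z. ennreal (indicator {0..1} z * (1 - z) powr (2 * a)) \<partial>lborel)
      + 4 * (\<integral>\<^sup>+z. ennreal (indicator {-1..0} z * (- z) powr (2 * a)) \<partial>lborel)
      + (\<integral>\<^sup>+z. ennreal (indicator {..-1} z * (- z) powr (2 * b - 2)) \<partial>lborel)"
    by (simp add: nn_integral_add nn_integral_cmult)
  also have "\<dots> < \<infinity>" using J1 J2 J3 by (simp add: ennreal_mult_less_top)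
  finally show ?thesis .
qed

lemma ma_kernel_scale:
  assumes "0 < \<tau>"
  shows "ma_kernel ap am H (\<tau> * x) = \<tau> powr (H - 1/2) * ma_kernel ap am H x"
proof -
  have "max (\<tau> * x) 0 = \<tau> * max x 0" "max (- (\<tau> * x)) 0 = \<tau> * max (- x) 0"
    using assms by (simp_all add: max_mult_distrib_left)
  then show ?thesis using assms by (simp add: ma_kernel_def pos_powr_def neg_powr_def powr_mult algebra_simps)
qed

text \<open>Self-similarity reduces the increment to the one over the unit interval.\<close>
lemma field_kernel_increment_upper:
  assumes h: "0 < h1" "h1 \<le> h2" "h2 < 1"
  shows "\<exists>C\<ge>0. \<forall>H t s. h1 \<le> H \<longrightarrow> H \<le> h2 \<longrightarrow> \<bar>t - s\<bar> \<le> 1 \<longrightarrow>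
    (\<integral>\<^sup>+u. ennreal ((field_kernel ap am t H u - field_kernel ap am s H u)\<^sup>2) \<partial>lborel) \<le> ennreal (C * \<bar>t - s\<bar> powr (2 * h1))"
proof -
  \<comment> \<open>The majorant asks for \<open>a \<le> 0\<close> although \<open>h1 - 1/2\<close>
    may be positive, hence the minimum.\<close>
  define a b where "a = min 0 (h1 - 1/2)" and "b = h2 - 1/2"
  have ab: "-1/2 < a" "a \<le> 0" "a \<le> h1 - 1/2" "b < 1/2" using h by (auto simp: a_def b_def)
  let ?g = "one_sided_bound a b"
  have g0: "0 \<le> ?g z" for z by (simp add: one_sided_bound_def)
  have "continuous_on {h1..h2} (\<lambda>H::real. rGamma (H + 1/2))"
    by (intro continuous_on_compose2[OF continuous_on_rGamma[of UNIV]] continuous_intros) auto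
  then have "compact ((\<lambda>H::real. rGamma (H + 1/2)) ` {h1..h2})" by (rule compact_continuous_image) simp
  then have "bounded ((\<lambda>H::real. rGamma (H + 1/2)) ` {h1..h2})" by (rule compact_imp_bounded)
  then obtain R where R': "\<forall>y\<in>(\<lambda>H::real. rGamma (H + 1/2)) ` {h1..h2}. norm y \<le> R"
    unfolding bounded_iff by (elim exE)
  have R: "\<bar>rGamma (H + 1/2)\<bar> \<le> R" if "h1 \<le> H" "H \<le> h2" for H
    using R' that by simp
  \<comment> \<open>The negative part is the positive one reflected by
    \<open>z \<mapsto> 1 - z\<close>, whence the second term; the leading \<open>2\<close> comes
    from \<open>(x + y)\<^sup>2 \<le> 2 * (x\<^sup>2 + y\<^sup>2)\<close>.\<close>
  define G where "G z = 2 * R\<^sup>2 * (ap\<^sup>2 * ?g z + am\<^sup>2 * ?g (1 - z))" for z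
  have [measurable]: "G \<in> borel_measurable borel" unfolding G_def[abs_def] by measurable
  obtain I where I: "(\<integral>\<^sup>+z. ennreal (?g z) \<partial>lborel) = ennreal I" "0 \<le> I"
    using one_sided_bound_integrable[of a b] ab by (cases "\<integral>\<^sup>+z. ennreal (?g z) \<partial>lborel") auto
  have I': "(\<integral>\<^sup>+z. ennreal (?g (1 - z)) \<partial>lborel) = ennreal I"
    using nn_integral_real_affine[of "\<lambda>z. ennreal (?g z)" "-1" 1] I by simp
  define C where "C = 2 * R\<^sup>2 * (ap\<^sup>2 * I + am\<^sup>2 * I)"
  have C0: "0 \<le> C" using I by (simp add: C_def)
  have GI: "(\<integral>\<^sup>+z. ennreal (G z) \<partial>lborel) = ennreal C"
  proof -
    have "(\<integral>\<^sup>+z. ennreal (G z) \<partial>lborel) = (\<integral>\<^sup>+z. ennreal (2 * R\<^sup>2 * ap\<^sup>2) * ennreal (?g z) + ennreal (2 * R\<^sup>2 * am\<^sup>2) * ennreal (?g (1 - z)) \<partial>lborel)"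
    proof (intro nn_integral_cong)
      fix z
      have "G z = 2 * R\<^sup>2 * ap\<^sup>2 * ?g z + 2 * R\<^sup>2 * am\<^sup>2 * ?g (1 - z)" by (simp add: G_def algebra_simps)
      then show "ennreal (G z) = ennreal (2 * R\<^sup>2 * ap\<^sup>2) * ennreal (?g z) + ennreal (2 * R\<^sup>2 * am\<^sup>2) * ennreal (?g (1 - z))"
        using g0 by (simp add: ennreal_plus ennreal_mult)
    qed
    also have "\<dots> = ennreal (2 * R\<^sup>2 * ap\<^sup>2) * ennreal I + ennreal (2 * R\<^sup>2 * am\<^sup>2) * ennreal I"
      by (subst nn_integral_add) (auto simp: nn_integral_cmult I I')
    also have "\<dots> = ennreal (2 * R\<^sup>2 * ap\<^sup>2 * I + 2 * R\<^sup>2 * am\<^sup>2 * I)"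
      using I(2) by (simp add: ennreal_plus ennreal_mult)
    also have "2 * R\<^sup>2 * ap\<^sup>2 * I + 2 * R\<^sup>2 * am\<^sup>2 * I = C" by (simp add: C_def algebra_simps)
    finally show ?thesis .
  qed
  have unit: "(ma_kernel ap am H (1 - z) - ma_kernel ap am H (- z))\<^sup>2 \<le> G z" if H: "h1 \<le> H" "H \<le> h2" for H z
  proof -
    define c where "c = H - 1/2"
    have c: "a \<le> c" "c \<le> b" "\<bar>c\<bar> \<le> 1" "b \<le> 1" using H h ab by (auto simp: c_def b_def)
    define p where "p = pos_powr (1 - z) c - pos_powr (- z) c"
    define q where "q = neg_powr (1 - z) c - neg_powr (- z) c"
    have p: "p\<^sup>2 \<le> ?g z" unfolding p_def using c ab by (intro one_sided_increment_bound) auto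
    have "q = - (pos_powr (1 - (1 - z)) c - pos_powr (- (1 - z)) c)"
      by (simp add: q_def pos_powr_def neg_powr_def)
    then have "q\<^sup>2 = (pos_powr (1 - (1 - z)) c - pos_powr (- (1 - z)) c)\<^sup>2" by (simp only: power2_minus)
    then have q: "q\<^sup>2 \<le> ?g (1 - z)" using one_sided_increment_bound[of a c b "1 - z"] c ab by simp
    have "ma_kernel ap am H (1 - z) - ma_kernel ap am H (- z) = rGamma (H + 1/2) * (ap * p + am * q)"
      by (simp add: ma_kernel_def p_def q_def c_def algebra_simps)
    then have "(ma_kernel ap am H (1 - z) - ma_kernel ap am H (- z))\<^sup>2 = \<bar>rGamma (H + 1/2)\<bar>\<^sup>2 * (ap * p + am * q)\<^sup>2"
      by (simp add: power_mult_distrib)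
    also have "\<dots> \<le> R\<^sup>2 * (2 * ((ap * p)\<^sup>2 + (am * q)\<^sup>2))"
    proof (intro mult_mono power_mono R H)
      have "0 \<le> (ap * p - am * q)\<^sup>2" by simp
      then show "(ap * p + am * q)\<^sup>2 \<le> 2 * ((ap * p)\<^sup>2 + (am * q)\<^sup>2)" by (simp add: power2_sum power2_diff)
    qed auto
    also have "\<dots> = 2 * R\<^sup>2 * (ap\<^sup>2 * p\<^sup>2 + am\<^sup>2 * q\<^sup>2)" by (simp add: power_mult_distrib)
    also have "\<dots> \<le> G z" unfolding G_def using p q by (intro mult_left_mono add_mono) auto
    finally show ?thesis .
  qed
  let ?F = "\<lambda>t s H u. field_kernel ap am t H u - field_kernel ap am s H u"
  have B: "(\<integral>\<^sup>+u. ennreal ((?F t s H u)\<^sup>2) \<partial>lborel) \<le> ennreal (C * \<bar>t - s\<bar> powr (2 * h1))"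
    if H: "h1 \<le> H" "H \<le> h2" and ts: "\<bar>t - s\<bar> \<le> 1" "s < t" for H t s
  proof -
    define \<tau> where "\<tau> = t - s"
    have \<tau>: "0 < \<tau>" "\<tau> \<le> 1" using ts by (auto simp: \<tau>_def)
    have F: "(?F t s H (s + \<tau> * z))\<^sup>2 = \<tau> powr (2 * H - 1) * (ma_kernel ap am H (1 - z) - ma_kernel ap am H (- z))\<^sup>2" for z
    proof -
      have "?F t s H (s + \<tau> * z) = ma_kernel ap am H (\<tau> * (1 - z)) - ma_kernel ap am H (\<tau> * (- z))"
        by (simp add: field_kernel_def \<tau>_def algebra_simps)
      also have "\<dots> = \<tau> powr (H - 1/2) * (ma_kernel ap am H (1 - z) - ma_kernel ap am H (- z))"
        unfolding ma_kernel_scale[OF \<tau>(1)] by (rule right_diff_distrib[symmetric])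
      finally have "(?F t s H (s + \<tau> * z))\<^sup>2 = (\<tau> powr (H - 1/2))\<^sup>2 * (ma_kernel ap am H (1 - z) - ma_kernel ap am H (- z))\<^sup>2"
        by (simp only: power_mult_distrib)
      also have "(\<tau> powr (H - 1/2))\<^sup>2 = \<tau> powr (2 * H - 1)" by (simp add: powr_square right_diff_distrib)
      finally show ?thesis .
    qed
    have "(\<integral>\<^sup>+u. ennreal ((?F t s H u)\<^sup>2) \<partial>lborel) = ennreal \<tau> * (\<integral>\<^sup>+z. ennreal ((?F t s H (s + \<tau> * z))\<^sup>2) \<partial>lborel)"
      using \<tau> by (subst nn_integral_real_affine[of _ \<tau> s]) auto
    also have "\<dots> \<le> ennreal \<tau> * (\<integral>\<^sup>+z. ennreal (\<tau> powr (2 * H - 1)) * ennreal (G z) \<partial>lborel)"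
    proof (intro mult_left_mono nn_integral_mono)
      fix z
      show "ennreal ((?F t s H (s + \<tau> * z))\<^sup>2) \<le> ennreal (\<tau> powr (2 * H - 1)) * ennreal (G z)"
        unfolding F by (simp add: ennreal_mult' mult_left_mono ennreal_leI unit[OF H])
    qed auto
    also have "\<dots> = ennreal \<tau> * (ennreal (\<tau> powr (2 * H - 1)) * ennreal C)"
      by (simp add: nn_integral_cmult GI)
    also have "\<dots> = ennreal (\<tau> * (\<tau> powr (2 * H - 1) * C))" using \<tau> C0 by (simp add: ennreal_mult)
    also have "\<tau> * (\<tau> powr (2 * H - 1) * C) = C * \<tau> powr (2 * H)" using \<tau> by (simp add: powr_diff)
    also have "ennreal (C * \<tau> powr (2 * H)) \<le> ennreal (C * \<bar>t - s\<bar> powr (2 * h1))"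
      using \<tau> C0 H by (intro ennreal_leI mult_left_mono) (auto simp: \<tau>_def intro!: powr_mono')
    finally show ?thesis .
  qed
  have main: "(\<integral>\<^sup>+u. ennreal ((?F t s H u)\<^sup>2) \<partial>lborel) \<le> ennreal (C * \<bar>t - s\<bar> powr (2 * h1))"
    if H: "h1 \<le> H" "H \<le> h2" and ts: "\<bar>t - s\<bar> \<le> 1" for H t s
  proof (cases t s rule: linorder_cases)
    case greater
    then show ?thesis using B[OF H ts] by simp
  next
    case less
    then show ?thesis using B[OF H, of s t] ts by (simp add: abs_minus_commute power2_commute)
  qed simp
  show ?thesis
    by (rule exI[of _ C], rule conjI, rule C0, intro allI impI, rule main)
qed

section \<open>Almost sure lower bound for the dimension of the graph\<close>

lemma std_normal_density_le_1: "std_normal_density x \<le> 1"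
proof -
  have "1 \<le> sqrt (2 * pi)" using pi_ge_two by (simp add: real_le_rsqrt)
  then have "1 / sqrt (2 * pi) \<le> 1" by simp
  moreover have "exp (- x\<^sup>2 / 2) \<le> 1" by simp
  ultimately have "1 / sqrt (2 * pi) * exp (- x\<^sup>2 / 2) \<le> 1 * 1" by (intro mult_mono) auto
  then show ?thesis by (simp add: std_normal_density_def)
qed

lemma nn_integral_centred_gaussian:
  assumes Y: "centred_gaussian M Y v" and F[measurable]: "F \<in> borel_measurable borel"
  shows "(\<integral>\<^sup>+\<omega>. F (Y \<omega>) \<partial>M) = (\<integral>\<^sup>+x. F (sqrt v * x) \<partial>std_normal_distribution)"
proof -
  have "(\<integral>\<^sup>+\<omega>. F (Y \<omega>) \<partial>M) = (\<integral>\<^sup>+y. F y \<partial>distr M borel Y)"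
    using Y by (subst nn_integral_distr) (auto simp: centred_gaussian_def)
  also have "distr M borel Y = distr std_normal_distribution borel (\<lambda>x. sqrt v * x)"
    using Y by (simp add: centred_gaussian_def)
  also have "(\<integral>\<^sup>+y. F y \<partial>distr std_normal_distribution borel (\<lambda>x. sqrt v * x)) = (\<integral>\<^sup>+x. F (sqrt v * x) \<partial>std_normal_distribution)"
    by (subst nn_integral_distr) auto
  finally show ?thesis .
qed

text \<open>The plateau contributes \<open>2 * \<tau> powr (1 - s)\<close> and each tail
  \<open>\<tau> powr (1 - s) / (s - 1)\<close>; the tails converge because
  \<open>1 < s\<close>.\<close>

lemma truncated_power_integral_le:
  assumes "0 < \<tau>" "1 < s"
  shows "(\<integral>\<^sup>+y. ennreal (max \<tau> \<bar>y\<bar> powr - s) \<partial>lborel) \<le> ennreal ((2 + 2 / (s - 1)) * \<tau> powr (1 - s))"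
proof -
  have I: "(\<integral>\<^sup>+y. ennreal (indicator {\<tau>..} y * y powr - s) \<partial>lborel) = ennreal (\<tau> powr (1 - s) / (s - 1))"
  proof -
    have "((\<lambda>x. x powr - s) has_integral - (\<tau> powr (- s + 1)) / (- s + 1)) {\<tau>..}"
      using assms by (intro has_integral_powr_to_inf) auto
    moreover have "- (\<tau> powr (- s + 1)) / (- s + 1) = \<tau> powr (1 - s) / (s - 1)"
      using assms by (simp add: divide_simps) (simp add: algebra_simps)
    ultimately show ?thesis by (intro nn_integral_indicator_has_integral) auto
  qed
  have I': "(\<integral>\<^sup>+y. ennreal (indicator {..-\<tau>} y * (- y) powr - s) \<partial>lborel) = ennreal (\<tau> powr (1 - s) / (s - 1))"
  proof -
    have "indicator {..-\<tau>} (0 + -1 * z) = (indicator {\<tau>..} z :: real)" for z :: real by (auto split: split_indicator)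
    then show ?thesis using I by (subst nn_integral_real_affine[of _ "-1" 0]) auto
  qed
  have "(\<integral>\<^sup>+y. ennreal (max \<tau> \<bar>y\<bar> powr - s) \<partial>lborel) \<le>
     (\<integral>\<^sup>+y. ennreal (\<tau> powr - s) * indicator {-\<tau>..\<tau>} y + (ennreal (indicator {\<tau>..} y * y powr - s)
        + ennreal (indicator {..-\<tau>} y * (- y) powr - s)) \<partial>lborel)"
  proof (intro nn_integral_mono)
    fix y :: real
    consider "\<bar>y\<bar> \<le> \<tau>" | "\<tau> < y" | "y < - \<tau>" by linarith
    then show "ennreal (max \<tau> \<bar>y\<bar> powr - s) \<le> ennreal (\<tau> powr - s) * indicator {-\<tau>..\<tau>} y + (ennreal (indicator {\<tau>..} y * y powr - s)
        + ennreal (indicator {..-\<tau>} y * (- y) powr - s))"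
    proof cases
      case 1
      then have "max \<tau> \<bar>y\<bar> = \<tau>" "y \<in> {-\<tau>..\<tau>}" by auto
      then show ?thesis by simp
    next
      case 2
      then have "max \<tau> \<bar>y\<bar> = y" "y \<in> {\<tau>..}" using assms by auto
      then show ?thesis using 2 assms by simp
    next
      case 3
      then have "max \<tau> \<bar>y\<bar> = - y" "y \<in> {..-\<tau>}" using assms by auto
      then show ?thesis using 3 assms by simp
    qed
  qed
  also have "\<dots> = ennreal (\<tau> powr - s) * ennreal (2 * \<tau>) + (ennreal (\<tau> powr (1 - s) / (s - 1)) + ennreal (\<tau> powr (1 - s) / (s - 1)))"
    using assms by (simp add: nn_integral_add nn_integral_cmult_indicator I I')
  also have "\<dots> = ennreal (\<tau> powr - s * (2 * \<tau>) + (\<tau> powr (1 - s) / (s - 1) + \<tau> powr (1 - s) / (s - 1)))"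
  proof -
    have "0 \<le> \<tau> powr (1 - s) / (s - 1)" "0 \<le> \<tau> powr - s * (2 * \<tau>)" using assms by auto
    moreover have "ennreal (\<tau> powr - s) * ennreal (2 * \<tau>) = ennreal (\<tau> powr - s * (2 * \<tau>))"
      using assms by (intro ennreal_mult[symmetric]) auto
    ultimately show ?thesis by (simp only: ennreal_plus add_nonneg_nonneg)
  qed
  also have "\<tau> powr - s * (2 * \<tau>) + (\<tau> powr (1 - s) / (s - 1) + \<tau> powr (1 - s) / (s - 1)) = (2 + 2 / (s - 1)) * \<tau> powr (1 - s)"
  proof -
    have "\<tau> powr - s * \<tau> = \<tau> powr (1 - s)" using assms powr_add[of \<tau> "- s" 1] by simp
    then show ?thesis by (simp add: algebra_simps)
  qed
  finally show ?thesis .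
qed

text \<open>The standard normal density is at most \<open>1\<close>, so after the substitution
  \<open>y = sqrt v * x\<close> the mean is at most the Lebesgue integral divided by the standard
  deviation. This division is the source of the parabolic distance in the denominator of the
  averaged kernel.\<close>

lemma gaussian_kernel_expectation_le:
  assumes Y: "centred_gaussian M Y v" and \<sigma>: "0 < \<sigma>" "\<sigma>\<^sup>2 \<le> v" and \<tau>: "0 < \<tau>" and s: "1 < s"
  shows "(\<integral>\<^sup>+\<omega>. ennreal (max \<tau> \<bar>Y \<omega>\<bar> powr - s) \<partial>M) \<le> ennreal ((2 + 2 / (s - 1)) * \<tau> powr (1 - s) / \<sigma>)"
proof -
  let ?F = "\<lambda>y. ennreal (max \<tau> \<bar>y\<bar> powr - s)"
  define C where "C = (2 + 2 / (s - 1)) * \<tau> powr (1 - s)"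
  have C: "0 \<le> C" using s by (simp add: C_def)
  have v: "0 < v" using \<sigma> by (smt (verit) zero_less_power)
  have r: "\<sigma> \<le> sqrt v" using \<sigma> by (simp add: real_le_rsqrt)
  have "(\<integral>\<^sup>+\<omega>. ?F (Y \<omega>) \<partial>M) = (\<integral>\<^sup>+x. ?F (sqrt v * x) \<partial>std_normal_distribution)"
    by (rule nn_integral_centred_gaussian[OF Y]) measurable
  also have "\<dots> = (\<integral>\<^sup>+x. ennreal (std_normal_density x) * ?F (sqrt v * x) \<partial>lborel)"
    by (subst nn_integral_density) auto
  also have "\<dots> \<le> (\<integral>\<^sup>+x. 1 * ?F (0 + sqrt v * x) \<partial>lborel)"
    using std_normal_density_le_1 by (intro nn_integral_mono mult_mono) (auto simp: ennreal_le_1)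
  also have "\<dots> = ennreal (1 / sqrt v) * (ennreal \<bar>sqrt v\<bar> * (\<integral>\<^sup>+x. ?F (0 + sqrt v * x) \<partial>lborel))"
    using v by (simp add: mult.assoc[symmetric] ennreal_mult[symmetric])
  also have "ennreal \<bar>sqrt v\<bar> * (\<integral>\<^sup>+x. ?F (0 + sqrt v * x) \<partial>lborel) = (\<integral>\<^sup>+y. ?F y \<partial>lborel)"
    using v by (intro nn_integral_real_affine[symmetric]) auto
  also have "ennreal (1 / sqrt v) * (\<integral>\<^sup>+y. ?F y \<partial>lborel) \<le> ennreal (1 / \<sigma>) * ennreal C"
    unfolding C_def using r \<sigma> by (intro mult_mono ennreal_leI truncated_power_integral_le \<tau> s) (auto intro: frac_le)
  also have "\<dots> = ennreal (C / \<sigma>)" using C \<sigma> by (simp add: ennreal_mult[symmetric])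
  finally show ?thesis by (simp add: C_def)
qed

text \<open>Scaling reduces the moment to that of the standard normal law; what matters later is
  that \<open>m\<close> is the same for all \<open>Y\<close> and \<open>v\<close>.\<close>

lemma gaussian_even_moment:
  "\<exists>m\<ge>0. \<forall>Y v. centred_gaussian M Y v \<longrightarrow> 0 \<le> v \<longrightarrow> (\<integral>\<^sup>+\<omega>. ennreal (Y \<omega> ^ (2 * k)) \<partial>M) = ennreal (v ^ k * m)"
proof -
  define m where "m = (\<integral>x. x ^ (2 * k) \<partial>std_normal_distribution)"
  have m0: "0 \<le> m" unfolding m_def by (intro integral_nonneg_AE) auto
  have "(\<integral>\<^sup>+\<omega>. ennreal (Y \<omega> ^ (2 * k)) \<partial>M) = ennreal (v ^ k * m)" if Y: "centred_gaussian M Y v" and v: "0 \<le> v" for Y v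
  proof -
    have "(\<integral>\<^sup>+\<omega>. ennreal (Y \<omega> ^ (2 * k)) \<partial>M) = (\<integral>\<^sup>+x. ennreal ((sqrt v * x) ^ (2 * k)) \<partial>std_normal_distribution)"
      by (rule nn_integral_centred_gaussian[OF Y]) measurable
    also have "\<dots> = (\<integral>\<^sup>+x. ennreal (v ^ k) * ennreal (x ^ (2 * k)) \<partial>std_normal_distribution)"
      using v by (intro nn_integral_cong) (simp add: ennreal_mult[symmetric] power_mult_distrib power_mult)
    also have "\<dots> = ennreal (v ^ k) * (\<integral>\<^sup>+x. ennreal (x ^ (2 * k)) \<partial>std_normal_distribution)"
      by (intro nn_integral_cmult) measurable
    also have "(\<integral>\<^sup>+x. ennreal (x ^ (2 * k)) \<partial>std_normal_distribution) = ennreal m"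
      unfolding m_def by (intro nn_integral_eq_integral integrable_std_normal_distribution_moment) auto
    finally show ?thesis using v m0 by (simp add: ennreal_mult)
  qed
  then show ?thesis using m0 by blast
qed

section \<open>Energy of the graph of the motion\<close>

context white_noise_space
begin

lemma field_has_wiener_integral:
  assumes B: "fractional_brownian_field_version M W ap am B" and H: "0 < H" "H < 1"
  shows "has_wiener_integral M W (field_kernel ap am t H) (B t H)"
proof -
  have H01: "H \<in> {0<..<1}" using H by simp
  note BH = B[unfolded fractional_brownian_field_version_def, THEN spec[of _ t], THEN bspec[OF _ H01]]
  have meas: "B t H \<in> borel_measurable M" by (rule conjunct1[OF BH])
  from conjunct2[OF BH] obtain Ip where Ip0: "\<exists>J. has_wiener_integral M W (\<lambda>u. pos_powr (t - u) (H - 1/2) - pos_powr (- u) (H - 1/2)) Ip \<and>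
     has_wiener_integral M W (\<lambda>u. neg_powr (t - u) (H - 1/2) - neg_powr (- u) (H - 1/2)) J \<and>
     (AE \<omega> in M. B t H \<omega> = ap * (1 / Gamma (H + 1/2) * Ip \<omega>) + am * (1 / Gamma (H + 1/2) * J \<omega>))" ..
  from Ip0 obtain J where I: "has_wiener_integral M W (\<lambda>u. pos_powr (t - u) (H - 1/2) - pos_powr (- u) (H - 1/2)) Ip \<and>
     has_wiener_integral M W (\<lambda>u. neg_powr (t - u) (H - 1/2) - neg_powr (- u) (H - 1/2)) J \<and>
     (AE \<omega> in M. B t H \<omega> = ap * (1 / Gamma (H + 1/2) * Ip \<omega>) + am * (1 / Gamma (H + 1/2) * J \<omega>))" ..
  have Ip: "has_wiener_integral M W (\<lambda>u. pos_powr (t - u) (H - 1/2) - pos_powr (- u) (H - 1/2)) Ip"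
    by (rule conjunct1[OF I])
  have J: "has_wiener_integral M W (\<lambda>u. neg_powr (t - u) (H - 1/2) - neg_powr (- u) (H - 1/2)) J"
    by (rule conjunct1[OF conjunct2[OF I]])
  have AE: "AE \<omega> in M. B t H \<omega> = ap * (1 / Gamma (H + 1/2) * Ip \<omega>) + am * (1 / Gamma (H + 1/2) * J \<omega>)"
    by (rule conjunct2[OF conjunct2[OF I]])
  let ?r = "rGamma (H + 1/2)"
  have r: "1 / Gamma (H + 1/2) = ?r" by (simp only: rGamma_inverse_Gamma inverse_eq_divide)
  have "has_wiener_integral M W (\<lambda>u. (ap * ?r) * (pos_powr (t - u) (H - 1/2) - pos_powr (- u) (H - 1/2))
      + (am * ?r) * (neg_powr (t - u) (H - 1/2) - neg_powr (- u) (H - 1/2))) (\<lambda>\<omega>. (ap * ?r) * Ip \<omega> + (am * ?r) * J \<omega>)"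
    by (rule has_wiener_integral_linear[OF Ip J])
  moreover have "(\<lambda>u. (ap * ?r) * (pos_powr (t - u) (H - 1/2) - pos_powr (- u) (H - 1/2))
      + (am * ?r) * (neg_powr (t - u) (H - 1/2) - neg_powr (- u) (H - 1/2))) = field_kernel ap am t H"
    by (simp add: fun_eq_iff field_kernel_def ma_kernel_def algebra_simps)
  ultimately have "has_wiener_integral M W (field_kernel ap am t H) (\<lambda>\<omega>. (ap * ?r) * Ip \<omega> + (am * ?r) * J \<omega>)" by simp
  then show ?thesis
    by (rule has_wiener_integral_cong_AE) (use AE meas r in \<open>auto simp: mult.assoc\<close>)
qed

lemma field_increment_gaussian:
  assumes B: "fractional_brownian_field_version M W ap am B" and H: "0 < H" "H < 1" "0 < H'" "H' < 1"
  shows "(\<integral>\<^sup>+u. ennreal ((field_kernel ap am t H u - field_kernel ap am s H' u)\<^sup>2) \<partial>lborel) < \<infinity>"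
    and "centred_gaussian M (\<lambda>\<omega>. B t H \<omega> - B s H' \<omega>)
      (enn2real (\<integral>\<^sup>+u. ennreal ((field_kernel ap am t H u - field_kernel ap am s H' u)\<^sup>2) \<partial>lborel))"
proof -
  have "has_wiener_integral M W (\<lambda>u. 1 * field_kernel ap am t H u + (-1) * field_kernel ap am s H' u) (\<lambda>\<omega>. 1 * B t H \<omega> + (-1) * B s H' \<omega>)"
    using field_has_wiener_integral[OF B] H by (intro has_wiener_integral_linear) auto
  then have "has_wiener_integral M W (\<lambda>u. field_kernel ap am t H u - field_kernel ap am s H' u) (\<lambda>\<omega>. B t H \<omega> - B s H' \<omega>)"
    by simp
  from has_wiener_integral_gaussian[OF this] show
    "(\<integral>\<^sup>+u. ennreal ((field_kernel ap am t H u - field_kernel ap am s H' u)\<^sup>2) \<partial>lborel) < \<infinity>"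
    "centred_gaussian M (\<lambda>\<omega>. B t H \<omega> - B s H' \<omega>)
      (enn2real (\<integral>\<^sup>+u. ennreal ((field_kernel ap am t H u - field_kernel ap am s H' u)\<^sup>2) \<partial>lborel))" .
qed

text \<open>The weighted point sets are deterministic, so only the kernel is averaged. The mean
  energies are bounded uniformly in \<open>n\<close>, and Fatou's lemma makes the liminf almost
  surely finite: infinitely many levels have energy below one random constant, as the mass
  distribution principle asks.\<close>

lemma graph_dim_ge_AE:
  fixes H :: "real \<Rightarrow> real"
  assumes B: "fractional_brownian_field_version M W ap am B"
    and cont: "AE \<omega> in M. continuous_on {p..q} (multifractional_brownian_motion B H \<omega>)"
    and H: "\<And>t. t \<in> {p..q} \<Longrightarrow> 0 < H t \<and> H t < 1" and pq: "q - p \<le> 1"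
    and h: "0 < h" "h < 1" and s: "1 < s'" "s' < 1 + h * (s - 1)" and c0: "0 < c0"
    and var: "\<And>t u. t \<in> {p..q} \<Longrightarrow> u \<in> {p..q} \<Longrightarrow> ennreal (c0 * (max (\<bar>t - u\<bar> powr h) \<bar>H t - H u\<bar>)\<^sup>2)
      \<le> (\<integral>\<^sup>+x. ennreal ((field_kernel ap am t (H t) x - field_kernel ap am u (H u) x)\<^sup>2) \<partial>lborel)"
    and out: "hausdorff_outer (parabolic_dist h) s (graph_on H {p..q}) = \<infinity>"
  shows "AE \<omega> in M. ereal s' \<le> hausdorff_dim dist (graph_on (multifractional_brownian_motion B H \<omega>) {p..q})"
proof -
  define X where "X = multifractional_brownian_motion B H"
  have Xm[measurable]: "(\<lambda>\<omega>. X \<omega> t) \<in> borel_measurable M" if "t \<in> {p..q}" for t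
    using B H[OF that] unfolding fractional_brownian_field_version_def X_def multifractional_brownian_motion_def by auto
  have s1: "1 < s"
  proof (rule ccontr)
    assume "\<not> 1 < s"
    then have "h * (s - 1) \<le> 0" using h by (simp add: mult_nonneg_nonpos)
    then show False using s by linarith
  qed
  have bH: "bounded (H ` {p..q})"
    unfolding bounded_iff by (intro exI[of _ 1]) (use H in \<open>force simp: abs_le_iff\<close>)
  define \<Psi> where "\<Psi> c n P \<mu> \<longleftrightarrow> finite P \<and> P \<subseteq> {p..q} \<and> (\<forall>u. 0 \<le> \<mu> u) \<and> c \<le> sum \<mu> P \<and>
     (\<forall>m\<le>n. \<forall>l. sum \<mu> {v\<in>P. graph_cell h H m v = l} \<le> cell_weight h s m)" for c n P \<mu>
  have "\<exists>c>0. \<forall>n. \<exists>P \<mu>. \<Psi> c n P \<mu>"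
    unfolding \<Psi>_def using s1 by (intro frostman_graph[OF h(1) _ out _ bH] bounded_closed_interval) simp
  then obtain c where c: "0 < c" and ex: "\<forall>n. \<exists>P \<mu>. \<Psi> c n P \<mu>" by blast
  obtain P where "\<forall>n. \<exists>\<mu>. \<Psi> c n (P n) \<mu>" using choice[OF ex] ..
  from choice[OF this] obtain \<mu> where \<Psi>: "\<forall>n. \<Psi> c n (P n) (\<mu> n)" ..
  have P: "\<And>n. finite (P n)" "\<And>n. P n \<subseteq> {p..q}" and \<mu>: "\<And>n u. 0 \<le> \<mu> n u" "\<And>n. c \<le> sum (\<mu> n) (P n)"
    and mass: "\<And>n m l. m \<le> n \<Longrightarrow> sum (\<mu> n) {v\<in>P n. graph_cell h H m v = l} \<le> cell_weight h s m"
    using \<Psi> unfolding \<Psi>_def by blast+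
  \<comment> \<open>The exponent for which the trivial kernel bound
    \<open>\<epsilon> n powr - s'\<close> has the order of the averaged kernel on the finest
    cells.\<close>
  define \<theta> where "\<theta> = (s' - 1 + h) / s'"
  have \<theta>: "0 < \<theta>" using s h by (simp add: \<theta>_def)
  define \<epsilon> where "\<epsilon> n = 2 powr - (real n * \<theta>)" for n :: nat
  have \<epsilon>0: "0 < \<epsilon> n" for n by (simp add: \<epsilon>_def)
  have \<epsilon>lim: "\<epsilon> \<longlonglongrightarrow> 0"
    unfolding \<epsilon>_def[abs_def] using \<theta> by real_asymp
  \<comment> \<open>Truncation at \<open>\<epsilon> n\<close> bounds the kernel by a constant, on
    the diagonal too, so all its means are finite.\<close>
  define \<kappa> where "\<kappa> n u v \<omega> = max (max \<bar>u - v\<bar> (\<epsilon> n)) \<bar>X \<omega> u - X \<omega> v\<bar> powr - s'" for n u v \<omega>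
  define K where "K n u v = enn2real (\<integral>\<^sup>+\<omega>. ennreal (\<kappa> n u v \<omega>) \<partial>M)" for n u v
  define A where "A = max 1 ((2 + 2 / (s' - 1)) / sqrt c0)"
  have \<kappa>m: "\<kappa> n u v \<in> borel_measurable M" if "u \<in> P n" "v \<in> P n" for n u v
  proof -
    have [measurable]: "(\<lambda>\<omega>. X \<omega> u) \<in> borel_measurable M" "(\<lambda>\<omega>. X \<omega> v) \<in> borel_measurable M"
      using P(2)[of n] that Xm by auto
    show ?thesis unfolding \<kappa>_def[abs_def] by measurable
  qed
  have E1: "(\<integral>\<^sup>+\<omega>. ennreal (\<kappa> n u v \<omega>) \<partial>M) \<le> ennreal (\<epsilon> n powr - s')" for n u v
  proof -
    have "(\<integral>\<^sup>+\<omega>. ennreal (\<kappa> n u v \<omega>) \<partial>M) \<le> (\<integral>\<^sup>+\<omega>. ennreal (\<epsilon> n powr - s') \<partial>M)"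
      unfolding \<kappa>_def using s \<epsilon>0 by (intro nn_integral_mono ennreal_leI powr_mono2') (auto simp: le_max_iff_disj)
    then show ?thesis by (simp add: emeasure_space_1)
  qed
  have Kfin: "(\<integral>\<^sup>+\<omega>. ennreal (\<kappa> n u v \<omega>) \<partial>M) = ennreal (K n u v)" for n u v
    using le_less_trans[OF E1[of n u v], of top] by (simp add: K_def)
  have K1: "K n u v \<le> \<epsilon> n powr - s'" for n u v
    using E1[of n u v] unfolding Kfin by (simp add: ennreal_le_iff)
  have K2: "K n u v \<le> A * max \<bar>u - v\<bar> (\<epsilon> n) powr (1 - s') / max (\<bar>u - v\<bar> powr h) \<bar>H u - H v\<bar>"
    if uv: "u \<in> {p..q}" "v \<in> {p..q}" "u \<noteq> v" for n u v
  proof -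
    define V where "V = (\<integral>\<^sup>+x. ennreal ((field_kernel ap am u (H u) x - field_kernel ap am v (H v) x)\<^sup>2) \<partial>lborel)"
    define g where "g = max (\<bar>u - v\<bar> powr h) \<bar>H u - H v\<bar>"
    have g: "0 < g" using uv by (simp add: g_def less_max_iff_disj)
    have G: "centred_gaussian M (\<lambda>\<omega>. X \<omega> u - X \<omega> v) (enn2real V)" and Vf: "V < \<infinity>"
      using field_increment_gaussian[OF B, of "H u" "H v" u v] H[OF uv(1)] H[OF uv(2)]
      unfolding V_def X_def multifractional_brownian_motion_def by auto
    have "ennreal (c0 * g\<^sup>2) \<le> ennreal (enn2real V)" using var[OF uv(1,2)] Vf by (simp add: V_def g_def)
    then have "c0 * g\<^sup>2 \<le> enn2real V" by (simp add: ennreal_le_iff)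
    then have "(sqrt c0 * g)\<^sup>2 \<le> enn2real V" using c0 by (simp add: power_mult_distrib)
    then have "ennreal (K n u v) \<le> ennreal ((2 + 2 / (s' - 1)) * max \<bar>u - v\<bar> (\<epsilon> n) powr (1 - s') / (sqrt c0 * g))"
      unfolding Kfin[symmetric] \<kappa>_def using c0 g s(1) \<epsilon>0[of n]
      by (intro gaussian_kernel_expectation_le[OF G]) (auto simp: less_max_iff_disj)
    then have "K n u v \<le> (2 + 2 / (s' - 1)) * max \<bar>u - v\<bar> (\<epsilon> n) powr (1 - s') / (sqrt c0 * g)"
      using s(1) c0 g by (subst (asm) ennreal_le_iff) auto
    also have "\<dots> = (2 + 2 / (s' - 1)) / sqrt c0 * (max \<bar>u - v\<bar> (\<epsilon> n) powr (1 - s') / g)" by simp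
    also have "\<dots> \<le> A * (max \<bar>u - v\<bar> (\<epsilon> n) powr (1 - s') / g)"
      using g by (intro mult_right_mono) (auto simp: A_def)
    finally show ?thesis by (simp add: g_def)
  qed
  define S where "S n \<omega> = (\<Sum>u\<in>P n. \<Sum>v\<in>P n. \<mu> n u * \<mu> n v * \<kappa> n u v \<omega>)" for n \<omega>
  have Sm[measurable]: "S n \<in> borel_measurable M" for n
    unfolding S_def[abs_def] using \<kappa>m by (intro borel_measurable_sum borel_measurable_times) auto
  define D where "D = energy_bound h s s' A"
  have ES: "(\<integral>\<^sup>+\<omega>. ennreal (S n \<omega>) \<partial>M) \<le> ennreal D" for n
  proof -
    have k0: "0 \<le> \<mu> n u * \<mu> n v * \<kappa> n u v \<omega>" for u v \<omega> using \<mu>(1) by (simp add: \<kappa>_def)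
    have K0: "0 \<le> \<mu> n u * \<mu> n v * K n u v" for u v using \<mu>(1) by (simp add: K_def)
    have "(\<integral>\<^sup>+\<omega>. ennreal (S n \<omega>) \<partial>M) = (\<integral>\<^sup>+\<omega>. (\<Sum>u\<in>P n. \<Sum>v\<in>P n. ennreal (\<mu> n u * \<mu> n v * \<kappa> n u v \<omega>)) \<partial>M)"
      unfolding S_def using k0 by (simp add: sum_ennreal sum_nonneg)
    also have "\<dots> = (\<Sum>u\<in>P n. \<Sum>v\<in>P n. \<integral>\<^sup>+\<omega>. ennreal (\<mu> n u * \<mu> n v * \<kappa> n u v \<omega>) \<partial>M)"
      using \<kappa>m by (simp add: nn_integral_sum)
    also have "\<dots> = (\<Sum>u\<in>P n. \<Sum>v\<in>P n. ennreal (\<mu> n u * \<mu> n v * K n u v))"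
    proof (intro sum.cong refl)
      fix u v assume uv: "u \<in> P n" "v \<in> P n"
      have "(\<integral>\<^sup>+\<omega>. ennreal (\<mu> n u * \<mu> n v * \<kappa> n u v \<omega>) \<partial>M) = ennreal (\<mu> n u * \<mu> n v) * (\<integral>\<^sup>+\<omega>. ennreal (\<kappa> n u v \<omega>) \<partial>M)"
        using \<kappa>m[OF uv] \<mu>(1) by (subst nn_integral_cmult[symmetric]) (auto simp: ennreal_mult')
      then show "(\<integral>\<^sup>+\<omega>. ennreal (\<mu> n u * \<mu> n v * \<kappa> n u v \<omega>) \<partial>M) = ennreal (\<mu> n u * \<mu> n v * K n u v)"
        using \<mu>(1) by (simp add: Kfin ennreal_mult'[symmetric])
    qed
    also have "\<dots> = ennreal (\<Sum>u\<in>P n. \<Sum>v\<in>P n. \<mu> n u * \<mu> n v * K n u v)"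
      using K0 by (simp add: sum_ennreal sum_nonneg)
    also have "\<dots> \<le> ennreal D"
    proof (rule ennreal_leI)
      show "(\<Sum>u\<in>P n. \<Sum>v\<in>P n. \<mu> n u * \<mu> n v * K n u v) \<le> D"
        unfolding D_def
      proof (rule energy_le[where n = n and \<epsilon> = "\<epsilon> n" and H = H])
        fix u v assume uv: "u \<in> P n" "v \<in> P n"
        then have uv': "u \<in> {p..q}" "v \<in> {p..q}" using P(2)[of n] by auto
        show "\<bar>u - v\<bar> \<le> 1 \<and> \<bar>H u - H v\<bar> \<le> 1"
          using uv' pq H[OF uv'(1)] H[OF uv'(2)] by (auto simp: abs_le_iff)
        show "K n u v \<le> \<epsilon> n powr - s'" by (rule K1)
        show "K n u v \<le> A * max \<bar>u - v\<bar> (\<epsilon> n) powr (1 - s') / max (\<bar>u - v\<bar> powr h) \<bar>H u - H v\<bar>" if "u \<noteq> v"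
          using K2[OF uv' that] .
      qed (use P \<mu> mass h s in \<open>auto simp: A_def \<epsilon>_def \<theta>_def\<close>)
    qed
    finally show ?thesis .
  qed
  have "(\<integral>\<^sup>+\<omega>. liminf (\<lambda>n. ennreal (S n \<omega>)) \<partial>M) \<le> liminf (\<lambda>n. \<integral>\<^sup>+\<omega>. ennreal (S n \<omega>) \<partial>M)"
    by (intro nn_integral_liminf) auto
  also have "\<dots> \<le> ennreal D"
    using ES by (intro Liminf_le) auto
  finally have "(\<integral>\<^sup>+\<omega>. liminf (\<lambda>n. ennreal (S n \<omega>)) \<partial>M) \<noteq> \<infinity>" by (auto simp: top_unique)
  then have "AE \<omega> in M. liminf (\<lambda>n. ennreal (S n \<omega>)) \<noteq> \<infinity>"
    by (intro nn_integral_noteq_infinite) auto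
  with cont show ?thesis
  proof eventually_elim
    case (elim \<omega>)
    obtain R where R: "liminf (\<lambda>n. ennreal (S n \<omega>)) = ennreal R" "0 \<le> R"
      using elim(2) by (cases "liminf (\<lambda>n. ennreal (S n \<omega>))") auto
    have "\<exists>\<^sub>F n in sequentially. S n \<omega> \<le> R + 1"
    proof (rule ccontr)
      assume "\<not> ?thesis"
      then have "\<forall>\<^sub>F n in sequentially. R + 1 < S n \<omega>" by (simp add: not_frequently not_le)
      then have "\<forall>\<^sub>F n in sequentially. ennreal (R + 1) \<le> ennreal (S n \<omega>)"
        by eventually_elim (intro ennreal_leI less_imp_le)
      then have "ennreal (R + 1) \<le> ennreal R" unfolding R(1)[symmetric] by (rule Liminf_bounded)
      then show False using R(2) by (simp add: ennreal_le_iff)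
    qed
    then show ?case
      using elim(1) s c P \<mu> unfolding S_def \<kappa>_def X_def
      by (intro hausdorff_dim_graph_ge_energy[where c = c and P = P and \<mu> = \<mu> and \<epsilon> = \<epsilon> and K = "R + 1"] \<epsilon>lim \<epsilon>0) auto
  qed
qed

end

section \<open>Hoelder continuity in time, locally uniformly in the Hurst parameter\<close>

text \<open>Chaining: \<open>f u\<close> is reached from the dyadic point \<open>D n u\<close> by
  steps of levels above \<open>n\<close>, and at the level matching \<open>\<bar>u - v\<bar>\<close>
  the two dyadic points are equal or adjacent. In the constant, \<open>1\<close> is the adjacent
  step, \<open>2 / (1 - 2 powr - g)\<close> the two tails, and \<open>2 powr g\<close> the gap
  between \<open>1 / 2 ^ n\<close> and the distance.\<close>

lemma dyadic_hoelder:
  fixes f :: "real \<Rightarrow> real" and N :: nat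
  assumes cont: "continuous_on {- real N..real N} f" and g: "0 < g" and K: "0 \<le> K"
    and inc: "\<And>n (k::int). - real N \<le> real_of_int k / 2 ^ n \<Longrightarrow> (real_of_int k + 1) / 2 ^ n \<le> real N \<Longrightarrow>
       \<bar>f ((real_of_int k + 1) / 2 ^ n) - f (real_of_int k / 2 ^ n)\<bar> \<le> K * 2 powr - (g * real n)"
    and uv: "u \<in> {- real N..real N}" "v \<in> {- real N..real N}" "\<bar>u - v\<bar> \<le> 1"
  shows "\<bar>f u - f v\<bar> \<le> K * (1 + 2 / (1 - 2 powr - g)) * 2 powr g * \<bar>u - v\<bar> powr g"
proof -
  define r where "r = 2 powr - g"
  have r: "0 < r" "r < 1" using g by (auto simp: r_def powr_less_one)
  have rn: "2 powr - (g * real n) = r ^ n" for n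
    using r by (simp add: r_def powr_realpow[symmetric] powr_powr)
  define D where "D n x = \<lfloor>2 ^ n * x\<rfloor> / 2 ^ n" for n and x :: real
  have Dle: "D n x \<le> x" for n x by (simp add: D_def field_simps)
  have Dge: "x - 1 / 2 ^ n \<le> D n x" for n x
  proof -
    have "2 ^ n * x - 1 \<le> \<lfloor>2 ^ n * x\<rfloor>" by linarith
    then have "(2 ^ n * x - 1) / 2 ^ n \<le> \<lfloor>2 ^ n * x\<rfloor> / 2 ^ n" by (intro divide_right_mono) auto
    then show ?thesis by (simp add: D_def diff_divide_distrib)
  qed
  \<comment> \<open>Rounding down stays inside the interval because its left end is an integer,
    hence dyadic at every level.\<close>
  have DN: "D n x \<in> {- real N..real N}" if "x \<in> {- real N..real N}" for n x
  proof -
    have "2 ^ n * (- real N) \<le> 2 ^ n * x" using that by (intro mult_left_mono) auto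
    then have "of_int (- (int N * 2 ^ n)) \<le> 2 ^ n * x" by (simp add: mult.commute)
    then have "- (int N * 2 ^ n) \<le> \<lfloor>2 ^ n * x\<rfloor>" by (simp only: le_floor_iff)
    then have "real_of_int (- (int N * 2 ^ n)) \<le> real_of_int \<lfloor>2 ^ n * x\<rfloor>" by (simp only: of_int_le_iff)
    then have "- real N \<le> D n x" by (simp add: D_def field_simps)
    then show ?thesis using Dle[of n x] that by auto
  qed
  have step: "\<bar>f (D (Suc n) x) - f (D n x)\<bar> \<le> K * r ^ Suc n" if x: "x \<in> {- real N..real N}" for n x
  proof -
    define k where "k = \<lfloor>2 ^ n * x\<rfloor>"
    have Dk: "D n x = real_of_int (2 * k) / 2 ^ Suc n" by (simp add: D_def k_def)
    \<comment> \<open>Refining by one level either keeps the dyadic point or moves it by one step of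
      the finer level.\<close>
    have "\<lfloor>2 ^ Suc n * x\<rfloor> = 2 * k \<or> \<lfloor>2 ^ Suc n * x\<rfloor> = 2 * k + 1"
    proof -
      have "2 ^ Suc n * x = 2 * (2 ^ n * x)" by simp
      then show ?thesis unfolding k_def by linarith
    qed
    then show ?thesis
    proof
      assume "\<lfloor>2 ^ Suc n * x\<rfloor> = 2 * k"
      then have "D (Suc n) x = D n x" unfolding Dk by (simp only: D_def)
      then show ?thesis using K r by simp
    next
      assume a: "\<lfloor>2 ^ Suc n * x\<rfloor> = 2 * k + 1"
      have Ds: "D (Suc n) x = (real_of_int (2 * k) + 1) / 2 ^ Suc n" unfolding D_def a by simp
      have "\<bar>f ((real_of_int (2 * k) + 1) / 2 ^ Suc n) - f (real_of_int (2 * k) / 2 ^ Suc n)\<bar> \<le> K * 2 powr - (g * real (Suc n))"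
        using DN[OF x, of n] DN[OF x, of "Suc n"] by (intro inc) (simp_all only: Dk Ds atLeastAtMost_iff)
      then show ?thesis unfolding Ds Dk rn .
    qed
  qed
  have tail: "\<bar>f (D (n + j) x) - f (D n x)\<bar> \<le> K * r ^ n * (r * (1 - r ^ j) / (1 - r))" if x: "x \<in> {- real N..real N}" for n j x
  proof (induction j)
    case (Suc j)
    have "\<bar>f (D (n + Suc j) x) - f (D n x)\<bar> \<le> \<bar>f (D (Suc (n + j)) x) - f (D (n + j) x)\<bar> + \<bar>f (D (n + j) x) - f (D n x)\<bar>"
      by simp
    also have "\<dots> \<le> K * r ^ Suc (n + j) + K * r ^ n * (r * (1 - r ^ j) / (1 - r))"
      by (intro add_mono step x Suc.IH)
    also have "\<dots> = K * r ^ n * (r * r ^ j + r * (1 - r ^ j) / (1 - r))" by (simp add: power_add algebra_simps)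
    also have "r * r ^ j + r * (1 - r ^ j) / (1 - r) = r * (1 - r ^ Suc j) / (1 - r)" using r by (simp add: field_simps)
    finally show ?case .
  qed simp
  have lim: "\<bar>f x - f (D n x)\<bar> \<le> K * r ^ n * (1 / (1 - r))" if x: "x \<in> {- real N..real N}" for n x
  proof (rule LIMSEQ_le_const2)
    have "(\<lambda>j. D (n + j) x) \<longlonglongrightarrow> x"
    proof (rule tendsto_sandwich[OF _ _ _ tendsto_const])
      show "\<forall>\<^sub>F j in sequentially. D (n + j) x \<le> x" using Dle by simp
      show "\<forall>\<^sub>F j in sequentially. x - 1 / 2 ^ (n + j) \<le> D (n + j) x" using Dge by simp
      have "(\<lambda>j. x - (1/2) ^ (n + j)) \<longlonglongrightarrow> x - 0"
        by (intro tendsto_diff tendsto_const LIMSEQ_ignore_initial_segment[where k = n, unfolded add.commute[of _ n]] LIMSEQ_realpow_zero) auto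
      then show "(\<lambda>j. x - 1 / 2 ^ (n + j)) \<longlonglongrightarrow> x" by (simp add: power_one_over)
    qed
    then have "(\<lambda>j. f (D (n + j) x)) \<longlonglongrightarrow> f x"
      using DN[OF x] x by (intro continuous_on_tendsto_compose[OF cont]) auto
    then show "(\<lambda>j. \<bar>f (D (n + j) x) - f (D n x)\<bar>) \<longlonglongrightarrow> \<bar>f x - f (D n x)\<bar>"
      by (intro tendsto_rabs tendsto_diff tendsto_const)
    have "r * (1 - r ^ j) / (1 - r) \<le> 1 / (1 - r)" for j
    proof -
      have "r * (1 - r ^ j) \<le> 1 * 1" using r by (intro mult_mono) (auto simp: power_le_one)
      then show ?thesis using r by (intro divide_right_mono) auto
    qed
    then have "K * r ^ n * (r * (1 - r ^ j) / (1 - r)) \<le> K * r ^ n * (1 / (1 - r))" for j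
      using K r by (intro mult_left_mono) auto
    then show "\<exists>J. \<forall>j\<ge>J. \<bar>f (D (n + j) x) - f (D n x)\<bar> \<le> K * r ^ n * (1 / (1 - r))"
      using tail[OF x] order_trans by blast
  qed
  have main: "\<bar>f u - f v\<bar> \<le> K * (1 + 2 / (1 - r)) * 2 powr g * \<bar>u - v\<bar> powr g"
    if uv: "u \<in> {- real N..real N}" "v \<in> {- real N..real N}" "\<bar>u - v\<bar> \<le> 1" "u < v" for u v
  proof -
    define d where "d = v - u"
    have d: "0 < d" "d \<le> 1" using uv by (auto simp: d_def)
    have "\<exists>n. 1 / 2 ^ Suc n < d"
    proof -
      obtain n where "(1/2) ^ n < d" using real_arch_pow_inv[OF d(1), of "1/2"] by auto
      moreover have "1 / 2 ^ Suc n \<le> (1/2 :: real) ^ n" by (simp add: power_one_over field_simps)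
      ultimately show ?thesis by (intro exI[of _ n]) linarith
    qed
    \<comment> \<open>The least such \<open>n\<close> brackets the distance,
      \<open>1 / 2 ^ Suc n < d \<le> 1 / 2 ^ n\<close>; for \<open>n = 0\<close> the upper bound is
      \<open>d \<le> 1\<close>.\<close>
    then obtain n where n: "1 / 2 ^ Suc n < d" and least: "\<And>m. m < n \<Longrightarrow> \<not> 1 / 2 ^ Suc m < d"
      using exists_least_iff[of "\<lambda>n. 1 / 2 ^ Suc n < d"] by auto
    have dn: "d \<le> 1 / 2 ^ n" using least[of "n - 1"] d by (cases n) (auto simp: not_less)
    define k l where "k = \<lfloor>2 ^ n * u\<rfloor>" and "l = \<lfloor>2 ^ n * v\<rfloor>"
    have "2 ^ n * d \<le> 1" using dn by (simp add: field_simps)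
    then have a: "2 ^ n * v \<le> 2 ^ n * u + 1" by (simp add: d_def algebra_simps)
    have b: "2 ^ n * u \<le> 2 ^ n * v" using uv(4) by simp
    have "l = k \<or> l = k + 1" using a b unfolding k_def l_def by linarith
    then have adj: "\<bar>f (D n v) - f (D n u)\<bar> \<le> K * r ^ n"
    proof
      assume "l = k"
      then have "D n v = D n u" by (simp add: D_def k_def l_def)
      then show ?thesis using K r by simp
    next
      assume lk: "l = k + 1"
      have Du: "D n u = real_of_int k / 2 ^ n" by (simp add: D_def k_def)
      have Dv: "D n v = (real_of_int k + 1) / 2 ^ n" using lk by (simp add: D_def l_def)
      have "\<bar>f ((real_of_int k + 1) / 2 ^ n) - f (real_of_int k / 2 ^ n)\<bar> \<le> K * 2 powr - (g * real n)"
        using DN[OF uv(1), of n] DN[OF uv(2), of n] by (intro inc) (simp_all only: Du Dv atLeastAtMost_iff)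
      then show ?thesis unfolding Du Dv rn .
    qed
    have "\<bar>f u - f v\<bar> \<le> \<bar>f u - f (D n u)\<bar> + \<bar>f (D n v) - f (D n u)\<bar> + \<bar>f v - f (D n v)\<bar>" by linarith
    also have "\<dots> \<le> K * r ^ n * (1 / (1 - r)) + K * r ^ n + K * r ^ n * (1 / (1 - r))"
      by (intro add_mono lim uv adj)
    also have "\<dots> = K * (1 + 2 / (1 - r)) * r ^ n" by (simp add: algebra_simps)
    also have "\<dots> \<le> K * (1 + 2 / (1 - r)) * (2 powr g * d powr g)"
    proof (intro mult_left_mono mult_nonneg_nonneg K)
      have "1 / 2 ^ n \<le> 2 * d" using n by (simp add: field_simps)
      then have "(1 / 2 ^ n) powr g \<le> (2 * d) powr g" using g by (intro powr_mono2) auto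
      moreover have "(1 / 2 ^ n :: real) powr g = r ^ n"
        by (simp add: rn[symmetric] powr_realpow[symmetric] powr_minus_divide[symmetric] powr_powr mult.commute)
      ultimately show "r ^ n \<le> 2 powr g * d powr g" using d by (simp add: powr_mult)
    qed (use r in auto)
    finally show ?thesis using uv(4) by (simp add: d_def mult.assoc abs_minus_commute)
  qed
  show ?thesis
  proof (cases u v rule: linorder_cases)
    case less
    then show ?thesis using main[OF uv] by (simp add: r_def)
  next
    case greater
    then show ?thesis using main[OF uv(2,1)] uv(3) by (simp add: r_def abs_minus_commute)
  qed simp
qed

section \<open>Regularity in the Hurst parameter\<close>

lemma jointly_smooth_continuous:
  assumes "jointly_smooth_in_H b" shows "continuous_on (UNIV \<times> {0<..<1}) (\<lambda>(t, H). b t H)"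
proof -
  obtain D where D: "\<And>t H. H \<in> {0<..<1} \<Longrightarrow> D (0::nat) t H = b t H"
      "\<And>n. continuous_on (UNIV \<times> {0<..<1}) (\<lambda>(t, H). D n t H)"
    using assms unfolding jointly_smooth_in_H_def by blast
  show ?thesis using D(1) by (intro continuous_on_cong[THEN iffD1, OF refl _ D(2)[of 0]]) auto
qed

lemma jointly_smooth_continuous_comp:
  assumes b: "jointly_smooth_in_H b" and H: "continuous_on S H" "\<And>t. t \<in> S \<Longrightarrow> 0 < H t \<and> H t < 1"
  shows "continuous_on S (\<lambda>t. b t (H t))"
proof -
  have "continuous_on S (\<lambda>t. (\<lambda>(t, H). b t H) (t, H t))"
    by (intro continuous_on_compose2[OF jointly_smooth_continuous[OF b]] continuous_intros H(1)) (use H(2) in auto)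
  then show ?thesis by simp
qed

text \<open>The first derivative in \<open>H\<close> is jointly continuous, hence bounded on a
  compact rectangle; so one constant serves all times up to \<open>R\<close>.\<close>

lemma jointly_smooth_lipschitz:
  assumes b: "jointly_smooth_in_H b" and h: "0 < h1" "h2 < 1"
  shows "\<exists>L\<ge>0. \<forall>t H H'. \<bar>t\<bar> \<le> R \<longrightarrow> h1 \<le> H \<longrightarrow> H \<le> h2 \<longrightarrow> h1 \<le> H' \<longrightarrow> H' \<le> h2 \<longrightarrow> \<bar>b t H - b t H'\<bar> \<le> L * \<bar>H - H'\<bar>"
proof -
  obtain D where D: "\<And>t H. H \<in> {0<..<1} \<Longrightarrow> D (0::nat) t H = b t H"
      "\<And>n t H. H \<in> {0<..<1} \<Longrightarrow> (D n t has_real_derivative D (Suc n) t H) (at H)"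
      "\<And>n. continuous_on (UNIV \<times> {0<..<1}) (\<lambda>(t, H). D n t H)"
    using b unfolding jointly_smooth_in_H_def by blast
  have "continuous_on ({-R..R} \<times> {h1..h2}) (\<lambda>(t, H). D 1 t H)"
    by (rule continuous_on_subset[OF D(3)]) (use h in auto)
  then have "compact ((\<lambda>(t, H). D 1 t H) ` ({-R..R} \<times> {h1..h2}))"
    by (rule compact_continuous_image) (intro compact_Times compact_Icc)
  then have "bounded ((\<lambda>(t, H). D 1 t H) ` ({-R..R} \<times> {h1..h2}))" by (rule compact_imp_bounded)
  then obtain L where L': "\<forall>y\<in>(\<lambda>(t, H). D 1 t H) ` ({-R..R} \<times> {h1..h2}). norm y \<le> L"
    unfolding bounded_iff by (elim exE)
  have L: "\<bar>D 1 t H\<bar> \<le> L" if "\<bar>t\<bar> \<le> R" "h1 \<le> H" "H \<le> h2" for t H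
    using bspec[OF L', of "D 1 t H"] that by (force simp: abs_le_iff)
  have le: "\<bar>b t H - b t H'\<bar> \<le> \<bar>L\<bar> * \<bar>H - H'\<bar>" if t: "\<bar>t\<bar> \<le> R" and H: "h1 \<le> H" "H < H'" "H' \<le> h2" for t H H'
  proof -
    have "\<exists>z>H. z < H' \<and> D 0 t H' - D 0 t H = (H' - H) * D 1 t z"
      using H h D(2)[of _ 0 t] by (intro MVT2) auto
    then obtain z where z: "H < z" "z < H'" "D 0 t H' - D 0 t H = (H' - H) * D 1 t z" by blast
    have "\<bar>D 1 t z\<bar> \<le> \<bar>L\<bar>" using L[OF t, of z] z H by linarith
    then have "\<bar>H' - H\<bar> * \<bar>D 1 t z\<bar> \<le> \<bar>H' - H\<bar> * \<bar>L\<bar>" by (intro mult_left_mono) auto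
    moreover have "b t H' - b t H = (H' - H) * D 1 t z" using z D(1) H h by simp
    ultimately show ?thesis by (simp add: abs_mult abs_minus_commute mult.commute)
  qed
  have "\<bar>b t H - b t H'\<bar> \<le> \<bar>L\<bar> * \<bar>H - H'\<bar>"
    if "\<bar>t\<bar> \<le> R" "h1 \<le> H" "H \<le> h2" "h1 \<le> H'" "H' \<le> h2" for t H H'
    using le[of t H H'] le[of t H' H] that by (cases H H' rule: linorder_cases) (auto simp: abs_minus_commute)
  then show ?thesis by (intro exI[of _ "\<bar>L\<bar>"]) auto
qed

lemma abs_le_of_even_power_le:
  fixes x :: real
  assumes "x ^ (2 * k) \<le> R" "0 < k" "0 \<le> R" shows "\<bar>x\<bar> \<le> 1 + R"
proof (cases "\<bar>x\<bar> \<le> 1")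
  case False
  then have "\<bar>x\<bar> \<le> \<bar>x\<bar> ^ (2 * k)" using assms by (intro self_le_power) auto
  also have "\<dots> = x ^ (2 * k)" by (simp add: power_mult)
  finally show ?thesis using assms by linarith
qed (use assms in auto)

section \<open>Kolmogorov's criterion for the field\<close>

context white_noise_space
begin

text \<open>At level \<open>n\<close> the Hurst range carries a grid of mesh proportional to
  \<open>1 / 2 ^ n\<close>, like the time axis. The union over both grids is paid for by a high
  moment, and all increments are controlled at once by one random series \<open>T\<close> with
  finite mean.\<close>

lemma field_dyadic_increments_AE:
  assumes B: "fractional_brownian_field_version M W ap am B" and h: "0 < h1" "h1 < h2" "h2 < 1" and g: "0 < g" "g < h1"
  shows "AE \<omega> in M. \<exists>R\<ge>0. \<forall>n. \<forall>i\<in>{- (int N * 2 ^ n)..<int N * 2 ^ n}. \<forall>j\<le>2 ^ n.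
     \<bar>B ((real_of_int i + 1) / 2 ^ n) (h1 + (h2 - h1) * real j / 2 ^ n) \<omega> - B (real_of_int i / 2 ^ n) (h1 + (h2 - h1) * real j / 2 ^ n) \<omega>\<bar>
       \<le> R * 2 powr - (g * real n)"
proof -
  have h12: "h1 \<le> h2" using h by simp
  obtain C where C: "0 \<le> C" and CB: "\<And>H t s. h1 \<le> H \<Longrightarrow> H \<le> h2 \<Longrightarrow> \<bar>t - s\<bar> \<le> 1 \<Longrightarrow>
    (\<integral>\<^sup>+u. ennreal ((field_kernel ap am t H u - field_kernel ap am s H u)\<^sup>2) \<partial>lborel) \<le> ennreal (C * \<bar>t - s\<bar> powr (2 * h1))"
    using field_kernel_increment_upper[OF h(1) h12 h(3), of ap am] by blast
  \<comment> \<open>Large enough that the rescaled moments of order \<open>2 * k\<close> decay like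
    \<open>(1/16) ^ n\<close>. Level \<open>n\<close> has of the order of \<open>4 ^ n\<close> pairs
    of grid points, so the sum over all levels converges.\<close>
  obtain k :: nat where "2 / (h1 - g) < real k" using reals_Archimedean2 by blast
  then have k: "2 \<le> real k * (h1 - g)" using g by (simp add: field_simps)
  then have k0: "0 < k" by (cases k) auto
  obtain m where m: "0 \<le> m" and mB: "\<And>Y v. centred_gaussian M Y v \<Longrightarrow> 0 \<le> v \<Longrightarrow> (\<integral>\<^sup>+\<omega>. ennreal (Y \<omega> ^ (2 * k)) \<partial>M) = ennreal (v ^ k * m)"
    using gaussian_even_moment[of M k] by blast
  define hj where "hj n j = h1 + (h2 - h1) * real j / 2 ^ n" for n j :: nat
  have hj: "h1 \<le> hj n j" "hj n j \<le> h2" if "j \<le> 2 ^ n" for n j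
  proof -
    show "h1 \<le> hj n j" using h by (simp add: hj_def)
    have "real j \<le> real (2 ^ n)" using that by (simp only: of_nat_le_iff)
    then have "(h2 - h1) * (real j / 2 ^ n) \<le> (h2 - h1) * 1" using h by (intro mult_left_mono) auto
    then show "hj n j \<le> h2" by (simp add: hj_def)
  qed
  define Z where "Z n i j \<omega> = B ((real_of_int i + 1) / 2 ^ n) (hj n j) \<omega> - B (real_of_int i / 2 ^ n) (hj n j) \<omega>" for n j :: nat and i :: int and \<omega>
  have Zm: "Z n i j \<in> borel_measurable M" if "j \<le> 2 ^ n" for n i j
    using field_increment_gaussian(2)[OF B, of "hj n j" "hj n j"] hj[OF that] h
    unfolding Z_def[abs_def] centred_gaussian_def by auto
  define c where "c n = 2 powr (g * real n)" for n :: nat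
  define I where "I n = {- (int N * 2 ^ n)..<int N * 2 ^ n}" for n :: nat
  define T where "T \<omega> = (\<Sum>n. \<Sum>i\<in>I n. \<Sum>j\<le>2 ^ n. ennreal ((c n * Z n i j \<omega>) ^ (2 * k)))" for \<omega>
  define Q where "Q = C ^ k * m"
  have Q: "0 \<le> Q" using C m by (simp add: Q_def)
  have EZ: "(\<integral>\<^sup>+\<omega>. ennreal ((c n * Z n i j \<omega>) ^ (2 * k)) \<partial>M) \<le> ennreal (Q * (1/16) ^ n)" if j: "j \<le> 2 ^ n" for n i j
  proof -
    define V where "V = (\<integral>\<^sup>+u. ennreal ((field_kernel ap am ((real_of_int i + 1) / 2 ^ n) (hj n j) u - field_kernel ap am (real_of_int i / 2 ^ n) (hj n j) u)\<^sup>2) \<partial>lborel)"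
    have G: "centred_gaussian M (Z n i j) (enn2real V)"
      using field_increment_gaussian(2)[OF B, of "hj n j" "hj n j"] hj[OF j] h unfolding Z_def V_def by auto
    have dt: "\<bar>(real_of_int i + 1) / 2 ^ n - real_of_int i / 2 ^ n\<bar> = 1 / (2::real) ^ n" by (simp add: diff_divide_distrib[symmetric])
    have "V \<le> ennreal (C * (1 / 2 ^ n) powr (2 * h1))"
      using CB[OF hj[OF j], of "(real_of_int i + 1) / 2 ^ n" "real_of_int i / 2 ^ n"] unfolding dt V_def by simp
    then have "enn2real V \<le> C * (1 / 2 ^ n) powr (2 * h1)" using C by (simp add: enn2real_leI)
    also have "(1 / 2 ^ n) powr (2 * h1) = 2 powr - (2 * h1 * real n)"
      by (simp add: powr_realpow[symmetric] powr_minus_divide[symmetric] powr_powr mult_ac)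
    finally have V: "enn2real V \<le> C * 2 powr - (2 * h1 * real n)" .
    have "(\<integral>\<^sup>+\<omega>. ennreal ((c n * Z n i j \<omega>) ^ (2 * k)) \<partial>M) = (\<integral>\<^sup>+\<omega>. ennreal (c n ^ (2 * k)) * ennreal (Z n i j \<omega> ^ (2 * k)) \<partial>M)"
      by (simp add: power_mult_distrib ennreal_mult power_mult)
    also have "\<dots> = ennreal (c n ^ (2 * k)) * (\<integral>\<^sup>+\<omega>. ennreal (Z n i j \<omega> ^ (2 * k)) \<partial>M)"
      using Zm[OF j] by (intro nn_integral_cmult) auto
    also have "\<dots> = ennreal (c n ^ (2 * k)) * ennreal (enn2real V ^ k * m)" by (simp add: mB[OF G])
    also have "\<dots> = ennreal (c n ^ (2 * k) * (enn2real V ^ k * m))" using m by (intro ennreal_mult[symmetric]) (auto simp: c_def)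
    also have "\<dots> \<le> ennreal (Q * (1/16) ^ n)"
    proof (rule ennreal_leI)
      have "enn2real V ^ k \<le> (C * 2 powr - (2 * h1 * real n)) ^ k" by (intro power_mono V) auto
      then have "c n ^ (2 * k) * (enn2real V ^ k * m) \<le> c n ^ (2 * k) * ((C * 2 powr - (2 * h1 * real n)) ^ k * m)"
        using m by (intro mult_left_mono mult_right_mono) (auto simp: c_def)
      also have "\<dots> = Q * ((c n)\<^sup>2 * 2 powr - (2 * h1 * real n)) ^ k"
      proof -
        have "c n ^ (2 * k) = ((c n)\<^sup>2) ^ k" by (rule power_mult)
        then show ?thesis unfolding Q_def power_mult_distrib by (simp only: mult_ac)
      qed
      also have "(c n)\<^sup>2 * 2 powr - (2 * h1 * real n) = 2 powr - (2 * (h1 - g) * real n)"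
        by (simp add: c_def powr_square powr_add[symmetric] algebra_simps)
      also have "(2 powr - (2 * (h1 - g) * real n)) ^ k = 2 powr - (2 * (real k * (h1 - g)) * real n)"
        by (simp add: powr_realpow[symmetric] powr_powr mult_ac)
      also have "Q * \<dots> \<le> Q * 2 powr - (4 * real n)"
      proof (intro mult_left_mono Q powr_mono)
        have "4 * real n \<le> (2 * (real k * (h1 - g))) * real n" using k by (intro mult_right_mono) auto
        then show "- (2 * (real k * (h1 - g)) * real n) \<le> - (4 * real n)" by simp
      qed auto
      also have "2 powr - (4 * real n) = (2 powr - 4) powr real n" by (simp add: powr_powr)
      also have "\<dots> = (1/16) ^ n" by (simp add: powr_minus powr_realpow)
      finally show "c n ^ (2 * k) * (enn2real V ^ k * m) \<le> Q * (1/16) ^ n" .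
    qed
    finally show ?thesis .
  qed
  have m1: "(\<lambda>\<omega>. \<Sum>i\<in>I n. \<Sum>j\<le>2 ^ n. ennreal ((c n * Z n i j \<omega>) ^ (2 * k))) \<in> borel_measurable M" for n
    using Zm by (intro borel_measurable_sum measurable_compose[OF _ measurable_ennreal] borel_measurable_power borel_measurable_times) auto
  have "(\<integral>\<^sup>+\<omega>. T \<omega> \<partial>M) = (\<Sum>n. \<integral>\<^sup>+\<omega>. (\<Sum>i\<in>I n. \<Sum>j\<le>2 ^ n. ennreal ((c n * Z n i j \<omega>) ^ (2 * k))) \<partial>M)"
    unfolding T_def by (rule nn_integral_suminf[OF m1])
  also have "\<dots> \<le> (\<Sum>n. ennreal (4 * real N * Q * (1/4) ^ n))"
  proof (intro suminf_le)
    fix n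
    have "(\<integral>\<^sup>+\<omega>. (\<Sum>i\<in>I n. \<Sum>j\<le>2 ^ n. ennreal ((c n * Z n i j \<omega>) ^ (2 * k))) \<partial>M)
        = (\<Sum>i\<in>I n. \<Sum>j\<le>2 ^ n. \<integral>\<^sup>+\<omega>. ennreal ((c n * Z n i j \<omega>) ^ (2 * k)) \<partial>M)"
    proof -
      have Tm: "(\<lambda>\<omega>. ennreal ((c n * Z n i j \<omega>) ^ (2 * k))) \<in> borel_measurable M" if "j \<in> {..2 ^ n}" for i j
        using Zm that by (intro measurable_compose[OF _ measurable_ennreal] borel_measurable_power borel_measurable_times) auto
      have "(\<integral>\<^sup>+\<omega>. (\<Sum>i\<in>I n. \<Sum>j\<le>2 ^ n. ennreal ((c n * Z n i j \<omega>) ^ (2 * k))) \<partial>M)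
          = (\<Sum>i\<in>I n. \<integral>\<^sup>+\<omega>. (\<Sum>j\<le>2 ^ n. ennreal ((c n * Z n i j \<omega>) ^ (2 * k))) \<partial>M)"
        by (rule nn_integral_sum, rule borel_measurable_sum, rule Tm)
      also have "\<dots> = (\<Sum>i\<in>I n. \<Sum>j\<le>2 ^ n. \<integral>\<^sup>+\<omega>. ennreal ((c n * Z n i j \<omega>) ^ (2 * k)) \<partial>M)"
        by (rule sum.cong[OF refl], rule nn_integral_sum, rule Tm)
      finally show ?thesis .
    qed
    also have "\<dots> \<le> (\<Sum>i\<in>I n. \<Sum>j\<le>(2::nat) ^ n. ennreal (Q * (1/16) ^ n))"
      by (intro sum_mono EZ) auto
    also have "\<dots> = ennreal (real (card (I n)) * (real (2 ^ n + 1) * (Q * (1/16) ^ n)))"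
      using Q by (simp add: ennreal_mult ennreal_of_nat_eq_real_of_nat ennreal_plus)
    also have "\<dots> \<le> ennreal (4 * real N * Q * (1/4) ^ n)"
    proof (rule ennreal_leI)
      have "card (I n) = 2 * N * 2 ^ n"
      proof -
        have "card (I n) = nat (int N * 2 ^ n + int N * 2 ^ n)" by (simp add: I_def)
        also have "\<dots> = nat (int (2 * N * 2 ^ n))" by simp
        finally show ?thesis by (simp only: nat_int)
      qed
      then have "real (card (I n)) * (real (2 ^ n + 1) * (Q * (1/16) ^ n))
          = (2 * real N * 2 ^ n) * ((2 ^ n + 1) * (Q * (1/16) ^ n))" by simp
      also have "\<dots> \<le> (2 * real N * 2 ^ n) * ((2 * 2 ^ n) * (Q * (1/16) ^ n))"
        using Q by (intro mult_left_mono mult_right_mono) auto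
      also have "\<dots> = 4 * real N * Q * (2 * 2 * (1/16)) ^ n"
        by (simp only: power_mult_distrib) (simp add: mult_ac)
      finally show "real (card (I n)) * (real (2 ^ n + 1) * (Q * (1/16) ^ n)) \<le> 4 * real N * Q * (1/4) ^ n" by simp
    qed
    finally show "(\<integral>\<^sup>+\<omega>. (\<Sum>i\<in>I n. \<Sum>j\<le>2 ^ n. ennreal ((c n * Z n i j \<omega>) ^ (2 * k))) \<partial>M)
        \<le> ennreal (4 * real N * Q * (1/4) ^ n)" .
  qed auto
  also have "\<dots> < \<infinity>"
  proof -
    have "summable (\<lambda>n. 4 * real N * Q * (1/4 :: real) ^ n)" by (intro summable_mult summable_geometric) auto
    then have "(\<Sum>n. ennreal (4 * real N * Q * (1/4) ^ n)) \<noteq> top" using Q by (intro ennreal_suminf_neq_top) auto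
    then show ?thesis by (simp add: less_top)
  qed
  finally have "(\<integral>\<^sup>+\<omega>. T \<omega> \<partial>M) \<noteq> \<infinity>" by simp
  moreover have "T \<in> borel_measurable M" unfolding T_def[abs_def] by (rule borel_measurable_suminf_order[OF m1])
  ultimately have "AE \<omega> in M. T \<omega> \<noteq> \<infinity>" by (intro nn_integral_noteq_infinite)
  then show ?thesis
  proof eventually_elim
    case (elim \<omega>)
    obtain R where R: "T \<omega> = ennreal R" "0 \<le> R" using elim by (cases "T \<omega>") auto
    have "\<bar>Z n i j \<omega>\<bar> \<le> (1 + R) * 2 powr - (g * real n)" if i: "i \<in> I n" and j: "j \<le> 2 ^ n" for n i j
    proof -
      let ?t = "\<lambda>n i j. ennreal ((c n * Z n i j \<omega>) ^ (2 * k))"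
      have "?t n i j \<le> (\<Sum>j\<le>2 ^ n. ?t n i j)" using j by (intro member_le_sum) auto
      also have "\<dots> \<le> (\<Sum>i\<in>I n. \<Sum>j\<le>2 ^ n. ?t n i j)" using i by (intro member_le_sum[of i]) (auto simp: I_def)
      also have "\<dots> = (\<Sum>n\<in>{n}. \<Sum>i\<in>I n. \<Sum>j\<le>2 ^ n. ?t n i j)" by simp
      also have "\<dots> \<le> T \<omega>" unfolding T_def by (intro sum_le_suminf) auto
      finally have "(c n * Z n i j \<omega>) ^ (2 * k) \<le> R" unfolding R(1) using R(2) by (simp add: ennreal_le_iff)
      then have "\<bar>c n * Z n i j \<omega>\<bar> \<le> 1 + R" using k0 R(2) by (intro abs_le_of_even_power_le)
      then have "c n * \<bar>Z n i j \<omega>\<bar> \<le> 1 + R" by (simp add: abs_mult c_def)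
      then show ?thesis by (simp add: c_def powr_minus field_simps)
    qed
    then show ?case using R(2) unfolding Z_def I_def hj_def by (intro exI[of _ "1 + R"]) auto
  qed
qed

text \<open>The exceptional null set is common to all \<open>H\<close>: at level \<open>n\<close>,
  \<open>H\<close> is replaced by the grid point just below it, which by the Lipschitz bound costs
  at most \<open>L * 2 powr - (g * real n)\<close> at each end of the time step. Hence the constant
  \<open>R + 2 * L\<close>; chaining then takes place at fixed \<open>H\<close>.\<close>

lemma field_hoelder_AE:
  assumes B: "fractional_brownian_field_version M W ap am B" and smooth: "AE \<omega> in M. jointly_smooth_in_H (\<lambda>t H. B t H \<omega>)"
    and h: "0 < h1" "h1 < h2" "h2 < 1" and g: "0 < g" "g < h1"
  shows "AE \<omega> in M. \<exists>K\<ge>0. \<forall>H u v. h1 \<le> H \<longrightarrow> H \<le> h2 \<longrightarrow> \<bar>u\<bar> \<le> real N \<longrightarrow> \<bar>v\<bar> \<le> real N \<longrightarrow> \<bar>u - v\<bar> \<le> 1 \<longrightarrow>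
     \<bar>B u H \<omega> - B v H \<omega>\<bar> \<le> K * \<bar>u - v\<bar> powr g"
  using smooth field_dyadic_increments_AE[OF B h g, of N]
proof eventually_elim
  case (elim \<omega>)
  obtain R where R: "0 \<le> R" and inc: "\<And>n i j. i \<in> {- (int N * 2 ^ n)..<int N * 2 ^ n} \<Longrightarrow> j \<le> 2 ^ n \<Longrightarrow>
     \<bar>B ((real_of_int i + 1) / 2 ^ n) (h1 + (h2 - h1) * real j / 2 ^ n) \<omega> - B (real_of_int i / 2 ^ n) (h1 + (h2 - h1) * real j / 2 ^ n) \<omega>\<bar>
       \<le> R * 2 powr - (g * real n)"
    using elim(2) by blast
  obtain L where L: "0 \<le> L" and lip: "\<And>t H H'. \<bar>t\<bar> \<le> real N \<Longrightarrow> h1 \<le> H \<Longrightarrow> H \<le> h2 \<Longrightarrow> h1 \<le> H' \<Longrightarrow> H' \<le> h2 \<Longrightarrow>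
      \<bar>B t H \<omega> - B t H' \<omega>\<bar> \<le> L * \<bar>H - H'\<bar>"
    using jointly_smooth_lipschitz[OF elim(1) h(1,3), of "real N"] by blast
  define K where "K = (R + 2 * L) * (1 + 2 / (1 - 2 powr - g)) * 2 powr g"
  have "\<bar>B u H \<omega> - B v H \<omega>\<bar> \<le> K * \<bar>u - v\<bar> powr g"
    if H: "h1 \<le> H" "H \<le> h2" and uv: "\<bar>u\<bar> \<le> real N" "\<bar>v\<bar> \<le> real N" "\<bar>u - v\<bar> \<le> 1" for H u v
    unfolding K_def
  proof (rule dyadic_hoelder[where f = "\<lambda>t. B t H \<omega>" and N = N])
    show "continuous_on {- real N..real N} (\<lambda>t. B t H \<omega>)"
      using jointly_smooth_continuous_comp[OF elim(1), of _ "\<lambda>_. H"] H h by auto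
    fix n and i :: int
    assume i: "- real N \<le> real_of_int i / 2 ^ n" "(real_of_int i + 1) / 2 ^ n \<le> real N"
    have "real_of_int (- (int N * 2 ^ n)) \<le> real_of_int i" using i(1) by (simp add: field_simps)
    moreover have "real_of_int (i + 1) \<le> real_of_int (int N * 2 ^ n)" using i(2) by (simp add: field_simps)
    ultimately have iI: "i \<in> {- (int N * 2 ^ n)..<int N * 2 ^ n}" by (simp only: of_int_le_iff) simp
    \<comment> \<open>The position of \<open>H\<close> in units of the grid of level
      \<open>n\<close>; its floor is the index of the grid point \<open>G\<close>.\<close>
    define x where "x = (H - h1) / (h2 - h1) * 2 ^ n"
    have x: "0 \<le> x" "x \<le> 2 ^ n" using H h by (auto simp: x_def divide_le_eq)
    define j where "j = nat \<lfloor>x\<rfloor>"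
    have j: "real j \<le> x" "x \<le> real j + 1" using x(1) unfolding j_def by linarith+
    have "real j \<le> 2 ^ n" using j x by linarith
    then have "real j \<le> real (2 ^ n)" by (simp only: of_nat_power of_nat_numeral)
    then have j2: "j \<le> 2 ^ n" by (simp only: of_nat_le_iff)
    define G where "G = h1 + (h2 - h1) * real j / 2 ^ n"
    have Hx: "H = h1 + (h2 - h1) * x / 2 ^ n" using h by (simp add: x_def)
    have HG: "H - G = (h2 - h1) * ((x - real j) / 2 ^ n)"
      unfolding Hx G_def by (simp add: diff_divide_distrib right_diff_distrib)
    have xj: "0 \<le> (x - real j) / 2 ^ n" "(x - real j) / 2 ^ n \<le> 1 / 2 ^ n" using j by (auto intro: divide_right_mono)
    have "0 \<le> H - G" unfolding HG using xj h by (intro mult_nonneg_nonneg) auto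
    moreover have "H - G \<le> 1 * (1 / 2 ^ n)" unfolding HG using xj h by (intro mult_mono) auto
    ultimately have HG': "\<bar>H - G\<bar> \<le> 2 powr - real n" by (simp add: powr_minus powr_realpow field_simps)
    also have "\<dots> \<le> 2 powr - (g * real n)"
    proof (intro powr_mono)
      have "g * real n \<le> 1 * real n" using g h by (intro mult_right_mono) auto
      then show "- real n \<le> - (g * real n)" by simp
    qed simp
    finally have HG'': "\<bar>H - G\<bar> \<le> 2 powr - (g * real n)" .
    have G: "h1 \<le> G" "G \<le> h2"
    proof -
      show "h1 \<le> G" using h by (simp add: G_def)
      show "G \<le> h2" using \<open>0 \<le> H - G\<close> H by simp
    qed
    have n1: "real_of_int i / 2 ^ n \<le> (real_of_int i + 1) / 2 ^ n" by (simp add: divide_right_mono)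
    have l1: "\<bar>B ((real_of_int i + 1) / 2 ^ n) H \<omega> - B ((real_of_int i + 1) / 2 ^ n) G \<omega>\<bar> \<le> L * 2 powr - (g * real n)"
      using i n1 H G HG'' L by (intro order_trans[OF lip] mult_left_mono) (auto simp: abs_le_iff)
    have l2: "\<bar>B (real_of_int i / 2 ^ n) H \<omega> - B (real_of_int i / 2 ^ n) G \<omega>\<bar> \<le> L * 2 powr - (g * real n)"
      using i n1 H G HG'' L by (intro order_trans[OF lip] mult_left_mono) (auto simp: abs_le_iff)
    have l3: "\<bar>B ((real_of_int i + 1) / 2 ^ n) G \<omega> - B (real_of_int i / 2 ^ n) G \<omega>\<bar> \<le> R * 2 powr - (g * real n)"
      using inc[OF iI j2] by (simp add: G_def)
    show "\<bar>B ((real_of_int i + 1) / 2 ^ n) H \<omega> - B (real_of_int i / 2 ^ n) H \<omega>\<bar> \<le> (R + 2 * L) * 2 powr - (g * real n)"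
      using l1 l2 l3 by (simp add: distrib_right)
  qed (use g R L uv in \<open>auto simp: abs_le_iff\<close>)
  moreover have "0 \<le> K"
  proof -
    have "2 powr - g \<le> (1::real)" using powr_mono[of "- g" 0 2] g by simp
    then show ?thesis using R L by (simp add: K_def)
  qed
  ultimately show ?case by (intro exI[of _ K]) auto
qed

end

section \<open>Local dimension of the graph\<close>

lemma local_graph_dim_le:
  assumes "0 < r" shows "local_graph_dim d f t \<le> hausdorff_dim d (graph_on f (ball t r))"
proof (rule tendsto_upperbound[OF local_graph_dim_tendsto])
  have "hausdorff_dim d (graph_on f (ball t x)) \<le> hausdorff_dim d (graph_on f (ball t r))" if "x < r" for x
    by (rule hausdorff_dim_mono) (use that in \<open>auto simp: graph_on_def\<close>)
  then show "\<forall>\<^sub>F x in at_right 0. hausdorff_dim d (graph_on f (ball t x)) \<le> hausdorff_dim d (graph_on f (ball t r))"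
    using assms unfolding eventually_at_right_field by (intro exI[of _ r]) auto
qed simp

lemma local_graph_dim_ge:
  assumes "\<And>r. 0 < r \<Longrightarrow> a \<le> hausdorff_dim d (graph_on f (ball t r))" shows "a \<le> local_graph_dim d f t"
proof (rule tendsto_lowerbound[OF local_graph_dim_tendsto])
  show "\<forall>\<^sub>F r in at_right 0. a \<le> hausdorff_dim d (graph_on f (ball t r))"
    using assms unfolding eventually_at_right_field by (intro exI[of _ 1]) auto
qed simp

lemma local_graph_dim_less:
  assumes "local_graph_dim d f t < a" shows "\<exists>r>0. hausdorff_dim d (graph_on f (ball t r)) < a"
proof -
  have "\<forall>\<^sub>F r in at_right 0. hausdorff_dim d (graph_on f (ball t r)) < a"
    using order_tendstoD(2)[OF local_graph_dim_tendsto assms] .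
  then obtain b where "0 < b" "\<forall>r>0. r < b \<longrightarrow> hausdorff_dim d (graph_on f (ball t r)) < a"
    unfolding eventually_at_right_field by auto
  then show ?thesis by (intro exI[of _ "b / 2"]) auto
qed

lemma local_graph_dim_parabolic_ge:
  assumes "0 < h" shows "ereal (1 / h) \<le> local_graph_dim (parabolic_dist h) H t"
proof (rule local_graph_dim_ge)
  fix r :: real assume r: "0 < r"
  have "{t - r / 2..t + r / 2} \<subseteq> ball t r" using r by (auto simp: dist_real_def abs_less_iff)
  then show "ereal (1 / h) \<le> hausdorff_dim (parabolic_dist h) (graph_on H (ball t r))"
    using r by (intro hausdorff_dim_parabolic_graph_ge[OF assms, of "t - r / 2" "t + r / 2"]) auto
qed

text \<open>Both bounds are tested on real \<open>s\<close> close to \<open>d\<close>, so the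
  identity also covers \<open>d = \<infinity>\<close>. The hypothesis \<open>1 < d\<close> leaves
  room for admissible \<open>s\<close> below \<open>d\<close>, as the lower bound is given for
  \<open>s > 1\<close>.\<close>

lemma affine_ereal_eqI:
  fixes d L :: ereal
  assumes h: "0 < h" and d: "1 < d"
    and up: "\<And>s. d < ereal s \<Longrightarrow> L \<le> ereal (1 + h * (s - 1))"
    and lo: "\<And>s. 1 < s \<Longrightarrow> ereal s < d \<Longrightarrow> ereal (1 + h * (s - 1)) \<le> L"
  shows "L = 1 + ereal h * (d - 1)"
proof (cases d)
  case PInf
  have "ereal B \<le> L" for B
  proof -
    define s where "s = 1 + \<bar>B\<bar> / h + 1"
    have "1 < s" using h by (simp add: s_def add_pos_nonneg)
    then have "ereal (1 + h * (s - 1)) \<le> L" using PInf by (intro lo) auto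
    moreover have "B \<le> 1 + h * (s - 1)" using h by (simp add: s_def distrib_left)
    ultimately show ?thesis by (meson ereal_less_eq(3) order_trans)
  qed
  then have "L = \<infinity>" by (rule ereal_top)
  then show ?thesis using PInf h by simp
next
  case (real D)
  have D: "1 < D" using d real by (simp add: one_ereal_def)
  have "L \<le> ereal (1 + h * (D - 1))"
  proof (rule ereal_le_epsilon2)
    fix e :: real assume e: "0 < e"
      have "L \<le> ereal (1 + h * ((D + e / h) - 1))" using e h real by (intro up) auto
      also have "1 + h * ((D + e / h) - 1) = 1 + h * (D - 1) + e" using h by (simp add: algebra_simps)
      finally show "L \<le> ereal (1 + h * (D - 1)) + ereal e" by simp
  qed
  moreover have "ereal (1 + h * (D - 1)) \<le> L"
  proof (rule ereal_le_epsilon2)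
    fix e :: real assume e: "0 < e"
      \<comment> \<open>The midpoint of \<open>1\<close> and \<open>D\<close> keeps \<open>s\<close>
        above \<open>1\<close> when \<open>e\<close> is large.\<close>
      define s where "s = max ((1 + D) / 2) (D - e / h)"
      have s: "1 < s" "s < D" "D - e / h \<le> s" proof -
        have "0 < e / h" using e h by simp
        then show "1 < s" "s < D" "D - e / h \<le> s"
          unfolding s_def less_max_iff_disj max_less_iff_conj using D by auto
      qed
      have "ereal (1 + h * (s - 1)) \<le> L" using s real by (intro lo) auto
      moreover have "1 + h * (D - 1) \<le> 1 + h * (s - 1) + e"
      proof -
        have "h * (D - e / h) \<le> h * s" using s h by (intro mult_left_mono) auto
        then show ?thesis using h by (simp add: algebra_simps)
      qed
      ultimately show "ereal (1 + h * (D - 1)) \<le> L + ereal e"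
        by (cases L) auto
  qed
  ultimately have "L = ereal (1 + h * (D - 1))" by (rule antisym)
  then show ?thesis by (simp add: real one_ereal_def)
qed (use d in auto)

text \<open>Rationals \<open>g < h1 < H t < h2\<close> put a neighbourhood of \<open>t\<close> in
  the range of the uniform Hoelder bound of exponent \<open>g\<close>. Replacing \<open>H t\<close>
  by \<open>g\<close> turns \<open>s\<close> into \<open>H t / g * s\<close>; as
  \<open>g * (H t / g * s) = H t * s\<close>, the exponent obtained exceeds the desired one by
  little more than \<open>H t - g\<close>.\<close>

lemma local_graph_dim_upper:
  fixes b :: "real \<Rightarrow> real \<Rightarrow> real" and H :: "real \<Rightarrow> real"
  assumes b: "jointly_smooth_in_H b" and H: "isCont H t" "0 < H t" "H t < 1"
    and hoelder: "\<And>N h1 h2 g. h1 \<in> \<rat> \<Longrightarrow> h2 \<in> \<rat> \<Longrightarrow> g \<in> \<rat> \<Longrightarrow> 0 < g \<Longrightarrow> g < h1 \<Longrightarrow> h1 < h2 \<Longrightarrow> h2 < 1 \<Longrightarrow>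
      \<exists>K\<ge>0. \<forall>h u v. h1 \<le> h \<longrightarrow> h \<le> h2 \<longrightarrow> \<bar>u\<bar> \<le> real N \<longrightarrow> \<bar>v\<bar> \<le> real N \<longrightarrow> \<bar>u - v\<bar> \<le> 1 \<longrightarrow>
        \<bar>b u h - b v h\<bar> \<le> K * \<bar>u - v\<bar> powr g"
    and s: "local_graph_dim (parabolic_dist (H t)) H t < ereal s"
  shows "local_graph_dim dist (\<lambda>u. b u (H u)) t \<le> ereal (1 + H t * (s - 1))"
proof (rule ereal_le_epsilon2)
  fix e :: real assume e: "0 < e"
  define h where "h = H t"
  have h: "0 < h" "h < 1" using H by (auto simp: h_def)
  obtain g where g: "g \<in> \<rat>" "max 0 (h - e / 2) < g" "g < h"
    using Rats_dense_in_real[of "max 0 (h - e / 2)" h] h e by auto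
  obtain h1 where h1: "h1 \<in> \<rat>" "g < h1" "h1 < h" using Rats_dense_in_real[OF g(3)] by blast
  obtain h2 where h2: "h2 \<in> \<rat>" "h < h2" "h2 < 1" using Rats_dense_in_real[OF h(2)] by blast
  obtain r0 where r0: "0 < r0" "hausdorff_dim (parabolic_dist h) (graph_on H (ball t r0)) < ereal s"
    using local_graph_dim_less[OF s] unfolding h_def by blast
  obtain r1 where r1: "0 < r1" "\<And>u. dist u t < r1 \<Longrightarrow> dist (H u) (H t) < min (h - h1) (h2 - h)"
    using H(1) h1 h2 unfolding continuous_at_eps_delta by (metis diff_gt_0_iff_gt min_less_iff_conj)
  define N where "N = nat \<lceil>\<bar>t\<bar>\<rceil> + 1"
  have N: "\<bar>t\<bar> + 1 \<le> real N" unfolding N_def by linarith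
  obtain K where K: "0 \<le> K" "\<And>h u v. h1 \<le> h \<Longrightarrow> h \<le> h2 \<Longrightarrow> \<bar>u\<bar> \<le> real N \<Longrightarrow> \<bar>v\<bar> \<le> real N \<Longrightarrow> \<bar>u - v\<bar> \<le> 1 \<Longrightarrow>
        \<bar>b u h - b v h\<bar> \<le> K * \<bar>u - v\<bar> powr g"
    using hoelder[OF h1(1) h2(1) g(1), of N] g h1 h2 h by auto
  obtain L where L: "0 \<le> L" "\<And>u h h'. \<bar>u\<bar> \<le> real N \<Longrightarrow> h1 \<le> h \<Longrightarrow> h \<le> h2 \<Longrightarrow> h1 \<le> h' \<Longrightarrow> h' \<le> h2 \<Longrightarrow> \<bar>b u h - b u h'\<bar> \<le> L * \<bar>h - h'\<bar>"
    using jointly_smooth_lipschitz[OF b, of h1 h2 "real N"] g h1 h2 by auto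
  define r where "r = min (min r0 r1) (1/2)"
  have r: "0 < r" "r \<le> r0" "r \<le> r1" "r \<le> 1/2" using r0 r1 by (auto simp: r_def)
  define V where "V = ball t r"
  have V: "h1 \<le> H u \<and> H u \<le> h2 \<and> \<bar>u\<bar> \<le> real N \<and> \<bar>u - t\<bar> < 1/2" if "u \<in> V" for u
  proof -
    have u: "\<bar>u - t\<bar> < r" using that by (simp add: V_def dist_real_def abs_minus_commute)
    then have "\<bar>H u - h\<bar> < min (h - h1) (h2 - h)" using r1(2)[of u] r(3) by (simp add: dist_real_def h_def)
    then have "\<bar>H u - h\<bar> < h - h1" "\<bar>H u - h\<bar> < h2 - h" by auto
    then have "h1 \<le> H u" "H u \<le> h2" by linarith+
    moreover have "\<bar>u - t\<bar> < 1/2" using u r(4) by linarith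
    moreover have "\<bar>u\<bar> \<le> real N" using \<open>\<bar>u - t\<bar> < 1/2\<close> N by linarith
    ultimately show ?thesis by blast
  qed
  have inc: "\<bar>b u (H u) - b v (H v)\<bar> \<le> (K + L) * parabolic_dist g (u, H u) (v, H v)" if uv: "u \<in> V" "v \<in> V" for u v
  proof -
    let ?p = "parabolic_dist g (u, H u) (v, H v)"
    have "\<bar>u - v\<bar> \<le> 1" using V[OF uv(1)] V[OF uv(2)] by linarith
    then have "\<bar>b u (H u) - b v (H u)\<bar> \<le> K * \<bar>u - v\<bar> powr g" using V[OF uv(1)] V[OF uv(2)] by (intro K(2)) auto
    also have "\<dots> \<le> K * ?p" using K(1) by (intro mult_left_mono) (auto simp: parabolic_dist_def)
    finally have 1: "\<bar>b u (H u) - b v (H u)\<bar> \<le> K * ?p" .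
    have "\<bar>b v (H u) - b v (H v)\<bar> \<le> L * \<bar>H u - H v\<bar>" using V[OF uv(1)] V[OF uv(2)] by (intro L(2)) auto
    also have "\<dots> \<le> L * ?p" using L(1) by (intro mult_left_mono) (auto simp: parabolic_dist_def)
    finally have 2: "\<bar>b v (H u) - b v (H v)\<bar> \<le> L * ?p" .
    have "(K + L) * ?p = K * ?p + L * ?p" by (rule distrib_right)
    then show ?thesis using 1 2 by linarith
  qed
  have "graph_on H V \<subseteq> graph_on H (ball t r0)" using r(2) by (auto simp: graph_on_def V_def)
  then have "hausdorff_dim (parabolic_dist h) (graph_on H V) < ereal s"
    by (rule le_less_trans[OF hausdorff_dim_mono r0(2)])
  then have "hausdorff_dim (parabolic_dist g) (graph_on H V) \<le> ereal (h / g * s)"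
    using g by (intro hausdorff_dim_parabolic_le) auto
  \<comment> \<open>The summand \<open>e / 2\<close> restores the strict inequality required by the
    graph bound.\<close>
  also have "\<dots> < ereal (h / g * s + e / 2)" using e by simp
  finally have "hausdorff_dim dist (graph_on (\<lambda>u. b u (H u)) V) \<le> ereal (1 + g * (h / g * s + e / 2 - 1))"
    using g h K(1) L(1) by (intro hausdorff_dim_graph_le[where K = "K + L" and H = H] inc) auto
  also have "\<dots> \<le> ereal (1 + h * (s - 1) + e)"
  proof -
    have "g * (h / g * s + e / 2 - 1) = h * s + g * (e / 2) - g" using g by (simp add: algebra_simps)
    moreover have "g * (e / 2) \<le> 1 * (e / 2)" using g h e by (intro mult_right_mono) auto
    moreover have "h - e / 2 < g" using g by simp
    ultimately have "1 + g * (h / g * s + e / 2 - 1) \<le> 1 + (h * s - h) + e" by linarith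
    then show ?thesis by (simp add: algebra_simps)
  qed
  finally have "hausdorff_dim dist (graph_on (\<lambda>u. b u (H u)) V) \<le> ereal (1 + h * (s - 1)) + ereal e" by simp
  then show "local_graph_dim dist (\<lambda>u. b u (H u)) t \<le> ereal (1 + H t * (s - 1)) + ereal e"
    using local_graph_dim_le[OF r(1), of dist "\<lambda>u. b u (H u)" t] unfolding V_def h_def by (rule order_trans[rotated])
qed

text \<open>A condition without randomness. It serves as a premise under the quantifier over
  rational intervals and exponents, for which it may fail, while the almost sure event is chosen
  independently of \<open>t\<close>.\<close>

definition increments_nondegenerate :: "real \<Rightarrow> real \<Rightarrow> (real \<Rightarrow> real) \<Rightarrow> real set \<Rightarrow> real \<Rightarrow> bool" where
  "increments_nondegenerate ap am H V h \<longleftrightarrow> (\<exists>c>0. \<forall>t\<in>V. \<forall>u\<in>V. ennreal (c * (max (\<bar>t - u\<bar> powr h) \<bar>H t - H u\<bar>)\<^sup>2)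
      \<le> (\<integral>\<^sup>+x. ennreal ((field_kernel ap am t (H t) x - field_kernel ap am u (H u) x)\<^sup>2) \<partial>lborel))"

text \<open>A rational \<open>h' > H t\<close> is taken because the variance bound asks that
  \<open>H\<close> be at most \<open>h'\<close> on the interval. The exponent \<open>s\<close>
  shrinks to \<open>S = H t * s / h'\<close>; as \<open>h' * S = H t * s\<close>, the change of
  exponent costs only \<open>h' - H t\<close>.\<close>

lemma local_graph_dim_lower:
  fixes x H :: "real \<Rightarrow> real"
  assumes H: "isCont H t" "0 < H t" "H t < 1" and t: "t \<noteq> 0" and a: "ap \<noteq> am"
    and lower: "\<And>p q h s s'. p \<in> \<rat> \<Longrightarrow> q \<in> \<rat> \<Longrightarrow> h \<in> \<rat> \<Longrightarrow> s \<in> \<rat> \<Longrightarrow> s' \<in> \<rat> \<Longrightarrow> q - p \<le> 1 \<Longrightarrow> 0 < h \<Longrightarrow> h < 1 \<Longrightarrow> 1 < s' \<Longrightarrow>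
      s' < 1 + h * (s - 1) \<Longrightarrow> increments_nondegenerate ap am H {p..q} h \<Longrightarrow>
      hausdorff_outer (parabolic_dist h) s (graph_on H {p..q}) = \<infinity> \<Longrightarrow> ereal s' \<le> hausdorff_dim dist (graph_on x {p..q})"
    and s: "1 < s" "ereal s < local_graph_dim (parabolic_dist (H t)) H t"
  shows "ereal (1 + H t * (s - 1)) \<le> local_graph_dim dist x t"
proof (rule local_graph_dim_ge)
  fix r :: real assume r: "0 < r"
  define h where "h = H t"
  have h: "0 < h" "h < 1" using H by (auto simp: h_def)
  obtain \<delta> c where \<delta>: "0 < \<delta>" and c: "0 < c" and var: "\<And>u v k k' g. \<bar>u - t\<bar> < \<delta> \<Longrightarrow> \<bar>v - t\<bar> < \<delta> \<Longrightarrow> \<bar>k - h\<bar> < \<delta> \<Longrightarrow> \<bar>k' - h\<bar> < \<delta> \<Longrightarrow>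
    k \<le> g \<Longrightarrow> k' \<le> g \<Longrightarrow> g < h + \<delta> \<Longrightarrow>
    ennreal (c * (max (\<bar>u - v\<bar> powr g) \<bar>k - k'\<bar>)\<^sup>2)
      \<le> (\<integral>\<^sup>+z. ennreal ((field_kernel ap am u k z - field_kernel ap am v k' z)\<^sup>2) \<partial>lborel)"
    using field_kernel_lower[OF h a t] by blast
  show "ereal (1 + H t * (s - 1)) \<le> hausdorff_dim dist (graph_on x (ball t r))"
  proof (rule ereal_le_epsilon2)
    fix e :: real assume e: "0 < e"
    \<comment> \<open>In order: \<open>h'\<close> is an admissible exponent, the variance bound
      applies to it, the loss is below \<open>e / 4\<close>, and \<open>S\<close> stays above
      \<open>1\<close>.\<close>
    have "h < min (min 1 (h + \<delta>)) (min (h + e / 4) (h * s))" using h \<delta> e s by simp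
    from Rats_dense_in_real[OF this] obtain h' where h': "h' \<in> \<rat>" "h < h'" "h' < 1" "h' < h + \<delta>" "h' < h + e / 4" "h' < h * s"
      by auto
    have h'0: "0 < h'" using h h' by linarith
    define S where "S = h * s / h'"
    have S: "1 < S" "h' * S = h * s" using h' h'0 by (simp_all add: S_def)
    have "max 1 (S - e / 4) < S" using S e by simp
    from Rats_dense_in_real[OF this] obtain s1 where s1: "s1 \<in> \<rat>" "1 < s1" "S - e / 4 < s1" "s1 < S" by auto
    have "max 1 (1 + h' * (s1 - 1) - e / 4) < 1 + h' * (s1 - 1)" using s1 h'0 e by simp
    from Rats_dense_in_real[OF this] obtain s' where s': "s' \<in> \<rat>" "1 < s'" "1 + h' * (s1 - 1) - e / 4 < s'" "s' < 1 + h' * (s1 - 1)"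
      by auto
    \<comment> \<open>Three losses of at most \<open>e / 4\<close> each: in \<open>h'\<close>
      against \<open>h\<close>, in \<open>s1\<close> against \<open>S\<close>, and in
      \<open>s'\<close>.\<close>
    have fin: "1 + h * (s - 1) \<le> s' + e"
    proof -
      have "h' * (S - e / 4) \<le> h' * s1" using s1 h'0 by (intro mult_left_mono) auto
      moreover have "h' * (e / 4) \<le> 1 * (e / 4)" using h' e by (intro mult_right_mono) auto
      ultimately have "h * s - e / 4 \<le> h' * s1" using S(2) by (simp add: right_diff_distrib)
      then have "1 + (h * s - h) \<le> s' + e" using s'(3) h'(5) e unfolding right_diff_distrib by linarith
      then show ?thesis by (simp add: algebra_simps)
    qed
    obtain r1 where r1: "0 < r1" "\<And>u. dist u t < r1 \<Longrightarrow> dist (H u) (H t) < min \<delta> (h' - h)"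
      using H(1) \<delta> h'(2) unfolding continuous_at_eps_delta by (metis diff_gt_0_iff_gt min_less_iff_conj)
    define r2 where "r2 = min (min r r1) (min \<delta> (1/2))"
    have r2: "0 < r2" "r2 \<le> r" "r2 \<le> r1" "r2 \<le> \<delta>" "r2 \<le> 1/2" using r r1 \<delta> by (auto simp: r2_def)
    obtain p where p: "p \<in> \<rat>" "t - r2 < p" "p < t" using Rats_dense_in_real[of "t - r2" t] r2 by auto
    obtain q where q: "q \<in> \<rat>" "t < q" "q < t + r2" using Rats_dense_in_real[of t "t + r2"] r2 by auto
    have V: "\<bar>u - t\<bar> < \<delta> \<and> \<bar>H u - h\<bar> < \<delta> \<and> H u \<le> h'" if u: "u \<in> {p..q}" for u
    proof -
      have "\<bar>u - t\<bar> < r2" using u p q by (auto simp: abs_less_iff)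
      then have "\<bar>u - t\<bar> < r1" "\<bar>u - t\<bar> < \<delta>" using r2 by linarith+
      moreover have "\<bar>H u - h\<bar> < min \<delta> (h' - h)" using r1(2)[of u] \<open>\<bar>u - t\<bar> < r1\<close> by (simp add: dist_real_def h_def)
      then have "\<bar>H u - h\<bar> < \<delta>" "\<bar>H u - h\<bar> < h' - h" by auto
      moreover from this have "H u \<le> h'" by linarith
      ultimately show ?thesis by blast
    qed
    have nd: "increments_nondegenerate ap am H {p..q} h'"
      unfolding increments_nondegenerate_def
    proof (rule exI[of _ c], intro conjI c ballI)
      fix u v assume "u \<in> {p..q}" "v \<in> {p..q}"
      then show "ennreal (c * (max (\<bar>u - v\<bar> powr h') \<bar>H u - H v\<bar>)\<^sup>2)
        \<le> (\<integral>\<^sup>+z. ennreal ((field_kernel ap am u (H u) z - field_kernel ap am v (H v) z)\<^sup>2) \<partial>lborel)"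
        using V[of u] V[of v] h'(4) by (intro var) auto
    qed
    \<comment> \<open>Otherwise returning from \<open>h'\<close> to \<open>h\<close> would bound the
      dimension over \<open>{p..q}\<close> by \<open>h' / h * S = s\<close>, although this interval
      contains a ball around \<open>t\<close>, where the local dimension exceeds
      \<open>s\<close>.\<close>
    have "ereal s1 < hausdorff_dim (parabolic_dist h') (graph_on H {p..q})"
    proof (rule ccontr)
      assume "\<not> ?thesis"
      then have "hausdorff_dim (parabolic_dist h') (graph_on H {p..q}) < ereal S" using s1(4) by (simp add: not_less le_less_trans)
      then have "hausdorff_dim (parabolic_dist h) (graph_on H {p..q}) \<le> ereal (h' / h * S)"
        using h h'(2) by (intro hausdorff_dim_parabolic_le) auto
      also have "h' / h * S = s" using h S(2) by simp
      finally have le: "hausdorff_dim (parabolic_dist h) (graph_on H {p..q}) \<le> ereal s" .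
      define r3 where "r3 = min (t - p) (q - t)"
      have r3: "0 < r3" using p q by (simp add: r3_def)
      have "ball t r3 \<subseteq> {p..q}" by (auto simp: r3_def dist_real_def abs_less_iff)
      then have "graph_on H (ball t r3) \<subseteq> graph_on H {p..q}" by (auto simp: graph_on_def)
      from hausdorff_dim_mono[OF this, of "parabolic_dist h"] local_graph_dim_le[OF r3, of "parabolic_dist h" H t]
      have "local_graph_dim (parabolic_dist h) H t \<le> hausdorff_dim (parabolic_dist h) (graph_on H {p..q})"
        by (rule order_trans[rotated])
      then show False using le s(2) unfolding h_def by (meson leD order_trans)
    qed
    then have out: "hausdorff_outer (parabolic_dist h') s1 (graph_on H {p..q}) = \<infinity>"
      using s1(2) by (intro hausdorff_outer_below_dim) auto
    have qp: "q - p \<le> 1" using p q r2(5) by linarith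
    have "ereal s' \<le> hausdorff_dim dist (graph_on x {p..q})"
      by (rule lower[OF p(1) q(1) h'(1) s1(1) s'(1) qp h'0 h'(3) s'(2) s'(4) nd out])
    also have "\<dots> \<le> hausdorff_dim dist (graph_on x (ball t r))"
    proof (rule hausdorff_dim_mono)
      have "{p..q} \<subseteq> ball t r" using p q r2(2) by (auto simp: dist_real_def abs_less_iff)
      then show "graph_on x {p..q} \<subseteq> graph_on x (ball t r)" by (auto simp: graph_on_def)
    qed
    finally have "ereal s' + ereal e \<le> hausdorff_dim dist (graph_on x (ball t r)) + ereal e" by (intro add_right_mono)
    moreover have "ereal (1 + H t * (s - 1)) \<le> ereal s' + ereal e" using fin by (simp add: h_def)
    ultimately show "ereal (1 + H t * (s - 1)) \<le> hausdorff_dim dist (graph_on x (ball t r)) + ereal e" by (rule order_trans[rotated])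
  qed
qed

theorem theorem4p2:
  fixes M :: "'a measure" and W :: "real set \<Rightarrow> 'a \<Rightarrow> real"
    and ap am :: real and B :: "real \<Rightarrow> real \<Rightarrow> 'a \<Rightarrow> real" and H :: "real \<Rightarrow> real"
  assumes "prob_space M"
    and "white_noise M W"
    and "(ap, am) \<noteq> (0, 0)" and "ap \<noteq> am"
    and "fractional_brownian_field M W ap am B"
    and "continuous_on UNIV H" and "\<And>t. H t \<in> {0<..<1}"
  shows "AE \<omega> in M. \<forall>t \<in> UNIV - {0}.
    local_graph_dim dist (multifractional_brownian_motion B H \<omega>) t =
      1 + ereal (H t) * (local_graph_dim (parabolic_dist (H t)) H t - 1)"
proof -
  interpret white_noise_space M W
    using assms(1,2) by (simp add: white_noise_space_def white_noise_space_axioms_def)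
  have B: "fractional_brownian_field_version M W ap am B"
    and smooth: "AE \<omega> in M. jointly_smooth_in_H (\<lambda>t H. B t H \<omega>)"
    using assms(5) by (auto simp: fractional_brownian_field_def)
  have H: "isCont H t" "0 < H t" "H t < 1" for t
    using assms(6) assms(7)[of t] by (auto simp: continuous_on_eq_continuous_at)
  let ?X = "multifractional_brownian_motion B H"
  have countQ: "countable (\<rat> :: real set)" by (rule countable_rat)
  \<comment> \<open>Quantifying over rationals and naturals keeps the union of the exceptional sets
    null; the side conditions are free of \<open>\<omega>\<close> and pass through the almost
    everywhere quantifier.\<close>
  have hoelder: "AE \<omega> in M. \<forall>N::nat. \<forall>h1\<in>\<rat>. \<forall>h2\<in>\<rat>. \<forall>g\<in>\<rat>. 0 < g \<longrightarrow> g < h1 \<longrightarrow> h1 < h2 \<longrightarrow> h2 < 1 \<longrightarrow>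
      (\<exists>K\<ge>0. \<forall>h u v. h1 \<le> h \<longrightarrow> h \<le> h2 \<longrightarrow> \<bar>u\<bar> \<le> real N \<longrightarrow> \<bar>v\<bar> \<le> real N \<longrightarrow> \<bar>u - v\<bar> \<le> 1 \<longrightarrow>
        \<bar>B u h \<omega> - B v h \<omega>\<bar> \<le> K * \<bar>u - v\<bar> powr g)"
  proof (intro AE_all_countable[THEN iffD2] allI AE_ball_countable[OF countQ, THEN iffD2] ballI AE_impI)
    fix N :: nat and h1 h2 g :: real
    assume "0 < g" "g < h1" "h1 < h2" "h2 < 1"
    then show "AE \<omega> in M. \<exists>K\<ge>0. \<forall>h u v. h1 \<le> h \<longrightarrow> h \<le> h2 \<longrightarrow> \<bar>u\<bar> \<le> real N \<longrightarrow> \<bar>v\<bar> \<le> real N \<longrightarrow> \<bar>u - v\<bar> \<le> 1 \<longrightarrow>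
        \<bar>B u h \<omega> - B v h \<omega>\<bar> \<le> K * \<bar>u - v\<bar> powr g"
      using field_hoelder_AE[OF B smooth, of h1 h2 g N] by simp
  qed
  have lower: "AE \<omega> in M. \<forall>p\<in>\<rat>. \<forall>q\<in>\<rat>. \<forall>h\<in>\<rat>. \<forall>s\<in>\<rat>. \<forall>s'\<in>\<rat>. q - p \<le> 1 \<longrightarrow> 0 < h \<longrightarrow> h < 1 \<longrightarrow> 1 < s' \<longrightarrow>
      s' < 1 + h * (s - 1) \<longrightarrow> increments_nondegenerate ap am H {p..q} h \<longrightarrow>
      hausdorff_outer (parabolic_dist h) s (graph_on H {p..q}) = \<infinity> \<longrightarrow> ereal s' \<le> hausdorff_dim dist (graph_on (?X \<omega>) {p..q})"
  proof (intro AE_ball_countable[OF countQ, THEN iffD2] ballI AE_impI)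
    fix p q h s s' :: real
    assume A: "q - p \<le> 1" "0 < h" "h < 1" "1 < s'" "s' < 1 + h * (s - 1)" "increments_nondegenerate ap am H {p..q} h"
      "hausdorff_outer (parabolic_dist h) s (graph_on H {p..q}) = \<infinity>"
    from A(6) obtain c where c: "0 < c" "\<And>t u. t \<in> {p..q} \<Longrightarrow> u \<in> {p..q} \<Longrightarrow> ennreal (c * (max (\<bar>t - u\<bar> powr h) \<bar>H t - H u\<bar>)\<^sup>2)
      \<le> (\<integral>\<^sup>+x. ennreal ((field_kernel ap am t (H t) x - field_kernel ap am u (H u) x)\<^sup>2) \<partial>lborel)"
      unfolding increments_nondegenerate_def by blast
    have "AE \<omega> in M. continuous_on {p..q} (?X \<omega>)"
      using smooth
    proof eventually_elim
      case (elim \<omega>)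
      have "continuous_on {p..q} H" using assms(6) by (rule continuous_on_subset) simp
      then have "continuous_on {p..q} (\<lambda>t. B t (H t) \<omega>)"
        using jointly_smooth_continuous_comp[OF elim, of "{p..q}" H] H by simp
      then show ?case by (simp add: multifractional_brownian_motion_def[abs_def])
    qed
    then show "AE \<omega> in M. ereal s' \<le> hausdorff_dim dist (graph_on (?X \<omega>) {p..q})"
      using A(1-5,7) c H by (intro graph_dim_ge_AE[OF B, where ?c0.0 = c]) auto
  qed
  \<comment> \<open>The event is now fixed, and every \<open>t\<close> is treated on it
    deterministically.\<close>
  from smooth hoelder lower show ?thesis
  proof eventually_elim
    case (elim \<omega>)
    have X: "?X \<omega> = (\<lambda>u. B u (H u) \<omega>)" by (simp add: multifractional_brownian_motion_def fun_eq_iff)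
    show ?case
    proof
      fix t :: real assume "t \<in> UNIV - {0}"
      then have t: "t \<noteq> 0" by simp
      show "local_graph_dim dist (?X \<omega>) t = 1 + ereal (H t) * (local_graph_dim (parabolic_dist (H t)) H t - 1)"
      proof (rule affine_ereal_eqI)
        show "0 < H t" by (rule H)
        \<comment> \<open>The strict inequality \<open>H t < 1\<close> enters here, to put the local
          parabolic dimension above \<open>1\<close>.\<close>
        have "1 < 1 / H t" using H[of t] by simp
        then have "1 < ereal (1 / H t)" by (simp add: one_ereal_def)
        then show "1 < local_graph_dim (parabolic_dist (H t)) H t"
          using local_graph_dim_parabolic_ge[OF H(2)] by (rule less_le_trans)
        fix s
        show "local_graph_dim dist (?X \<omega>) t \<le> ereal (1 + H t * (s - 1))"
          if "local_graph_dim (parabolic_dist (H t)) H t < ereal s"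
          unfolding X
          by (rule local_graph_dim_upper[where b = "\<lambda>u h. B u h \<omega>", OF elim(1) H _ that]) (use elim(2) in blast)
        show "ereal (1 + H t * (s - 1)) \<le> local_graph_dim dist (?X \<omega>) t"
          if "1 < s" "ereal s < local_graph_dim (parabolic_dist (H t)) H t"
          by (rule local_graph_dim_lower[OF H t assms(4) _ that]) (use elim(3) in blast)
      qed
    qed
  qed
qed

end
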